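(* Assume that $g$ is bounded on $\mathbb{R}^n$, that $Df$ is bounded on $\mathbb{R}^n$, and that the free dynamics $\dot x=f(x)$ is globally exponentially stable. Then, for each $x_0\in\mathbb{R}^n$, there exists an optimal control $\bar u\in L^2((0,\infty);\mathbb{R}^m)$ for the problem of minimizing $J$ over $L^2((0,\infty);\mathbb{R}^m)$ subject to $\dot x=f(x)+g(x)u$, $x(0)=x_0$, and it holds that $x_{\bar u}(t)\to0$ as $t\to\infty$.
   Context: Consider the control system $\dot x=f(x)+g(x)u$, $x(0)=x_0$, where $f:\mathbb{R}^n\to\mathbb{R}^n$ and $g:\mathbb{R}^n\to\mathbb{R}^{n\times m}$ are $C^2$ maps and $f(0)=0$. Solutions are understood in the sense of Carathéodory (absolutely continuous functions satisfying the equation almost everywhere). For $u\in L^2((0,\infty);\mathbb{R}^m)$, $x_u$ denotes the corresponding solution with $x_u(0)=x_0$. The cost functional is $$J(u)=\int_0^\infty \tfrac12|u(t)|^2+h(x_u(t))\,dt\in\mathbb{R}^+\cup\{+\infty\},\qquad u\in L^2((0,\infty);\mathbb{R}^m),$$ where $h:\mathbb{R}^n\to\mathbb{R}$ is locally Lipschitz, $h(x)\geqslant0$ for all $x$, and $h(0)=0$; one sets $J(u)=+\infty$ if the solution for $u$ has finite escape time. An optimal control is a $\bar u\in L^2((0,\infty);\mathbb{R}^m)$ with $J(\bar u)=\inf_{L^2((0,\infty);\mathbb{R}^m)}J$. Global exponential stability of $\dot x=f(x)$: there exist constants $\mu>0$, $K>0$, independent of $x_0$, such that the solution $x(t,x_0)$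 of $\dot x=f(x)$, $x(0)=x_0$, satisfies $|x(t,x_0)|\leqslant K|x_0|e^{-\mu t}$ for all $t\geqslant0$ and $x_0\in\mathbb{R}^n$. *)

theory Defs
  imports "HOL-Analysis.Analysis"
begin

definition C2 :: "('a::real_normed_vector \<Rightarrow> 'b::real_normed_vector) \<Rightarrow> bool" where
  "C2 F \<longleftrightarrow> (\<exists>(D1 :: 'a \<Rightarrow> 'a \<Rightarrow>\<^sub>L 'b) (D2 :: 'a \<Rightarrow> 'a \<Rightarrow>\<^sub>L ('a \<Rightarrow>\<^sub>L 'b)).
     (\<forall>x. (F has_derivative blinfun_apply (D1 x)) (at x)) \<and>
     (\<forall>x. (D1 has_derivative blinfun_apply (D2 x)) (at x)) \<and>
     continuous_on UNIV D2)"

definition locally_lipschitz :: "('a::metric_space \<Rightarrow> 'b::metric_space) \<Rightarrow> bool" where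
  "locally_lipschitz h \<longleftrightarrow> (\<forall>x. \<exists>e>0. \<exists>L. L-lipschitz_on (cball x e) h)"

text \<open>The members of a division are compact intervals \<open>{Inf k..Sup k}\<close> with pairwise disjoint
  interiors.\<close>

definition abs_continuous_on :: "real set \<Rightarrow> (real \<Rightarrow> 'a::real_normed_vector) \<Rightarrow> bool" where
  "abs_continuous_on S x \<longleftrightarrow> (\<forall>\<epsilon>>0. \<exists>\<delta>>0. \<forall>D. D division_of \<Union>D \<and> \<Union>D \<subseteq> S \<and>
     (\<Sum>k\<in>D. Sup k - Inf k) < \<delta> \<longrightarrow> (\<Sum>k\<in>D. norm (x (Sup k) - x (Inf k))) < \<epsilon>)"

text \<open>Caratheodory solutions of \<open>x' = F t x\<close> on an interval \<open>I\<close>. On an unbounded interval,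
  absolute continuity is required on compact subintervals, as usual.\<close>

definition caratheodory_solution ::
    "(real \<Rightarrow> 'a \<Rightarrow> 'a) \<Rightarrow> real set \<Rightarrow> (real \<Rightarrow> 'a::real_normed_vector) \<Rightarrow> bool" where
  "caratheodory_solution F I x \<longleftrightarrow>
     (\<forall>a b. {a..b} \<subseteq> I \<longrightarrow> abs_continuous_on {a..b} x) \<and>
     (AE t in lebesgue. t \<in> I \<longrightarrow> (x has_vector_derivative F t (x t)) (at t within I))"

definition globally_exponentially_stable :: "('a::real_normed_vector \<Rightarrow> 'a) \<Rightarrow> bool" where
  "globally_exponentially_stable f \<longleftrightarrow> (\<exists>\<mu>>0. \<exists>K>0. \<forall>x0.
     (\<exists>x. caratheodory_solution (\<lambda>_. f) {0..} x \<and> x 0 = x0) \<and>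
     (\<forall>x. caratheodory_solution (\<lambda>_. f) {0..} x \<and> x 0 = x0 \<longrightarrow>
        (\<forall>t\<ge>0. norm (x t) \<le> K * norm x0 * exp (- \<mu> * t))))"

text \<open>Square-integrable functions on \<open>(0,\<infinity>)\<close>, not quotiented by almost-everywhere equality;
  trajectories and cost only depend on the class.\<close>

definition L2_controls :: "(real \<Rightarrow> real ^ 'm) set" where
  "L2_controls = {u. u \<in> borel_measurable (lebesgue_on {0<..}) \<and>
     integrable (lebesgue_on {0<..}) (\<lambda>t. (norm (u t))\<^sup>2)}"

definition trajectory_on ::
    "(real ^ 'n \<Rightarrow> real ^ 'n) \<Rightarrow> (real ^ 'n \<Rightarrow> real ^ 'm ^ 'n) \<Rightarrow> real ^ 'n \<Rightarrow> (real \<Rightarrow> real ^ 'm) \<Rightarrow>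
     real set \<Rightarrow> (real \<Rightarrow> real ^ 'n) \<Rightarrow> bool" where
  "trajectory_on f g x0 u I x \<longleftrightarrow>
     caratheodory_solution (\<lambda>t y. f y + g y *v u t) I x \<and> x 0 = x0"

definition escape_time ::
    "(real ^ 'n \<Rightarrow> real ^ 'n) \<Rightarrow> (real ^ 'n \<Rightarrow> real ^ 'm ^ 'n) \<Rightarrow> real ^ 'n \<Rightarrow> (real \<Rightarrow> real ^ 'm) \<Rightarrow> ereal" where
  "escape_time f g x0 u = Sup {ereal T |T. 0 \<le> T \<and> (\<exists>x. trajectory_on f g x0 u {0..T} x)}"

text \<open>The trajectory \<open>x\<^sub>u\<close>. For \<open>f\<close>, \<open>g\<close> of class \<open>C\<^sup>2\<close> and square-integrable \<open>u\<close>, its values on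
  \<open>{0..}\<close> are uniquely determined whenever the escape time is infinite; the choice operator only
  fixes irrelevant values at negative times.\<close>

definition traj ::
    "(real ^ 'n \<Rightarrow> real ^ 'n) \<Rightarrow> (real ^ 'n \<Rightarrow> real ^ 'm ^ 'n) \<Rightarrow> real ^ 'n \<Rightarrow> (real \<Rightarrow> real ^ 'm) \<Rightarrow>
     real \<Rightarrow> real ^ 'n" where
  "traj f g x0 u = (SOME x. trajectory_on f g x0 u {0..} x)"

text \<open>\<open>ennreal\<close> truncates negative arguments to 0, which is harmless since \<open>h \<ge> 0\<close>.\<close>

definition cost ::
    "(real ^ 'n \<Rightarrow> real ^ 'n) \<Rightarrow> (real ^ 'n \<Rightarrow> real ^ 'm ^ 'n) \<Rightarrow> (real ^ 'n \<Rightarrow> real) \<Rightarrow> real ^ 'n \<Rightarrow>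
     (real \<Rightarrow> real ^ 'm) \<Rightarrow> ennreal" where
  "cost f g h x0 u =
     (if escape_time f g x0 u < \<infinity> then \<infinity>
      else \<integral>\<^sup>+ t. ennreal (1/2 * (norm (u t))\<^sup>2 + h (traj f g x0 u t)) \<partial>lebesgue_on {0<..})"

definition optimal_control ::
    "(real ^ 'n \<Rightarrow> real ^ 'n) \<Rightarrow> (real ^ 'n \<Rightarrow> real ^ 'm ^ 'n) \<Rightarrow> (real ^ 'n \<Rightarrow> real) \<Rightarrow> real ^ 'n \<Rightarrow>
     (real \<Rightarrow> real ^ 'm) \<Rightarrow> bool" where
  "optimal_control f g h x0 u \<longleftrightarrow>
     u \<in> L2_controls \<and> cost f g h x0 u = (INF v\<in>L2_controls. cost f g h x0 v)"

end

theory Submission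
  imports Defs "HOL-Library.Diagonal_Subsequence"
begin

text \<open>
  The existence part is the direct method of the calculus of variations. Controls \<open>u\<^sub>k\<close> whose costs
  approach the infimum have bounded energy, so along a subsequence they converge weakly in \<open>L\<^sup>2\<close> to
  some \<open>v\<close>. The cost does not increase in the limit: the energy is weakly lower semicontinuous, and
  the running cost \<open>\<integral> h (x\<^sub>u)\<close> is handled by Fatou's lemma as soon as the trajectories converge
  pointwise. The latter is where the special form of the system enters. The right-hand side is
  affine in the control, so the difference of two trajectories is driven by
  \<open>\<integral>\<^sub>0\<^sup>t g (x\<^sub>v) (u\<^sub>k - v)\<close>, a weakly convergent factor against a fixed continuous one; this tends to
  \<open>0\<close> uniformly on compact intervals, and Gronwall's inequality finishes the argument
  (\<open>integral_solution_tendsto\<close>).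

  Weak convergence is used in the form that the primitives of the controls converge pointwise. The
  corresponding compactness statement is proved directly (\<open>bounded_energy_weak_limit\<close>). A
  diagonal subsequence makes the integrals over countably many sets converge. Elements of nearly
  minimal energy in the convex hulls of the tails of that subsequence form a Cauchy sequence, by
  the parallelogram law. Their limit has the right integrals, because the integrals over
  the tails are already close to their limits and taking averages does not spoil this.

  In fact \<open>x\<^sub>u(t) \<rightarrow> 0\<close> for every square-integrable control \<open>u\<close>
  (\<open>integral_solution_tendsto_0\<close>). Cut the half-line into windows of a fixed length \<open>T\<close> so large that
  the free dynamics at least halves the norm of the state over a window. As \<open>f\<close> is Lipschitz and \<open>g\<close>
  is bounded, the trajectory deviates from the free one over a window by at most a constant times
  the integral of \<open>\<bar>u\<bar>\<close> over that window, and these integrals tend to \<open>0\<close>.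

  Caratheodory solutions are treated throughout as continuous solutions of the integral equation. The
  passage between the two notions is the fundamental theorem of calculus for absolutely continuous
  functions (\<open>abs_continuous_has_integral\<close>) together with Lebesgue's differentiation theorem. Since
  \<open>f\<close> grows at most linearly and \<open>g\<close> is bounded, all solutions satisfy an a priori bound and exist on
  the whole half-line, so the escape time is infinite for every square-integrable control.
\<close>

section \<open>Absolute continuity and indefinite integrals\<close>

lemma sum_lengths_division:
  fixes D :: "real set set"
  assumes D: "D division_of \<Union>D"
  shows "((\<lambda>x. 1::real) has_integral (\<Sum>k\<in>D. Sup k - Inf k)) (\<Union>D)"
proof (rule has_integral_combine_division[OF D])
  fix k assume "k \<in> D"
  then obtain a b where k: "k = {a..b}" "k \<noteq> {}"
    using division_ofD(3,4)[OF D] by (metis box_real(2))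
  then have ab: "a \<le> b" by auto
  show "((\<lambda>x. 1::real) has_integral (Sup k - Inf k)) k"
    using has_integral_const_real[of "1::real" a b] ab by (simp add: k)
qed

text \<open>The proof follows the one for an everywhere differentiable function, with a gauge adapted to the
  exceptional null set \<open>N\<close>. Intervals tagged outside \<open>N\<close> are controlled by the derivative. Those
  tagged in \<open>N\<close> are forced into an open set of small measure, so their total length is small and
  absolute continuity bounds the increments of \<open>x\<close> over them.\<close>

lemma abs_continuous_has_integral:
  fixes x :: "real \<Rightarrow> 'a::euclidean_space"
  assumes ab: "a \<le> b" and ac: "abs_continuous_on {a..b} x"
    and ae: "AE t in lebesgue. t \<in> {a..b} \<longrightarrow> (x has_vector_derivative x' t) (at t within {a..b})"
  shows "(x' has_integral (x b - x a)) {a..b}"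
proof -
  obtain N where N: "negligible N"
    and der: "\<And>t. t \<notin> N \<Longrightarrow> t \<in> {a..b} \<Longrightarrow> (x has_vector_derivative x' t) (at t within {a..b})"
    using ae unfolding eventually_ae_filter_negligible by blast
  define y where "y t = (if t \<in> N then 0 else x' t)" for t
  have "(y has_integral (x b - x a)) (cbox a b)"
    unfolding has_integral
  proof (intro allI impI)
    fix e :: real assume e: "e > 0"
    \<comment> \<open>chosen so that \<open>e' * (b - a) < e / 2\<close> also if \<open>a = b\<close>\<close>
    define e' where "e' = e / (2 * (b - a) + 2)"
    have e': "e' > 0" using e ab by (simp add: e'_def)
    define P where "P t d \<longleftrightarrow> 0 < d \<and> (\<forall>s\<in>{a..b}. norm (s-t) < d \<longrightarrow>
      norm (x s - x t - (s-t) *\<^sub>R x' t) \<le> e' * norm (s-t))" for t d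
    have "\<exists>d. P t d" if "t \<in> {a..b}" "t \<notin> N" for t
      using der[OF that(2,1)] e' unfolding has_vector_derivative_def has_derivative_within_alt P_def by auto
    then have "\<forall>t. \<exists>d. 0 < d \<and> (t \<in> {a..b} \<and> t \<notin> N \<longrightarrow> P t d)"
      by (metis P_def zero_less_one)
    then obtain d where dP: "\<And>t. 0 < d t" "\<And>t. t \<in> {a..b} \<Longrightarrow> t \<notin> N \<Longrightarrow> P t (d t)"
      by metis
    have d: "norm (x s - x t - (s-t) *\<^sub>R x' t) \<le> e' * norm (s-t)"
      if "t \<in> {a..b}" "t \<notin> N" "s \<in> {a..b}" "norm (s-t) < d t" for s t
      using dP(2)[OF that(1,2)] that(3,4) unfolding P_def by blast
    obtain \<delta> where \<delta>: "\<delta> > 0" and ac\<delta>: "\<And>D. \<lbrakk>D division_of \<Union>D; \<Union>D \<subseteq> {a..b};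
        (\<Sum>k\<in>D. Sup k - Inf k) < \<delta>\<rbrakk> \<Longrightarrow> (\<Sum>k\<in>D. norm (x (Sup k) - x (Inf k))) < e/2"
      using ac[unfolded abs_continuous_on_def, rule_format, OF half_gt_zero[OF e]] by auto
    obtain U where U: "open U" "N \<subseteq> U" "(U - N) \<in> lmeasurable" "emeasure lebesgue (U - N) < ennreal \<delta>"
      using sets_lebesgue_outer_open[OF negligible_imp_sets[OF N] \<delta>] by blast
    have Um: "U \<in> lmeasurable" "measure lebesgue U < \<delta>"
    proof -
      have "U = (U - N) \<union> N" using U(2) by auto
      moreover have "N \<in> lmeasurable" "measure lebesgue N = 0"
        using N negligible_iff_measure by auto
      ultimately show "U \<in> lmeasurable" using U(3) by (metis fmeasurable.Un)
      have "measure lebesgue U = measure lebesgue (U - N)"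
        using N by (metis \<open>U \<in> lmeasurable\<close> fmeasurableD measure_Diff_null_set negligible_iff_null_sets)
      also have "\<dots> < \<delta>"
        using U(3,4) \<delta> by (simp add: emeasure_eq_measure2 ennreal_less_iff)
      finally show "measure lebesgue U < \<delta>" .
    qed
    \<comment> \<open>intervals tagged in \<open>N\<close> must lie in \<open>U\<close>, the others satisfy the derivative estimate\<close>
    let ?\<gamma> = "\<lambda>t. if t \<in> N then U else ball t (d t)"
    show "\<exists>\<gamma>. gauge \<gamma> \<and> (\<forall>\<D>. \<D> tagged_division_of cbox a b \<and> \<gamma> fine \<D> \<longrightarrow>
          norm ((\<Sum>(t, k)\<in>\<D>. measure lborel k *\<^sub>R y t) - (x b - x a)) < e)"
    proof (intro exI[of _ ?\<gamma>] conjI allI impI)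
      show "gauge ?\<gamma>"
        using U dP(1) by (auto simp: gauge_def)
    next
      fix p assume "p tagged_division_of cbox a b \<and> ?\<gamma> fine p"
      then have p: "p tagged_division_of {a..b}" and fine: "?\<gamma> fine p" by auto
      have fin: "finite p" using p by blast
      have ends: "\<exists>u v. u \<le> v \<and> K = {u..v} \<and> a \<le> u \<and> v \<le> b \<and> u \<le> t \<and> t \<le> v" if tK: "(t, K) \<in> p" for t K
      proof -
        obtain u v where uv: "K = cbox u v" using tagged_division_ofD(4)[OF p tK] by auto
        moreover have "t \<in> K" "K \<subseteq> {a..b}" using tagged_division_ofD(2,3)[OF p tK] by auto
        ultimately show ?thesis by (auto intro!: exI[of _ u] exI[of _ v])
      qed
      define q where "q = {z \<in> p. fst z \<in> N}"
      define r where "r = {z \<in> p. fst z \<notin> N}"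
      have pqr: "p = q \<union> r" "q \<inter> r = {}" "finite q" "finite r" "q \<subseteq> p" "r \<subseteq> p"
        using fin by (auto simp: q_def r_def)
      let ?T = "\<lambda>z. (case z of (t, K) \<Rightarrow> measure lborel K *\<^sub>R y t - (x (Sup K) - x (Inf K)))"
      have "(\<Sum>(t, k)\<in>p. measure lborel k *\<^sub>R y t) - (x b - x a) = (\<Sum>z\<in>p. ?T z)"
        using additive_tagged_division_1[OF ab p, of x]
        by (simp add: sum_subtractf case_prod_unfold)
      also have "\<dots> = sum ?T q + sum ?T r"
        unfolding pqr(1) by (rule sum.union_disjoint) (use pqr in auto)
      finally have eq: "(\<Sum>(t, k)\<in>p. measure lborel k *\<^sub>R y t) - (x b - x a) = sum ?T q + sum ?T r" .
      have "norm (sum ?T r) \<le> (\<Sum>(t, K)\<in>r. e' * (Sup K - Inf K))"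
      proof (rule sum_norm_le)
        fix z assume "z \<in> r"
        then obtain t K where z: "z = (t, K)" and tK: "(t, K) \<in> p" "t \<notin> N" by (cases z) (auto simp: r_def)
        obtain u v where K: "u \<le> v" "K = {u..v}" "a \<le> u" "v \<le> b" "u \<le> t" "t \<le> v"
          using ends[OF tK(1)] by auto
        have sub: "{u..v} \<subseteq> ball t (d t)"
          using fine tK K(2) unfolding fine_def by fastforce
        have sub': "\<bar>t - u\<bar> < d t" "\<bar>t - v\<bar> < d t"
          using K subsetD[OF sub, of u] subsetD[OF sub, of v] by (auto simp: dist_real_def)
        have "norm ((v - u) *\<^sub>R x' t - (x v - x u)) = norm (x u - x t - (u - t) *\<^sub>R x' t - (x v - x t - (v - t) *\<^sub>R x' t))"
          by (auto simp: algebra_simps)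
        also have "\<dots> \<le> norm (x u - x t - (u - t) *\<^sub>R x' t) + norm (x v - x t - (v - t) *\<^sub>R x' t)"
          by (rule norm_triangle_ineq4)
        also have "\<dots> \<le> e' * norm (u - t) + e' * norm (v - t)"
          using d[of t u] d[of t v] tK K sub'
          by (intro add_mono) auto
        also have "\<dots> = e' * (v - u)" using K by (simp add: algebra_simps)
        finally show "norm (?T z) \<le> (case z of (t, K) \<Rightarrow> e' * (Sup K - Inf K))"
          using K tK by (simp add: z y_def)
      qed
      also have "\<dots> \<le> (\<Sum>(t, K)\<in>p. e' * (Sup K - Inf K))"
      proof (rule sum_mono2[OF fin pqr(6)])
        fix z assume "z \<in> p - r"
        then show "0 \<le> (case z of (t, K) \<Rightarrow> e' * (Sup K - Inf K))"
          using ends[of "fst z" "snd z"] e' by (auto simp: case_prod_unfold)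
      qed
      also have "\<dots> = e' * (b - a)"
        using additive_tagged_division_1[OF ab p, of "\<lambda>t. t"]
        by (simp add: sum_distrib_left[symmetric] case_prod_unfold)
      also have "\<dots> < e/2"
        using e ab by (simp add: e'_def field_simps)
      finally have r: "norm (sum ?T r) < e/2" .
      have qp: "q tagged_partial_division_of {a..b}"
        by (rule tagged_partial_division_subset[OF _ pqr(5)]) (use p in \<open>simp add: tagged_division_of_def\<close>)
      let ?D = "snd ` q"
      have D: "?D division_of \<Union>?D"
        by (rule partial_division_of_tagged_division[OF qp])
      have DU: "\<Union>?D \<subseteq> U"
        using fineD[OF fine] by (fastforce simp: q_def)
      have Dab: "\<Union>?D \<subseteq> {a..b}"
        using tagged_division_ofD(3)[OF p] by (fastforce simp: q_def simp del: atLeastAtMost_iff)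
      have "norm (sum ?T q) \<le> (\<Sum>(t, K)\<in>q. norm (x (Sup K) - x (Inf K)))"
        by (rule sum_norm_le) (auto simp: q_def y_def norm_minus_commute)
      \<comment> \<open>pass from tagged intervals to intervals; degenerate ones may carry several tags but contribute \<open>0\<close>\<close>
      also have "\<dots> = (\<Sum>(t, K)\<in>q. if K = {} then 0 else norm (x (Sup K) - x (Inf K)))"
        using tagged_division_ofD(2)[OF p] pqr(5) by (intro sum.cong) (fastforce simp: case_prod_unfold)+
      also have "\<dots> = (\<Sum>K\<in>?D. if K = {} then 0 else norm (x (Sup K) - x (Inf K)))"
      proof (rule sum.over_tagged_division_lemma[OF tagged_partial_division_of_Union_self[OF qp]])
        fix u v :: real assume "box u v = {}"
        then have "v \<le> u" by simp
        then show "(if cbox u v = {} then 0 else norm (x (Sup (cbox u v)) - x (Inf (cbox u v)))) = 0"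
          by (cases "u = v") auto
      qed
      also have "\<dots> = (\<Sum>K\<in>?D. norm (x (Sup K) - x (Inf K)))"
        using division_ofD(3)[OF D] by (intro sum.cong) auto
      also have "\<dots> < e/2"
      proof (rule ac\<delta>[OF D Dab])
        have "(\<Sum>k\<in>?D. Sup k - Inf k) = measure lebesgue (\<Union>?D)"
        proof -
          have "\<Union>?D \<in> lmeasurable"
            using D by (meson lmeasurable_division)
          then show ?thesis
            using integral_unique[OF sum_lengths_division[OF D]] lmeasure_integral by metis
        qed
        also have "\<dots> \<le> measure lebesgue U"
          using D DU Um by (intro measure_mono_fmeasurable) (auto intro: fmeasurableD lmeasurable_division)
        finally show "(\<Sum>k\<in>?D. Sup k - Inf k) < \<delta>" using Um by simp
      qed
      finally have "norm (sum ?T q) < e/2" .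
      then show "norm ((\<Sum>(t, k)\<in>p. measure lborel k *\<^sub>R y t) - (x b - x a)) < e"
        unfolding eq using r norm_triangle_ineq[of "sum ?T q" "sum ?T r"] by linarith
    qed
  qed
  then show ?thesis
    using has_integral_spike[OF N, of "cbox a b" x' y] by (simp add: y_def)
qed

text \<open>Up to a function of small integral, the norm of the integrand is bounded: truncate it at a high level.\<close>

lemma abs_continuous_on_indefinite_integral:
  fixes \<phi> :: "real \<Rightarrow> 'a::euclidean_space"
  assumes \<phi>: "\<phi> absolutely_integrable_on {a..b}"
  shows "abs_continuous_on {a..b} (\<lambda>t. integral {a..t} \<phi>)"
  unfolding abs_continuous_on_def
proof (intro allI impI)
  fix e :: real assume e: "e > 0"
  define \<rho> where "\<rho> t = norm (\<phi> t)" for t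
  define \<rho>n where "\<rho>n n t = min (\<rho> t) (real n)" for n t
  have \<rho>: "\<rho> absolutely_integrable_on {a..b}"
    using absolutely_integrable_norm[OF \<phi>] by (simp add: \<rho>_def[abs_def] o_def)
  then have \<rho>i: "\<rho> integrable_on {a..b}" by (simp add: absolutely_integrable_on_def)
  have \<rho>n: "\<rho>n n absolutely_integrable_on {a..b}" for n
    using absolutely_integrable_min_1[OF \<rho> absolutely_integrable_on_const[of "{a..b}" "real n"]]
    by (simp add: \<rho>n_def[abs_def])
  have \<rho>ni: "\<rho>n n integrable_on {a..b}" for n using \<rho>n by (simp add: absolutely_integrable_on_def)
  have "(\<lambda>n. integral {a..b} (\<rho>n n)) \<longlonglongrightarrow> integral {a..b} \<rho>"
  proof (rule dominated_convergence(2)[where h=\<rho>])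
    fix t
    have "eventually (\<lambda>n. \<rho>n n t = \<rho> t) sequentially"
      using eventually_ge_at_top[of "nat \<lceil>\<rho> t\<rceil>"]
      by eventually_elim (simp add: \<rho>n_def min_def nat_ceiling_le_eq)
    then show "(\<lambda>n. \<rho>n n t) \<longlonglongrightarrow> \<rho> t" by (rule tendsto_eventually)
  qed (use \<rho>ni \<rho>i in \<open>auto simp: \<rho>n_def \<rho>_def\<close>)
  then obtain n where n: "norm (integral {a..b} (\<rho>n n) - integral {a..b} \<rho>) < e/2"
    using e by (meson LIMSEQ_iff half_gt_zero order_refl)
  define \<sigma> where "\<sigma> t = \<rho> t - \<rho>n n t" for t
  have \<sigma>i: "\<sigma> integrable_on {a..b}"
    using integrable_diff[OF \<rho>i \<rho>ni[of n]] by (simp add: \<sigma>_def[abs_def])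
  have \<sigma>0: "\<sigma> t \<ge> 0" for t by (simp add: \<sigma>_def \<rho>n_def)
  have \<sigma>e: "integral {a..b} \<sigma> < e/2"
    using n Henstock_Kurzweil_Integration.integral_diff[OF \<rho>i \<rho>ni[of n]] unfolding \<sigma>_def[abs_def] real_norm_def by linarith
  show "\<exists>\<delta>>0. \<forall>D. D division_of \<Union>D \<and> \<Union>D \<subseteq> {a..b} \<and> (\<Sum>k\<in>D. Sup k - Inf k) < \<delta> \<longrightarrow>
      (\<Sum>k\<in>D. norm (integral {a..Sup k} \<phi> - integral {a..Inf k} \<phi>)) < e"
  proof (intro exI[of _ "e / (2 * (real n + 1))"] conjI allI impI)
    show "0 < e / (2 * (real n + 1))" using e by simp
  next
    fix D assume "D division_of \<Union>D \<and> \<Union>D \<subseteq> {a..b} \<and> (\<Sum>k\<in>D. Sup k - Inf k) < e / (2 * (real n + 1))"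
    then have D: "D division_of \<Union>D" "\<Union>D \<subseteq> {a..b}" and len: "(\<Sum>k\<in>D. Sup k - Inf k) < e / (2 * (real n + 1))"
      by auto
    have K: "\<exists>u v. k = {u..v} \<and> u \<le> v \<and> a \<le> u \<and> v \<le> b" if kD: "k \<in> D" for k
    proof -
      obtain u v where "k = {u..v}" "k \<noteq> {}" using division_ofD(3,4)[OF D(1) kD] by auto
      moreover have "k \<subseteq> {a..b}" using D(2) kD by auto
      ultimately show ?thesis by auto
    qed
    have est: "norm (integral {a..Sup k} \<phi> - integral {a..Inf k} \<phi>) \<le> integral k \<sigma> + real n * (Sup k - Inf k)"
      if kD: "k \<in> D" for k
    proof -
      obtain u v where k: "k = {u..v}" "u \<le> v" "a \<le> u" "v \<le> b" using K[OF kD] by auto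
      have sub: "{u..v} \<subseteq> {a..b}" "{a..v} \<subseteq> {a..b}" using k by auto
      have \<phi>v: "\<phi> integrable_on {a..v}"
        using \<phi> sub by (meson absolutely_integrable_on_def integrable_on_subinterval)
      have \<phi>k: "\<phi> absolutely_integrable_on {u..v}"
        using \<phi> sub(1) by (rule absolutely_integrable_on_subinterval)
      have \<sigma>k: "\<sigma> integrable_on {u..v}" using \<sigma>i sub(1) by (rule integrable_on_subinterval)
      have "integral {a..v} \<phi> - integral {a..u} \<phi> = integral {u..v} \<phi>"
        using Henstock_Kurzweil_Integration.integral_combine[OF k(3,2) \<phi>v] by (simp add: algebra_simps)
      also have "norm \<dots> \<le> integral {u..v} (\<lambda>t. \<sigma> t + real n)"
      proof (rule integral_norm_bound_integral)
        show "\<phi> integrable_on {u..v}" using \<phi>k by (simp add: absolutely_integrable_on_def)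
        show "(\<lambda>t. \<sigma> t + real n) integrable_on {u..v}"
          by (intro integrable_add \<sigma>k integrable_const_ivl)
      qed (auto simp: \<sigma>_def \<rho>n_def \<rho>_def)
      also have "\<dots> = integral {u..v} \<sigma> + real n * (v - u)"
        using k by (subst integral_add) (use \<sigma>k in auto)
      finally show ?thesis using k by simp
    qed
    have h\<sigma>: "(\<sigma> has_integral (\<Sum>k\<in>D. integral k \<sigma>)) (\<Union>D)"
    proof (rule has_integral_combine_division[OF D(1)])
      fix k assume "k \<in> D"
      then obtain u v where k: "k = {u..v}" "u \<le> v" "a \<le> u" "v \<le> b" using K by blast
      have "\<sigma> integrable_on k" unfolding k(1) using k by (intro integrable_on_subinterval[OF \<sigma>i]) auto
      then show "(\<sigma> has_integral integral k \<sigma>) k" by (rule integrable_integral)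
    qed
    have "(\<Sum>k\<in>D. norm (integral {a..Sup k} \<phi> - integral {a..Inf k} \<phi>))
        \<le> (\<Sum>k\<in>D. integral k \<sigma> + real n * (Sup k - Inf k))"
      by (rule sum_mono[OF est])
    also have "\<dots> = (\<Sum>k\<in>D. integral k \<sigma>) + real n * (\<Sum>k\<in>D. Sup k - Inf k)"
      by (simp add: sum.distrib sum_distrib_left)
    also have "(\<Sum>k\<in>D. integral k \<sigma>) \<le> integral {a..b} \<sigma>"
      using has_integral_subset_le[OF D(2) h\<sigma> integrable_integral[OF \<sigma>i]] \<sigma>0 by auto
    also have "real n * (\<Sum>k\<in>D. Sup k - Inf k) \<le> real n * (e / (2 * (real n + 1)))"
      using len by (intro mult_left_mono) auto
    also have "\<dots> \<le> e/2" using e by (simp add: field_simps)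
    finally show "(\<Sum>k\<in>D. norm (integral {a..Sup k} \<phi> - integral {a..Inf k} \<phi>)) < e"
      using \<sigma>e by simp
  qed
qed

text \<open>The covering argument behind Lebesgue's differentiation theorem is contained in
  \<open>integrable_ccontinuous_explicit\<close>, which is about right-hand difference quotients. Applied to
  \<open>\<phi>\<close> and to its reflection it gives both one-sided derivatives.\<close>

lemma indefinite_integral_has_vector_derivative_AE:
  fixes \<phi> :: "real \<Rightarrow> 'a::euclidean_space"
  assumes \<phi>: "\<And>a b. \<phi> integrable_on {a..b}"
  shows "AE t in lebesgue. c < t \<longrightarrow> ((\<lambda>t. integral {c..t} \<phi>) has_vector_derivative \<phi> t) (at t)"
proof -
  obtain N where N: "negligible N" and right: "\<And>x e. \<lbrakk>x \<notin> N; 0 < e\<rbrakk> \<Longrightarrow>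
      \<exists>d>0. \<forall>h. 0 < h \<and> h < d \<longrightarrow> norm (integral {x..x + h} \<phi> /\<^sub>R h - \<phi> x) < e"
    using integrable_ccontinuous_explicit[of \<phi>] \<phi> by auto
  have "(\<lambda>x. \<phi> (- x)) integrable_on cbox a b" for a b
    using \<phi>[of "-b" "-a"] Henstock_Kurzweil_Integration.integrable_reflect_real[where f=\<phi> and a="-b" and b="-a"] by simp
  then obtain N' where N': "negligible N'" and left: "\<And>x e. \<lbrakk>x \<notin> N'; 0 < e\<rbrakk> \<Longrightarrow>
      \<exists>d>0. \<forall>h. 0 < h \<and> h < d \<longrightarrow> norm (integral {x..x + h} (\<lambda>x. \<phi> (- x)) /\<^sub>R h - \<phi> (- x)) < e"
    using integrable_ccontinuous_explicit[of "\<lambda>x. \<phi> (- x)"] by auto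
  have "negligible (uminus ` N')"
    using N' by (intro negligible_differentiable_image_negligible) (auto intro!: derivative_intros simp: differentiable_on_def)
  then have neg: "negligible (N \<union> uminus ` N')"
    using N by simp
  have "((\<lambda>t. integral {c..t} \<phi>) has_vector_derivative \<phi> t) (at t)"
    if "t \<notin> N \<union> uminus ` N'" "c < t" for t
    unfolding has_vector_derivative_def has_derivative_at_alt
  proof (intro conjI allI impI bounded_linear_scaleR_left)
    fix e :: real assume e: "e > 0"
    have "t \<notin> N" "- t \<notin> N'" using that(1) by (auto simp: image_iff)
    obtain d1 where d1: "d1 > 0" "\<And>h. 0 < h \<and> h < d1 \<Longrightarrow> norm (integral {t..t + h} \<phi> /\<^sub>R h - \<phi> t) < e"
      using right[OF \<open>t \<notin> N\<close> e] by auto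
    obtain d2 where d2: "d2 > 0" "\<And>h. 0 < h \<and> h < d2 \<Longrightarrow>
        norm (integral {-t..-t + h} (\<lambda>x. \<phi> (- x)) /\<^sub>R h - \<phi> t) < e"
      using left[OF \<open>- t \<notin> N'\<close> e] by auto
    have key: "norm (I - h *\<^sub>R \<phi> t) \<le> e * h" if "norm (I /\<^sub>R h - \<phi> t) < e" "h > 0" for I h
    proof -
      have "I - h *\<^sub>R \<phi> t = h *\<^sub>R (I /\<^sub>R h - \<phi> t)" using that by (simp add: algebra_simps)
      then have "norm (I - h *\<^sub>R \<phi> t) = h * norm (I /\<^sub>R h - \<phi> t)" using that by simp
      also have "\<dots> \<le> h * e" using that by (intro mult_left_mono) auto
      finally show ?thesis by (simp add: mult.commute)
    qed
    show "\<exists>d>0. \<forall>y. norm (y - t) < d \<longrightarrow>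
        norm (integral {c..y} \<phi> - integral {c..t} \<phi> - (y - t) *\<^sub>R \<phi> t) \<le> e * norm (y - t)"
    proof (intro exI[of _ "min (min d1 d2) (t - c)"] conjI allI impI)
      show "0 < min (min d1 d2) (t - c)" using d1 d2 that by simp
      fix y assume y: "norm (y - t) < min (min d1 d2) (t - c)"
      consider "y = t" | "y > t" | "y < t" by linarith
      then show "norm (integral {c..y} \<phi> - integral {c..t} \<phi> - (y - t) *\<^sub>R \<phi> t) \<le> e * norm (y - t)"
      proof cases
        case 2
        have "integral {c..y} \<phi> - integral {c..t} \<phi> = integral {t..t + (y - t)} \<phi>"
          using Henstock_Kurzweil_Integration.integral_combine[of c t y \<phi>] \<phi> 2 that by (simp add: algebra_simps)
        then show ?thesis
          using key[OF d1(2)[of "y - t"]] 2 y by simp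
      next
        case 3
        have "integral {c..t} \<phi> - integral {c..y} \<phi> = integral {y..t} \<phi>"
          using Henstock_Kurzweil_Integration.integral_combine[of c y t \<phi>] \<phi> 3 that y by (simp add: algebra_simps)
        also have "\<dots> = integral {-t..-t + (t - y)} (\<lambda>x. \<phi> (- x))"
          by simp
        finally have eq: "integral {c..t} \<phi> - integral {c..y} \<phi> = \<dots>" .
        have "norm (integral {c..t} \<phi> - integral {c..y} \<phi> - (t - y) *\<^sub>R \<phi> t) \<le> e * (t - y)"
          unfolding eq using key[OF d2(2)[of "t - y"]] 3 y by simp
        moreover have "norm (integral {c..y} \<phi> - integral {c..t} \<phi> - (y - t) *\<^sub>R \<phi> t)
            = norm (integral {c..t} \<phi> - integral {c..y} \<phi> - (t - y) *\<^sub>R \<phi> t)"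
          by (subst norm_minus_cancel[symmetric]) (simp add: algebra_simps)
        ultimately show ?thesis using 3 by simp
      qed auto
    qed
  qed
  then show ?thesis
    unfolding eventually_ae_filter_negligible using neg by blast
qed

text \<open>The two instances of interest are compact intervals and the half-line.\<close>

lemma indefinite_integral_has_vector_derivative_within_AE:
  fixes \<phi> :: "real \<Rightarrow> 'a::euclidean_space"
  assumes \<phi>: "\<And>a b. \<phi> integrable_on (S \<inter> {a..b})"
    and S: "\<And>t. t \<in> S \<Longrightarrow> {c..t} \<subseteq> S" "S \<subseteq> {c..}"
  shows "AE t in lebesgue. t \<in> S \<longrightarrow> ((\<lambda>t. integral {c..t} \<phi>) has_vector_derivative \<phi> t) (at t within S)"
proof -
  let ?\<psi> = "\<lambda>t. if t \<in> S then \<phi> t else 0"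
  have ae: "AE t in lebesgue. c < t \<longrightarrow> ((\<lambda>t. integral {c..t} ?\<psi>) has_vector_derivative ?\<psi> t) (at t)"
    by (rule indefinite_integral_has_vector_derivative_AE) (simp add: integrable_restrict_Int \<phi>)
  have "AE t in lebesgue. t \<noteq> c"
    unfolding eventually_ae_filter_negligible by (rule exI[of _ "{c}"]) auto
  with ae show ?thesis
  proof eventually_elim
    case (elim t)
    show ?case
    proof
      assume t: "t \<in> S"
      then have "c < t" using elim(2) S(2) by force
      with elim(1) t have "((\<lambda>t. integral {c..t} ?\<psi>) has_vector_derivative \<phi> t) (at t within S)"
        by (auto intro: has_vector_derivative_at_within)
      then show "((\<lambda>t. integral {c..t} \<phi>) has_vector_derivative \<phi> t) (at t within S)"
      proof (rule has_vector_derivative_transform[OF t, rotated])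
        fix s assume "s \<in> S"
        then have "{c..s} \<subseteq> S" by (rule S(1))
        then show "integral {c..s} \<phi> = integral {c..s} ?\<psi>"
          by (intro Henstock_Kurzweil_Integration.integral_cong) (auto simp: subset_eq)
      qed
    qed
  qed
qed

lemma abs_continuous_on_lipschitz_image:
  assumes y: "abs_continuous_on {a..b} y" and C: "C \<ge> 0"
    and le: "\<And>s t. s \<in> {a..b} \<Longrightarrow> t \<in> {a..b} \<Longrightarrow> norm (x s - x t) \<le> C * norm (y s - y t)"
  shows "abs_continuous_on {a..b} x"
  unfolding abs_continuous_on_def
proof (intro allI impI)
  fix e :: real assume e: "e > 0"
  define e' where "e' = e / (C + 1)"
  have e': "e' > 0" using e C by (simp add: e'_def)
  obtain d where d: "d > 0" "\<And>D. D division_of \<Union>D \<and> \<Union>D \<subseteq> {a..b} \<and> (\<Sum>k\<in>D. Sup k - Inf k) < d \<Longrightarrow>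
      (\<Sum>k\<in>D. norm (y (Sup k) - y (Inf k))) < e'"
    using y[unfolded abs_continuous_on_def, rule_format, OF e'] by auto
  show "\<exists>\<delta>>0. \<forall>D. D division_of \<Union>D \<and> \<Union>D \<subseteq> {a..b} \<and> (\<Sum>k\<in>D. Sup k - Inf k) < \<delta> \<longrightarrow>
      (\<Sum>k\<in>D. norm (x (Sup k) - x (Inf k))) < e"
  proof (intro exI[of _ d] conjI allI impI d(1))
    fix D assume D: "D division_of \<Union>D \<and> \<Union>D \<subseteq> {a..b} \<and> (\<Sum>k\<in>D. Sup k - Inf k) < d"
    have "(\<Sum>k\<in>D. norm (x (Sup k) - x (Inf k))) \<le> (\<Sum>k\<in>D. C * norm (y (Sup k) - y (Inf k)))"
    proof (rule sum_mono)
      fix k assume k: "k \<in> D"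
      then obtain u v where uv: "k = {u..v}" "k \<noteq> {}" using division_ofD(3,4)[of D "\<Union>D" k] D by auto
      moreover have "k \<subseteq> {a..b}" using D k by auto
      ultimately show "norm (x (Sup k) - x (Inf k)) \<le> C * norm (y (Sup k) - y (Inf k))"
        by (intro le) auto
    qed
    also have "\<dots> = C * (\<Sum>k\<in>D. norm (y (Sup k) - y (Inf k)))"
      by (simp add: sum_distrib_left)
    also have "\<dots> \<le> C * e'"
      using d(2)[OF D] C by (intro mult_left_mono) auto
    also have "\<dots> < e" using e C by (simp add: e'_def field_simps)
    finally show "(\<Sum>k\<in>D. norm (x (Sup k) - x (Inf k))) < e" .
  qed
qed

lemma continuous_on_atLeastI:
  fixes x :: "real \<Rightarrow> 'a::topological_space"
  assumes "\<And>T. c \<le> T \<Longrightarrow> continuous_on {c..T} x"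
  shows "continuous_on {c..} x"
  unfolding continuous_on_def
proof
  fix t assume t: "t \<in> {c..}"
  then have "(x \<longlongrightarrow> x t) (at t within {c..t + 1})"
    using assms[of "t + 1"] by (auto simp: continuous_on_def)
  moreover have "at t within {c..} = at t within {c..t + 1}"
    by (rule at_within_nhd[of _ "{..<t + 1}"]) auto
  ultimately show "(x \<longlongrightarrow> x t) (at t within {c..})" by simp
qed

lemma abs_continuous_on_subset:
  "abs_continuous_on T x \<Longrightarrow> S \<subseteq> T \<Longrightarrow> abs_continuous_on S x"
  unfolding abs_continuous_on_def by (meson subset_trans)

lemma abs_continuous_on_imp_continuous_on:
  fixes x :: "real \<Rightarrow> 'a::real_normed_vector"
  assumes x: "abs_continuous_on {a..b} x"
  shows "continuous_on {a..b} x"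
  unfolding continuous_on_iff
proof (intro ballI allI impI)
  fix t e :: real assume t: "t \<in> {a..b}" and e: "e > 0"
  obtain d where d: "d > 0" and dD: "\<And>D. D division_of \<Union>D \<and> \<Union>D \<subseteq> {a..b} \<and> (\<Sum>k\<in>D. Sup k - Inf k) < d \<Longrightarrow>
      (\<Sum>k\<in>D. norm (x (Sup k) - x (Inf k))) < e"
    using x[unfolded abs_continuous_on_def, rule_format, OF e] by auto
  have small: "norm (x v - x w) < e" if "w \<in> {a..b}" "v \<in> {a..b}" "w \<le> v" "v - w < d" for v w
  proof -
    have "{{w..v}} division_of {w..v}" using division_of_self[of w v] that by simp
    then show ?thesis using dD[of "{{w..v}}"] that by simp
  qed
  show "\<exists>d>0. \<forall>s\<in>{a..b}. dist s t < d \<longrightarrow> dist (x s) (x t) < e"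
  proof (intro exI[of _ d] conjI ballI impI d)
    fix s assume s: "s \<in> {a..b}" "dist s t < d"
    show "dist (x s) (x t) < e"
    proof (cases "s \<le> t")
      case True
      then show ?thesis using small[of s t] s t by (simp add: dist_norm norm_minus_commute)
    next
      case False
      then show ?thesis using small[of t s] s t by (simp add: dist_norm)
    qed
  qed
qed

lemma caratheodory_solution_imp_integral:
  fixes x :: "real \<Rightarrow> 'a::euclidean_space"
  assumes x: "caratheodory_solution F {0..} x"
  shows "continuous_on {0..} x"
    and "0 \<le> t \<Longrightarrow> ((\<lambda>s. F s (x s)) has_integral (x t - x 0)) {0..t}"
proof -
  have ac: "abs_continuous_on {0..T} x" for T
    using x by (auto simp: caratheodory_solution_def)
  show "continuous_on {0..} x"
    by (intro continuous_on_atLeastI abs_continuous_on_imp_continuous_on ac)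
  have "AE s in lebesgue. s \<in> {0..} \<longrightarrow> (x has_vector_derivative F s (x s)) (at s within {0..})"
    using x by (simp add: caratheodory_solution_def)
  then have "AE s in lebesgue. s \<in> {0..t} \<longrightarrow> (x has_vector_derivative F s (x s)) (at s within {0..t})"
    by eventually_elim (auto intro: has_vector_derivative_within_subset)
  then show "((\<lambda>s. F s (x s)) has_integral (x t - x 0)) {0..t}" if "0 \<le> t"
    using that ac by (intro abs_continuous_has_integral)
qed

lemma integral_imp_caratheodory_solution:
  fixes x :: "real \<Rightarrow> 'a::euclidean_space"
  assumes F: "\<And>T. (\<lambda>s. F s (x s)) absolutely_integrable_on {0..T}"
    and x: "\<And>t. 0 \<le> t \<Longrightarrow> x t = x0 + integral {0..t} (\<lambda>s. F s (x s))"
  shows "caratheodory_solution F {0..} x"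
  unfolding caratheodory_solution_def
proof (intro conjI allI impI)
  fix a b :: real assume ab: "{a..b} \<subseteq> {0..}"
  have "abs_continuous_on {0..b} x"
    by (rule abs_continuous_on_lipschitz_image[OF abs_continuous_on_indefinite_integral[OF F], of 1]) (auto simp: x)
  then show "abs_continuous_on {a..b} x"
    by (rule abs_continuous_on_subset) (use ab in auto)
next
  have "AE t in lebesgue. t \<in> {0..} \<longrightarrow>
      ((\<lambda>t. integral {0..t} (\<lambda>s. F s (x s))) has_vector_derivative F t (x t)) (at t within {0..})"
  proof (rule indefinite_integral_has_vector_derivative_within_AE)
    fix a b :: real
    have "{0..} \<inter> {a..b} = {max 0 a..b}" by auto
    then show "(\<lambda>s. F s (x s)) integrable_on {0..} \<inter> {a..b}"
      using F[of b] by (auto simp: absolutely_integrable_on_def intro: integrable_on_subinterval)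
  qed auto
  then show "AE t in lebesgue. t \<in> {0..} \<longrightarrow> (x has_vector_derivative F t (x t)) (at t within {0..})"
  proof eventually_elim
    case (elim t)
    show ?case
    proof
      assume t: "t \<in> {0..}"
      with elim have "((\<lambda>t. x0 + integral {0..t} (\<lambda>s. F s (x s))) has_vector_derivative F t (x t)) (at t within {0..})"
        by (auto intro!: derivative_eq_intros)
      then show "(x has_vector_derivative F t (x t)) (at t within {0..})"
        by (rule has_vector_derivative_transform[OF t, rotated]) (simp add: x)
    qed
  qed
qed

section \<open>Gronwall inequality and global existence for Lipschitz right-hand sides\<close>

lemma indefinite_integral_mono:
  fixes \<alpha> :: "real \<Rightarrow> real"
  assumes "\<alpha> integrable_on {c..d}" "\<And>t. t \<in> {c..d} \<Longrightarrow> 0 \<le> \<alpha> t" "c \<le> s" "s \<le> t" "t \<le> d"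
  shows "integral {c..s} \<alpha> \<le> integral {c..t} \<alpha>"
  using assms by (intro integral_subset_le) (auto intro: integrable_on_subinterval)

text \<open>Formally this is \<open>(exp (2 A) / 2)' = \<alpha> exp (2 A)\<close>. As \<open>A\<close> is only absolutely continuous, so is
  \<open>exp (2 A)\<close>, being a Lipschitz function of \<open>A\<close> on the range of \<open>A\<close>, and the chain rule holds at
  almost every point. The weight \<open>exp (2 A)\<close> turns the integral operator with kernel \<open>\<alpha>\<close> into a
  contraction with factor \<open>1 / 2\<close>; this single fact yields both the Gronwall inequality and the
  existence of solutions below.\<close>

lemma has_integral_exp_weight:
  fixes \<alpha> :: "real \<Rightarrow> real"
  assumes \<alpha>: "\<alpha> integrable_on {c..d}" "\<And>t. t \<in> {c..d} \<Longrightarrow> 0 \<le> \<alpha> t" and cd: "c \<le> d"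
  defines "A \<equiv> \<lambda>t. integral {c..t} \<alpha>"
  shows "((\<lambda>s. \<alpha> s * exp (2 * A s)) has_integral (exp (2 * A d) - 1) / 2) {c..d}"
proof -
  have abs: "\<alpha> absolutely_integrable_on {c..d}"
    using \<alpha> by (intro nonnegative_absolutely_integrable_1) auto
  have A0: "0 \<le> A t" "A t \<le> A d" if "t \<in> {c..d}" for t
    using indefinite_integral_mono[OF \<alpha>, of c t] indefinite_integral_mono[OF \<alpha>, of t d] that
    by (auto simp: A_def)
  let ?E = "\<lambda>t. exp (2 * A t) / 2"
  have "((\<lambda>s. \<alpha> s * exp (2 * A s)) has_integral (?E d - ?E c)) {c..d}"
  proof (rule abs_continuous_has_integral[OF cd])
    show "abs_continuous_on {c..d} ?E"
    proof (rule abs_continuous_on_lipschitz_image)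
      show "abs_continuous_on {c..d} A"
        unfolding A_def by (rule abs_continuous_on_indefinite_integral[OF abs])
      show "0 \<le> exp (2 * A d)" by simp
      fix s t assume st: "s \<in> {c..d}" "t \<in> {c..d}"
      have "norm (exp (2 * A s) / 2 - exp (2 * A t) / 2) \<le> exp (2 * A d) * norm (A s - A t)"
      proof (rule field_differentiable_bound[where S = "{..A d}" and f' = "\<lambda>r. exp (2 * r)"
            and f = "\<lambda>r. exp (2 * r) / 2"])
        fix r :: real assume "r \<in> {..A d}"
        show "((\<lambda>r. exp (2 * r) / 2) has_field_derivative exp (2 * r)) (at r within {..A d})"
          by (auto intro!: derivative_eq_intros)
        show "norm (exp (2 * r)) \<le> exp (2 * A d)" using \<open>r \<in> _\<close> by simp
      qed (use A0 st in auto)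
      then show "norm (?E s - ?E t) \<le> exp (2 * A d) * norm (A s - A t)" .
    qed
    have "AE t in lebesgue. t \<in> {c..d} \<longrightarrow> (A has_vector_derivative \<alpha> t) (at t within {c..d})"
      unfolding A_def
    proof (rule indefinite_integral_has_vector_derivative_within_AE)
      show "\<alpha> integrable_on {c..d} \<inter> {a..b}" for a b
        by (simp add: Int_atLeastAtMost integrable_on_subinterval[OF \<alpha>(1)])
    qed auto
    then show "AE t in lebesgue. t \<in> {c..d} \<longrightarrow>
        (?E has_vector_derivative \<alpha> t * exp (2 * A t)) (at t within {c..d})"
    proof eventually_elim
      case (elim t)
      show ?case
      proof
        assume "t \<in> {c..d}"
        with elim have "(A has_real_derivative \<alpha> t) (at t within {c..d})"
          by (simp add: has_real_derivative_iff_has_vector_derivative)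
        then have "(?E has_real_derivative \<alpha> t * exp (2 * A t)) (at t within {c..d})"
          by (auto intro!: derivative_eq_intros)
        then show "(?E has_vector_derivative \<alpha> t * exp (2 * A t)) (at t within {c..d})"
          by (simp add: has_real_derivative_iff_has_vector_derivative)
      qed
    qed
  qed
  moreover have "?E d - ?E c = (exp (2 * A d) - 1) / 2"
    by (simp add: A_def diff_divide_distrib)
  ultimately show ?thesis by simp
qed

lemma integrable_bounded_mult:
  fixes \<alpha> \<phi> :: "real \<Rightarrow> real"
  assumes "\<alpha> integrable_on {c..d}" "\<And>t. t \<in> {c..d} \<Longrightarrow> 0 \<le> \<alpha> t" "continuous_on {c..d} \<phi>"
  shows "(\<lambda>s. \<alpha> s * \<phi> s) integrable_on {c..d}"
proof -
  have "\<alpha> absolutely_integrable_on {c..d}"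
    using assms by (intro nonnegative_absolutely_integrable_1) auto
  then have "(\<lambda>s. \<phi> s * \<alpha> s) absolutely_integrable_on {c..d}"
    using assms by (intro absolutely_integrable_bounded_measurable_product_real)
      (auto intro!: continuous_imp_measurable_on_sets_lebesgue compact_imp_bounded compact_continuous_image)
  then show ?thesis by (simp add: absolutely_integrable_on_def mult.commute)
qed

text \<open>The classical bound is \<open>k exp A\<close>. The weaker one comes at no cost: if \<open>m\<close> is the maximum of
  \<open>\<phi> exp (- 2 A)\<close>, the hypothesis at the maximum point gives \<open>m \<le> k + m / 2\<close>.\<close>

lemma gronwall_integral:
  fixes \<alpha> \<phi> :: "real \<Rightarrow> real"
  assumes \<alpha>: "\<alpha> integrable_on {c..d}" "\<And>t. t \<in> {c..d} \<Longrightarrow> 0 \<le> \<alpha> t"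
    and \<phi>: "continuous_on {c..d} \<phi>"
    and le: "\<And>t. t \<in> {c..d} \<Longrightarrow> \<phi> t \<le> k + integral {c..t} (\<lambda>s. \<alpha> s * \<phi> s)" and k: "0 \<le> k"
    and t: "t \<in> {c..d}"
  shows "\<phi> t \<le> 2 * k * exp (2 * integral {c..t} \<alpha>)"
proof -
  define A where "A t = integral {c..t} \<alpha>" for t
  have cd: "c \<le> d" using t by auto
  have A0: "0 \<le> A t" if "t \<in> {c..d}" for t
    using indefinite_integral_mono[OF \<alpha>, of c t] that by (auto simp: A_def)
  have Acont: "continuous_on {c..d} A"
    unfolding A_def by (rule indefinite_integral_continuous_1[OF \<alpha>(1)])
  have "continuous_on {c..d} (\<lambda>t. \<phi> t * exp (- 2 * A t))"
    by (intro continuous_intros \<phi> Acont)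
  then obtain \<tau> where \<tau>: "\<tau> \<in> {c..d}" "\<And>t. t \<in> {c..d} \<Longrightarrow> \<phi> t * exp (- 2 * A t) \<le> \<phi> \<tau> * exp (- 2 * A \<tau>)"
    using continuous_attains_sup[of "{c..d}" "\<lambda>t. \<phi> t * exp (- 2 * A t)"] cd by auto
  define m where "m = \<phi> \<tau> * exp (- 2 * A \<tau>)"
  have m: "\<phi> s \<le> m * exp (2 * A s)" if "s \<in> {c..d}" for s
  proof -
    have "\<phi> s = \<phi> s * exp (- 2 * A s) * exp (2 * A s)" by (simp add: exp_minus)
    also have "\<dots> \<le> m * exp (2 * A s)" unfolding m_def using \<tau>(2)[OF that] by (intro mult_right_mono) auto
    finally show ?thesis .
  qed
  have meq: "\<phi> \<tau> = m * exp (2 * A \<tau>)" by (simp add: m_def exp_minus)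
  have "m \<le> 2 * k"
  proof (cases "m \<le> 0")
    case False
    have sub: "{c..\<tau>} \<subseteq> {c..d}" using \<tau> by auto
    have wi: "((\<lambda>s. \<alpha> s * exp (2 * A s)) has_integral (exp (2 * A \<tau>) - 1) / 2) {c..\<tau>}"
      unfolding A_def using \<tau> \<alpha> by (intro has_integral_exp_weight integrable_on_subinterval[OF \<alpha>(1)]) auto
    have "m * exp (2 * A \<tau>) \<le> k + integral {c..\<tau>} (\<lambda>s. \<alpha> s * \<phi> s)"
      using le[OF \<tau>(1)] meq by simp
    also have "integral {c..\<tau>} (\<lambda>s. \<alpha> s * \<phi> s) \<le> integral {c..\<tau>} (\<lambda>s. m * (\<alpha> s * exp (2 * A s)))"
    proof (rule integral_le)
      show "(\<lambda>s. \<alpha> s * \<phi> s) integrable_on {c..\<tau>}"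
        using sub \<alpha> \<phi> by (intro integrable_bounded_mult integrable_on_subinterval[OF \<alpha>(1)])
          (auto intro: continuous_on_subset)
      show "(\<lambda>s. m * (\<alpha> s * exp (2 * A s))) integrable_on {c..\<tau>}"
        using has_integral_integrable[OF has_integral_mult_right[OF wi, of m]] by simp
      fix s assume "s \<in> {c..\<tau>}"
      then have "s \<in> {c..d}" using sub by auto
      then show "\<alpha> s * \<phi> s \<le> m * (\<alpha> s * exp (2 * A s))"
        using mult_left_mono[OF m[of s] \<alpha>(2)[of s]] by (simp add: mult_ac)
    qed
    also have "\<dots> = m * ((exp (2 * A \<tau>) - 1) / 2)"
      using has_integral_mult_right[OF wi, of m] by (rule integral_unique)
    finally have "m * exp (2 * A \<tau>) \<le> 2 * k - m" by (simp add: field_simps)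
    moreover have "m \<le> m * exp (2 * A \<tau>)"
      using False A0[OF \<tau>(1)] by simp
    ultimately have "m \<le> 2 * k - m" by (rule order_trans[rotated])
    then show ?thesis using k by simp
  qed (use k in auto)
  then have "m * exp (2 * A t) \<le> 2 * k * exp (2 * A t)" by (intro mult_right_mono) auto
  with m[OF t] have "\<phi> t \<le> 2 * k * exp (2 * A t)" by (rule order_trans)
  then show ?thesis by (simp add: A_def)
qed

text \<open>Banach's fixed point theorem for the integral operator, on all of \<open>{0..}\<close> at once. The unknown is
  written as \<open>x = exp (2 A) z\<close> with \<open>z\<close> bounded and continuous; in the sup norm of \<open>z\<close> the
  operator contracts by \<open>1 / 2\<close>. The bound on \<open>F s 0\<close> is what makes it map bounded functions to
  bounded functions.\<close>

lemma caratheodory_existence: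
  fixes F :: "real \<Rightarrow> 'a::euclidean_space \<Rightarrow> 'a" and \<alpha> :: "real \<Rightarrow> real"
  assumes \<alpha>: "\<And>T. \<alpha> integrable_on {0..T}" "\<And>t. 0 \<le> t \<Longrightarrow> 0 \<le> \<alpha> t"
    and lip: "\<And>s y z. 0 \<le> s \<Longrightarrow> norm (F s y - F s z) \<le> \<alpha> s * norm (y - z)"
    and F0: "\<And>s. 0 \<le> s \<Longrightarrow> norm (F s 0) \<le> \<alpha> s"
    and meas: "\<And>x T. continuous_on {0..} x \<Longrightarrow> (\<lambda>s. F s (x s)) \<in> borel_measurable (lebesgue_on {0..T})"
  obtains x where "continuous_on {0..} x" "\<And>t. 0 \<le> t \<Longrightarrow> x t = x0 + integral {0..t} (\<lambda>s. F s (x s))"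
proof -
  define A where "A t = integral {0..t} \<alpha>" for t
  define w where "w t = exp (2 * A t)" for t
  have A0: "0 \<le> A t" for t
    unfolding A_def using \<alpha> by (intro Henstock_Kurzweil_Integration.integral_nonneg) auto
  have w1: "1 \<le> w t" "A t \<le> w t" for t
    using A0[of t] exp_ge_add_one_self[of "2 * A t"] unfolding w_def by linarith+
  have Acont: "continuous_on {0..} A"
    unfolding A_def by (intro continuous_on_atLeastI indefinite_integral_continuous_1 \<alpha>)
  then have wcont: "continuous_on {0..} w" unfolding w_def by (intro continuous_intros)
  have wi: "((\<lambda>s. \<alpha> s * w s) has_integral (w t - 1) / 2) {0..t}" if "0 \<le> t" for t
    unfolding w_def A_def using that \<alpha> by (intro has_integral_exp_weight) auto
  define X where "X z s = w s *\<^sub>R apply_bcontfun z s" for z :: "real \<Rightarrow>\<^sub>C 'a" and s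
  have Xcont: "continuous_on {0..} (X z)" for z
    unfolding X_def by (intro continuous_on_scaleR wcont continuous_on_apply_bcontfun)
  have bnd: "norm (F s (X z s)) \<le> \<alpha> s + norm z * (\<alpha> s * w s)" if "0 \<le> s" for s z
  proof -
    have "norm (F s (X z s)) \<le> norm (F s 0) + norm (F s (X z s) - F s 0)"
      by (metis norm_triangle_sub)
    also have "\<dots> \<le> \<alpha> s + \<alpha> s * norm (X z s)"
      using lip[OF that, of "X z s" 0] F0[OF that] by simp
    also have "\<dots> \<le> \<alpha> s + \<alpha> s * (w s * norm z)"
      using w1[of s] norm_bounded[of z s] \<alpha>(2)[OF that] by (auto simp: X_def intro!: mult_left_mono)
    finally show ?thesis by (simp add: mult_ac)
  qed
  have bi: "(\<lambda>s. \<alpha> s + B * (\<alpha> s * w s)) integrable_on {0..t}" if "0 \<le> t" for t B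
    using has_integral_integrable[OF has_integral_mult_right[OF wi[OF that], of B]]
    by (intro integrable_add \<alpha>) auto
  have Fi: "(\<lambda>s. F s (X z s)) integrable_on {0..t}" if "0 \<le> t" for t z
    using measurable_bounded_by_integrable_imp_absolutely_integrable[OF meas[OF Xcont] _ bi[OF that]] bnd
    by (auto simp: absolutely_integrable_on_def)
  \<comment> \<open>the conjugated integral operator, frozen for \<open>t < 0\<close> to obtain functions on the whole line\<close>
  define P where "P z t = inverse (w (max t 0)) *\<^sub>R (x0 + integral {0..max t 0} (\<lambda>s. F s (X z s)))" for z t
  have Pb: "P z \<in> bcontfun" for z
  proof (rule bcontfun_normI)
    have cont: "continuous_on {0..} (\<lambda>t. inverse (w t) *\<^sub>R (x0 + integral {0..t} (\<lambda>s. F s (X z s))))"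
      using w1(1) by (intro continuous_intros wcont continuous_on_atLeastI indefinite_integral_continuous_1 Fi)
        (auto simp: w_def)
    show "continuous_on UNIV (P z)" unfolding P_def
      by (rule continuous_on_compose2[OF cont]) (auto intro!: continuous_intros)
    fix t :: real
    define r where "r = max t 0"
    have r: "0 \<le> r" by (simp add: r_def)
    have "norm (integral {0..r} (\<lambda>s. F s (X z s))) \<le> integral {0..r} (\<lambda>s. \<alpha> s + norm z * (\<alpha> s * w s))"
      using bnd by (intro integral_norm_bound_integral Fi bi r) auto
    also have "\<dots> = A r + norm z * ((w r - 1) / 2)"
      unfolding A_def
      by (intro integral_unique has_integral_add integrable_integral \<alpha> has_integral_mult_right wi r)
    also have "\<dots> \<le> w r + norm z * w r"
      using w1[of r] by (intro add_mono mult_left_mono) auto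
    finally have "norm (x0 + integral {0..r} (\<lambda>s. F s (X z s))) \<le> norm x0 + (w r + norm z * w r)"
      by (intro norm_triangle_le) auto
    also have "\<dots> \<le> w r * (norm x0 + 1 + norm z)"
      using mult_right_mono[OF w1(1)[of r] norm_ge_zero[of x0]] by (simp add: algebra_simps)
    finally have "inverse (w r) * norm (x0 + integral {0..r} (\<lambda>s. F s (X z s))) \<le> inverse (w r) * (w r * (norm x0 + 1 + norm z))"
      using w1[of r] by (intro mult_left_mono) auto
    moreover have "\<bar>w r\<bar> = w r" "inverse (w r) * (w r * (norm x0 + 1 + norm z)) = norm x0 + 1 + norm z"
      using w1[of r] by auto
    ultimately show "norm (P z t) \<le> norm x0 + 1 + norm z"
      by (simp add: P_def flip: r_def)
  qed
  have "dist (Bcontfun (P y)) (Bcontfun (P z)) \<le> 1/2 * dist y z" for y z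
  proof (rule dist_bound)
    fix t :: real
    define r where "r = max t 0"
    have r: "0 \<le> r" by (simp add: r_def)
    have "norm (integral {0..r} (\<lambda>s. F s (X y s) - F s (X z s))) \<le> integral {0..r} (\<lambda>s. dist y z * (\<alpha> s * w s))"
    proof (rule integral_norm_bound_integral)
      show "(\<lambda>s. dist y z * (\<alpha> s * w s)) integrable_on {0..r}"
        using has_integral_integrable[OF has_integral_mult_right[OF wi[OF r], of "dist y z"]] .
      fix s assume s: "s \<in> {0..r}"
      have "norm (F s (X y s) - F s (X z s)) \<le> \<alpha> s * norm (X y s - X z s)"
        using s by (intro lip) auto
      also have "norm (X y s - X z s) = w s * dist (apply_bcontfun y s) (apply_bcontfun z s)"
        using w1[of s] by (simp add: X_def dist_norm flip: scaleR_diff_right)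
      also have "\<alpha> s * \<dots> \<le> \<alpha> s * (w s * dist y z)"
        using w1[of s] \<alpha>(2)[of s] s by (intro mult_left_mono dist_bounded) auto
      finally show "norm (F s (X y s) - F s (X z s)) \<le> dist y z * (\<alpha> s * w s)"
        by (simp add: mult_ac)
    qed (intro integrable_diff Fi r)
    also have "\<dots> = dist y z * ((w r - 1) / 2)"
      by (intro integral_unique has_integral_mult_right wi r)
    also have "\<dots> \<le> dist y z * (w r / 2)"
      by (intro mult_left_mono) auto
    finally have *: "norm (integral {0..r} (\<lambda>s. F s (X y s)) - integral {0..r} (\<lambda>s. F s (X z s))) \<le> dist y z * (w r / 2)"
      using Henstock_Kurzweil_Integration.integral_diff[OF Fi[OF r] Fi[OF r]] by metis
    have "dist (P y t) (P z t) = inverse (w r) * norm (integral {0..r} (\<lambda>s. F s (X y s)) - integral {0..r} (\<lambda>s. F s (X z s)))"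
      using w1[of r] by (simp add: P_def r_def dist_norm flip: scaleR_diff_right)
    also have "\<dots> \<le> inverse (w r) * (dist y z * (w r / 2))"
      using w1[of r] by (intro mult_left_mono *) auto
    also have "\<dots> = 1/2 * dist y z" using w1[of r] by simp
    finally show "dist (apply_bcontfun (Bcontfun (P y)) t) (apply_bcontfun (Bcontfun (P z)) t) \<le> 1/2 * dist y z"
      by (simp add: Bcontfun_inverse Pb)
  qed
  then have "\<exists>!z. Bcontfun (P z) = z"
    by (intro banach_fix_type[where c = "1/2"]) auto
  then obtain z where "Bcontfun (P z) = z" by auto
  then have z: "apply_bcontfun z = P z" by (metis Bcontfun_inverse Pb)
  show thesis
  proof
    show "continuous_on {0..} (X z)" by (rule Xcont)
    show "X z t = x0 + integral {0..t} (\<lambda>s. F s (X z s))" if "0 \<le> t" for t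
      using that w1[of t] by (subst X_def, subst z) (simp add: P_def)
  qed
qed

section \<open>Trajectories of the control system\<close>

text \<open>The norm of a matrix is its Frobenius norm; Cauchy-Schwarz row by row.\<close>

lemma norm_matrix_vector_mult_le:
  fixes A :: "real ^ 'm ^ 'n"
  shows "norm (A *v v) \<le> norm A * norm v"
proof -
  have "norm (A *v v) = L2_set (\<lambda>i. \<bar>row i A \<bullet> v\<bar>) UNIV"
    by (simp add: norm_vec_def matrix_mult_dot row_def)
  also have "\<dots> \<le> L2_set (\<lambda>i. norm (A $ i) * norm v) UNIV"
    by (rule L2_set_mono) (auto simp: row_def Cauchy_Schwarz_ineq2)
  also have "\<dots> = norm A * norm v"
    by (simp add: norm_vec_def L2_set_left_distrib)
  finally show ?thesis .
qed

lemma bounded_bilinear_matrix_vector_mult: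
  "bounded_bilinear ((*v) :: real ^ 'm ^ 'n \<Rightarrow> real ^ 'm \<Rightarrow> real ^ 'n)"
proof
  show "\<exists>K. \<forall>A v. norm ((A :: real ^ 'm ^ 'n) *v v) \<le> norm A * norm v * K"
    by (rule exI[of _ 1]) (simp add: norm_matrix_vector_mult_le)
qed (simp_all add: matrix_vector_mult_add_rdistrib matrix_vector_right_distrib
    scaleR_matrix_vector_assoc linear_scale[OF matrix_vector_mul_linear])

lemma bilinear_matrix_vector_mult:
  "bilinear ((*v) :: real ^ 'm ^ 'n \<Rightarrow> real ^ 'm \<Rightarrow> real ^ 'n)"
  using bounded_bilinear_matrix_vector_mult bilinear_conv_bounded_bilinear by blast

lemma absolutely_integrable_matrix_vector_mult:
  fixes M :: "real \<Rightarrow> real ^ 'm ^ 'n" and u :: "real \<Rightarrow> real ^ 'm"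
  assumes M: "continuous_on {c..d} M" and u: "u absolutely_integrable_on {c..d}"
  shows "(\<lambda>s. M s *v u s) absolutely_integrable_on {c..d}"
proof (rule absolutely_integrable_bounded_measurable_product[OF bilinear_matrix_vector_mult _ _ _ u])
  show "M \<in> borel_measurable (lebesgue_on {c..d})"
    using M by (intro continuous_imp_measurable_on_sets_lebesgue) auto
  show "bounded (M ` {c..d})"
    using M by (intro compact_imp_bounded compact_continuous_image) auto
qed auto

text \<open>The radial retraction onto the ball of radius \<open>r\<close>. In this form it is jointly continuous in \<open>r\<close> and
  \<open>y\<close> for \<open>r > 0\<close>, which gives measurability when the radius depends on time.\<close>

definition radial_truncation :: "real \<Rightarrow> 'a::real_normed_vector \<Rightarrow> 'a" where
  "radial_truncation r y = (r / max r (norm y)) *\<^sub>R y"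

lemma norm_radial_truncation_le: "r > 0 \<Longrightarrow> norm (radial_truncation r y) \<le> r"
  by (auto simp: radial_truncation_def max_def field_simps)

lemma radial_truncation_id: "norm y \<le> r \<Longrightarrow> r > 0 \<Longrightarrow> radial_truncation r y = y"
  by (simp add: radial_truncation_def max_def)

lemma radial_truncation_lipschitz:
  assumes r: "r > 0"
  shows "norm (radial_truncation r y - radial_truncation r z) \<le> 2 * norm (y - z)"
proof -
  define p q where "p = max r (norm y)" and "q = max r (norm z)"
  have pq: "p \<ge> r" "q \<ge> r" "q \<ge> norm z" "p > 0" "q > 0" using r by (auto simp: p_def q_def)
  have "radial_truncation r y - radial_truncation r z = (r / p) *\<^sub>R (y - z) + (r / p - r / q) *\<^sub>R z"
    by (simp add: radial_truncation_def p_def q_def algebra_simps)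
  also have "norm \<dots> \<le> norm ((r / p) *\<^sub>R (y - z)) + norm ((r / p - r / q) *\<^sub>R z)"
    by (rule norm_triangle_ineq)
  also have "norm ((r / p) *\<^sub>R (y - z)) \<le> 1 * norm (y - z)"
    unfolding norm_scaleR using pq r by (intro mult_right_mono) auto
  also have "norm ((r / p - r / q) *\<^sub>R z) = (r / p) * (norm z / q) * \<bar>q - p\<bar>"
  proof -
    have "r / p - r / q = r * (q - p) / (p * q)" using pq by (simp add: field_simps)
    then show ?thesis using pq r by (simp add: abs_mult)
  qed
  also have "\<dots> \<le> 1 * 1 * \<bar>q - p\<bar>"
    using pq r by (intro mult_mono mult_right_mono) auto
  also have "\<bar>q - p\<bar> \<le> norm (y - z)"
  proof -
    have "\<bar>q - p\<bar> \<le> \<bar>norm z - norm y\<bar>" unfolding p_def q_def by (auto simp: max_def)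
    also have "\<dots> \<le> norm (y - z)" by (metis norm_minus_commute norm_triangle_ineq3)
    finally show ?thesis .
  qed
  finally show ?thesis by simp
qed

text \<open>The class of controls for which trajectories are constructed. It is stable under time shifts and
  contains the square-integrable controls as well as the zero control of the free dynamics.\<close>

definition locally_integrable :: "(real \<Rightarrow> 'b::euclidean_space) \<Rightarrow> bool" where
  "locally_integrable u \<longleftrightarrow> (\<forall>T. u absolutely_integrable_on {0..T})"

lemma locally_integrable_norm: "locally_integrable u \<Longrightarrow> (\<lambda>s. norm (u s)) integrable_on {0..T}"
  by (simp add: locally_integrable_def absolutely_integrable_on_def)

text \<open>The standing hypotheses in quantitative form: \<open>f\<close> is Lipschitz, \<open>g\<close> is bounded by \<open>G\<close>, and \<open>l n\<close> is
  a Lipschitz constant of \<open>g\<close> on the ball of radius \<open>n\<close>. Monotonicity of \<open>l\<close> makes \<open>l\<close>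
  measurable along a growing radius.\<close>

locale control_system =
  fixes f :: "real ^ 'n \<Rightarrow> real ^ 'n" and g :: "real ^ 'n \<Rightarrow> real ^ 'm ^ 'n"
    and L G :: real and l :: "nat \<Rightarrow> real"
  assumes L0: "0 \<le> L" and G0: "0 \<le> G" and f0: "f 0 = 0"
    and f_lip: "norm (f y - f z) \<le> L * norm (y - z)"
    and g_bound: "norm (g y) \<le> G"
    and g_cont: "continuous_on UNIV g"
    and l0: "0 \<le> l n" and l_mono: "mono l"
    and g_lip: "norm y \<le> real n \<Longrightarrow> norm z \<le> real n \<Longrightarrow> norm (g y - g z) \<le> l n * norm (y - z)"
begin

lemma f_cont: "continuous_on UNIV f"
proof -
  have "L-lipschitz_on UNIV f"
    using L0 f_lip by (auto simp: lipschitz_on_def dist_norm)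
  then show ?thesis by (rule lipschitz_on_continuous_on)
qed

lemma norm_f_le: "norm (f y) \<le> L * norm y"
  using f_lip[of y 0] f0 by simp

lemma norm_g_mult_le: "norm (g y *v v) \<le> G * norm v"
  by (rule order_trans[OF norm_matrix_vector_mult_le]) (intro mult_right_mono g_bound norm_ge_zero)

definition integral_solution :: "(real \<Rightarrow> real ^ 'm) \<Rightarrow> real ^ 'n \<Rightarrow> (real \<Rightarrow> real ^ 'n) \<Rightarrow> bool" where
  "integral_solution u x0 x \<longleftrightarrow> continuous_on {0..} x \<and>
     (\<forall>t\<ge>0. x t = x0 + integral {0..t} (\<lambda>s. f (x s) + g (x s) *v u s))"

text \<open>The a priori bound for trajectories. The summand \<open>1\<close> keeps it positive, so that one can truncate at
  this radius.\<close>

definition radius :: "(real \<Rightarrow> real ^ 'm) \<Rightarrow> real ^ 'n \<Rightarrow> real \<Rightarrow> real" where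
  "radius u x0 t = 2 * (norm x0 + 1 + G * integral {0..t} (\<lambda>s. norm (u s))) * exp (2 * (L * t))"

lemma rhs_absolutely_integrable:
  assumes u: "locally_integrable u" and x: "continuous_on {0..} x"
  shows "(\<lambda>s. f (x s) + g (x s) *v u s) absolutely_integrable_on {0..T}"
proof -
  have x': "continuous_on {0..T} x" using x by (rule continuous_on_subset) auto
  have "continuous_on {0..T} (\<lambda>s. f (x s))" "continuous_on {0..T} (\<lambda>s. g (x s))"
    using continuous_on_compose2[OF f_cont x'] continuous_on_compose2[OF g_cont x'] by auto
  then show ?thesis
    using u absolutely_integrable_matrix_vector_mult[of 0 T "\<lambda>s. g (x s)" u]
    by (intro set_integral_add(1)[OF absolutely_integrable_continuous_real]) (auto simp: locally_integrable_def)
qed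

text \<open>Stated for an arbitrary integrand of linear growth, because it is applied to the truncated
  system in the existence proof as well as to the original one.\<close>

lemma a_priori_bound:
  assumes u: "locally_integrable u" and x: "continuous_on {0..} x"
    and hi: "\<And>T. h integrable_on {0..T}"
    and xh: "\<And>t. 0 \<le> t \<Longrightarrow> x t = x0 + integral {0..t} h"
    and h: "\<And>s. 0 \<le> s \<Longrightarrow> norm (h s) \<le> L * norm (x s) + G * norm (u s)"
    and t: "0 \<le> t"
  shows "norm (x t) \<le> radius u x0 t"
proof -
  let ?U = "\<lambda>t. integral {0..t} (\<lambda>s. norm (u s))"
  have U0: "0 \<le> ?U s" "s \<le> t \<Longrightarrow> 0 \<le> s \<Longrightarrow> ?U s \<le> ?U t" for s
    using locally_integrable_norm[OF u]
    by (auto intro!: Henstock_Kurzweil_Integration.integral_nonneg indefinite_integral_mono)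
  have x': "continuous_on {0..t} (\<lambda>s. norm (x s))"
    using x by (intro continuous_intros) (auto intro: continuous_on_subset)
  have "norm (x t) \<le> 2 * (norm x0 + G * ?U t) * exp (2 * integral {0..t} (\<lambda>_. L))"
  proof (rule gronwall_integral[where d = t])
    fix s assume s: "s \<in> {0..t}"
    have xi: "(\<lambda>s. norm (x s)) integrable_on {0..s}"
      using s by (intro integrable_continuous_real continuous_on_subset[OF x']) auto
    have "norm (integral {0..s} h) \<le> integral {0..s} (\<lambda>s. L * norm (x s) + G * norm (u s))"
      using h by (intro integral_norm_bound_integral hi integrable_add integrable_on_mult_right
          xi locally_integrable_norm[OF u]) auto
    also have "\<dots> = integral {0..s} (\<lambda>s. L * norm (x s)) + G * ?U s"
      by (subst Henstock_Kurzweil_Integration.integral_add)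
        (auto intro!: integrable_on_mult_right xi locally_integrable_norm[OF u])
    also have "G * ?U s \<le> G * ?U t" using s G0 U0 by (intro mult_left_mono) auto
    finally have "norm (x0 + integral {0..s} h) \<le> norm x0 + (integral {0..s} (\<lambda>s. L * norm (x s)) + G * ?U t)"
      by (intro norm_triangle_le) auto
    then show "norm (x s) \<le> norm x0 + G * ?U t + integral {0..s} (\<lambda>s. L * norm (x s))"
      using xh[of s] s by (simp add: add_ac)
  qed (use L0 G0 U0 t x' in auto)
  also have "\<dots> = 2 * (norm x0 + G * ?U t) * exp (2 * (L * t))"
    using t by (simp add: mult_ac)
  also have "\<dots> \<le> radius u x0 t"
    unfolding radius_def by (intro mult_right_mono) auto
  finally show ?thesis .
qed

lemma integral_solution_norm_le_radius:
  assumes u: "locally_integrable u" and x: "integral_solution u x0 x" and t: "0 \<le> t"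
  shows "norm (x t) \<le> radius u x0 t"
proof (rule a_priori_bound[OF u])
  show c: "continuous_on {0..} x" using x by (simp add: integral_solution_def)
  show "(\<lambda>s. f (x s) + g (x s) *v u s) integrable_on {0..T}" for T
    using rhs_absolutely_integrable[OF u c] by (simp add: absolutely_integrable_on_def)
  show "norm (f (x s) + g (x s) *v u s) \<le> L * norm (x s) + G * norm (u s)" for s
    by (intro norm_triangle_mono norm_f_le norm_g_mult_le)
qed (use x t in \<open>auto simp: integral_solution_def\<close>)

lemma radius_mono:
  assumes u: "locally_integrable u" and st: "s \<le> t"
  shows "radius u x0 s \<le> radius u x0 t"
proof -
  have "integral {0..s} (\<lambda>s. norm (u s)) \<le> integral {0..t} (\<lambda>s. norm (u s))"
    using locally_integrable_norm[OF u] st by (intro integral_subset_le) auto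
  then show ?thesis
    unfolding radius_def using L0 G0 st locally_integrable_norm[OF u]
    by (intro mult_mono) (auto intro!: mult_left_mono add_nonneg_nonneg mult_nonneg_nonneg
        Henstock_Kurzweil_Integration.integral_nonneg)
qed

lemma radius_pos:
  assumes u: "locally_integrable u"
  shows "0 < radius u x0 t"
proof -
  have "0 \<le> G * integral {0..t} (\<lambda>s. norm (u s))"
    using locally_integrable_norm[OF u] G0
    by (intro mult_nonneg_nonneg Henstock_Kurzweil_Integration.integral_nonneg) auto
  then have "0 < norm x0 + 1 + G * integral {0..t} (\<lambda>s. norm (u s))"
    using norm_ge_zero[of x0] by linarith
  then show ?thesis by (simp add: radius_def)
qed

text \<open>Only \<open>g\<close> may fail to be globally Lipschitz. Replace its argument by the radial truncation at
  \<open>R t = radius u x0 t\<close>. The modified right-hand side is globally Lipschitz with a locally integrable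
  constant, and still of linear growth. Hence its solution obeys the a priori bound, never
  notices the truncation, and solves the original equation. Letting the radius depend on time avoids
  gluing solutions on longer and longer intervals.\<close>

theorem integral_solution_exists:
  assumes u: "locally_integrable u"
  obtains x where "integral_solution u x0 x"
proof -
  define R where "R = radius u x0"
  \<comment> \<open>\<open>l\<close> is indexed by integer radii\<close>
  define N where "N s = nat \<lceil>R s\<rceil>" for s
  have R: "0 < R s" "s \<le> t \<Longrightarrow> R s \<le> R t" "R s \<le> real (N s)" for s t
    using radius_pos[OF u] radius_mono[OF u] real_nat_ceiling_ge[of "R s"] by (auto simp: R_def N_def)
  have Rcont: "continuous_on {0..} R"
    unfolding R_def radius_def
    by (intro continuous_intros continuous_on_atLeastI indefinite_integral_continuous_1 locally_integrable_norm u)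
  define F where "F s y = f y + g (radial_truncation (R s) y) *v u s" for s y
  \<comment> \<open>the factor \<open>2\<close> is the Lipschitz constant of the truncation\<close>
  define k where "k s = 2 * l (N s) + G" for s
  define \<alpha> where "\<alpha> s = L + k s * norm (u s)" for s
  have k0: "0 \<le> k s" "s \<le> t \<Longrightarrow> k s \<le> k t" for s t
    using l0 G0 R(2)[of s t] by (auto simp: k_def N_def intro!: monoD[OF l_mono] nat_mono ceiling_mono)
  have \<alpha>i: "\<alpha> integrable_on {0..T}" for T
  proof -
    have "(\<lambda>s. k s * norm (u s)) absolutely_integrable_on {0..T}"
    proof (rule absolutely_integrable_bounded_measurable_product_real)
      show "k \<in> borel_measurable (lebesgue_on {0..T})"
      proof (rule measurable_restrict_space1, rule measurable_completion)
        have "k \<in> borel_measurable borel"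
          by (rule borel_measurable_mono) (auto intro!: monoI k0)
        then show "k \<in> borel_measurable lborel" by simp
      qed
      show "bounded (k ` {0..T})"
        unfolding bounded_iff using k0 by (intro exI[of _ "k T"]) auto
      show "(\<lambda>s. norm (u s)) absolutely_integrable_on {0..T}"
        using u by (auto simp: locally_integrable_def intro: absolutely_integrable_norm[unfolded o_def])
    qed auto
    then show ?thesis
      unfolding \<alpha>_def by (intro integrable_add integrable_const_ivl) (simp add: absolutely_integrable_on_def)
  qed
  have Fbound: "norm (F s y) \<le> L * norm y + G * norm (u s)" for s y
    unfolding F_def by (intro norm_triangle_mono norm_f_le norm_g_mult_le)
  have meas: "(\<lambda>s. F s (x s)) absolutely_integrable_on {0..T}" if x: "continuous_on {0..} x" for x T
  proof -
    have x': "continuous_on {0..T} x" using x by (rule continuous_on_subset) auto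
    have R': "continuous_on {0..T} R" using Rcont by (rule continuous_on_subset) auto
    have "max (R s) (norm (x s)) \<noteq> 0" for s using R(1)[of s] by linarith
    then have "continuous_on {0..T} (\<lambda>s. radial_truncation (R s) (x s))"
      unfolding radial_truncation_def by (intro continuous_intros x' R') auto
    then have "continuous_on {0..T} (\<lambda>s. f (x s))" "continuous_on {0..T} (\<lambda>s. g (radial_truncation (R s) (x s)))"
      using continuous_on_compose2[OF f_cont x'] continuous_on_compose2[OF g_cont] by auto
    then show ?thesis
      using u absolutely_integrable_matrix_vector_mult[of 0 T "\<lambda>s. g (radial_truncation (R s) (x s))" u]
      unfolding F_def
      by (intro set_integral_add(1)[OF absolutely_integrable_continuous_real]) (auto simp: locally_integrable_def)
  qed
  obtain x where x: "continuous_on {0..} x" "\<And>t. 0 \<le> t \<Longrightarrow> x t = x0 + integral {0..t} (\<lambda>s. F s (x s))"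
  proof (rule caratheodory_existence[of \<alpha> F x0])
    show "0 \<le> \<alpha> t" for t using L0 k0(1)[of t] by (simp add: \<alpha>_def)
    show "norm (F s y - F s z) \<le> \<alpha> s * norm (y - z)" for s y z
    proof -
      let ?P = "radial_truncation (R s)"
      have "norm (g (?P y) - g (?P z)) \<le> l (N s) * norm (?P y - ?P z)"
        by (rule g_lip) (use norm_radial_truncation_le[OF R(1)] R(3) order_trans in blast)+
      also have "\<dots> \<le> l (N s) * (2 * norm (y - z))"
        by (intro mult_left_mono radial_truncation_lipschitz R l0)
      also have "\<dots> \<le> k s * norm (y - z)"
        using G0 by (simp add: k_def algebra_simps)
      finally have *: "norm (g (?P y) - g (?P z)) \<le> k s * norm (y - z)" .
      have "F s y - F s z = (f y - f z) + (g (?P y) - g (?P z)) *v u s"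
        by (simp add: F_def matrix_vector_mult_diff_rdistrib)
      also have "norm \<dots> \<le> L * norm (y - z) + k s * norm (y - z) * norm (u s)"
        by (intro norm_triangle_mono f_lip order_trans[OF norm_matrix_vector_mult_le] mult_right_mono * norm_ge_zero)
      finally show ?thesis by (simp add: \<alpha>_def algebra_simps)
    qed
    show "norm (F s 0) \<le> \<alpha> s" for s
    proof -
      have "norm (F s 0) \<le> G * norm (u s)" using Fbound[of s 0] by simp
      also have "\<dots> \<le> k s * norm (u s)" using l0 by (intro mult_right_mono) (auto simp: k_def)
      finally show ?thesis using L0 by (simp add: \<alpha>_def)
    qed
    show "(\<lambda>s. F s (x s)) \<in> borel_measurable (lebesgue_on {0..T})" if "continuous_on {0..} x" for x T
      by (intro absolutely_integrable_imp_borel_measurable meas that) auto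
  qed (use \<alpha>i in auto)
  have "norm (x t) \<le> R t" if "0 \<le> t" for t
    unfolding R_def using meas[OF x(1)] Fbound that
    by (intro a_priori_bound[OF u x(1) _ x(2)]) (auto simp: absolutely_integrable_on_def)
  then have "F s (x s) = f (x s) + g (x s) *v u s" if "0 \<le> s" for s
    using that R(1) by (simp add: F_def radial_truncation_id)
  then have "integral {0..t} (\<lambda>s. F s (x s)) = integral {0..t} (\<lambda>s. f (x s) + g (x s) *v u s)" for t
    by (intro Henstock_Kurzweil_Integration.integral_cong) auto
  then have "integral_solution u x0 x" using x by (simp add: integral_solution_def)
  then show thesis by (rule that)
qed

text \<open>The right-hand sides differ by Lipschitz terms in \<open>x - y\<close> plus \<open>g y (u - v)\<close>. What matters is that the
  hypothesis concerns the integral of this last term and not the integral of its norm: it stays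
  small for controls that are close only in the weak sense.\<close>

theorem integral_solution_dist_le:
  assumes u: "locally_integrable u" and v: "locally_integrable v" and x: "integral_solution u x0 x" and y: "integral_solution v x0 y"
    and bound: "\<And>s. s \<in> {0..T} \<Longrightarrow> norm (x s) \<le> real N \<and> norm (y s) \<le> real N"
    and k: "\<And>t. t \<in> {0..T} \<Longrightarrow> norm (integral {0..t} (\<lambda>s. g (y s) *v (u s - v s))) \<le> k"
    and t: "t \<in> {0..T}"
  shows "norm (x t - y t) \<le> 2 * k * exp (2 * integral {0..t} (\<lambda>s. L + l N * norm (u s)))"
proof (rule gronwall_integral[OF _ _ _ _ _ t])
  have xc: "continuous_on {0..} x" and yc: "continuous_on {0..} y" using x y by (auto simp: integral_solution_def)
  have T: "0 \<le> T" using t by auto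
  show \<alpha>i: "(\<lambda>s. L + l N * norm (u s)) integrable_on {0..T}" for T
    by (intro integrable_add integrable_on_mult_right locally_integrable_norm[OF u] integrable_const_ivl)
  show \<alpha>0: "0 \<le> L + l N * norm (u s)" for s using L0 l0 by simp
  show dc: "continuous_on {0..T} (\<lambda>s. norm (x s - y s))" for T
    using xc yc by (intro continuous_intros) (auto intro: continuous_on_subset)
  show "0 \<le> k" using order_trans[OF norm_ge_zero k[of 0]] T by simp
  fix t assume t: "t \<in> {0..T}"
  have uv: "(\<lambda>s. u s - v s) absolutely_integrable_on {0..t}"
    using u v by (intro set_integral_diff) (auto simp: locally_integrable_def)
  have gy: "continuous_on {0..t} (\<lambda>s. g (y s))"
    using continuous_on_compose2[OF g_cont continuous_on_subset[OF yc]] by auto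
  let ?X = "\<lambda>s. f (x s) + g (x s) *v u s" and ?Y = "\<lambda>s. f (y s) + g (y s) *v v s"
    and ?W = "\<lambda>s. g (y s) *v (u s - v s)"
  have i: "?X integrable_on {0..t}" "?Y integrable_on {0..t}" "?W integrable_on {0..t}"
    using rhs_absolutely_integrable[OF u xc] rhs_absolutely_integrable[OF v yc]
      absolutely_integrable_matrix_vector_mult[OF gy uv]
    by (auto simp: absolutely_integrable_on_def)
  let ?D = "\<lambda>s. ?X s - ?Y s - ?W s"
  have Di: "?D integrable_on {0..t}" by (intro integrable_diff i)
  have "x t - y t = integral {0..t} ?X - integral {0..t} ?Y"
    using x y t by (simp add: integral_solution_def)
  also have "\<dots> = integral {0..t} ?W + integral {0..t} ?D"
    using i by (simp add: Henstock_Kurzweil_Integration.integral_diff integrable_diff)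
  finally have eq: "x t - y t = integral {0..t} ?W + integral {0..t} ?D" .
  have "norm (integral {0..t} ?D) \<le> integral {0..t} (\<lambda>s. (L + l N * norm (u s)) * norm (x s - y s))"
  proof (rule integral_norm_bound_integral[OF Di])
    show "(\<lambda>s. (L + l N * norm (u s)) * norm (x s - y s)) integrable_on {0..t}"
      by (intro integrable_bounded_mult \<alpha>i \<alpha>0 dc)
    fix s assume s: "s \<in> {0..t}"
    then have "norm (x s) \<le> real N" "norm (y s) \<le> real N" using bound[of s] t by auto
    then have gl: "norm (g (x s) - g (y s)) \<le> l N * norm (x s - y s)" by (rule g_lip)
    have "?D s = (f (x s) - f (y s)) + (g (x s) - g (y s)) *v u s"
      by (simp add: matrix_vector_mult_diff_rdistrib matrix_vector_mult_diff_distrib)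
    also have "norm \<dots> \<le> L * norm (x s - y s) + l N * norm (x s - y s) * norm (u s)"
      by (intro norm_triangle_mono f_lip order_trans[OF norm_matrix_vector_mult_le] mult_right_mono gl norm_ge_zero)
    finally show "norm (?D s) \<le> (L + l N * norm (u s)) * norm (x s - y s)" by (simp add: algebra_simps)
  qed
  with k[OF t] show "norm (x t - y t) \<le> k + integral {0..t} (\<lambda>s. (L + l N * norm (u s)) * norm (x s - y s))"
    unfolding eq by (intro norm_triangle_mono)
qed

lemma trajectory_iff_integral_solution:
  assumes u: "locally_integrable u"
  shows "trajectory_on f g x0 u {0..} x \<longleftrightarrow> integral_solution u x0 x"
proof
  assume x: "trajectory_on f g x0 u {0..} x"
  then have c: "caratheodory_solution (\<lambda>t y. f y + g y *v u t) {0..} x" and "x 0 = x0"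
    by (auto simp: trajectory_on_def)
  then show "integral_solution u x0 x"
    using caratheodory_solution_imp_integral(1)[OF c] integral_unique[OF caratheodory_solution_imp_integral(2)[OF c]]
    by (simp add: integral_solution_def)
next
  assume x: "integral_solution u x0 x"
  then have "continuous_on {0..} x" by (simp add: integral_solution_def)
  then have "caratheodory_solution (\<lambda>t y. f y + g y *v u t) {0..} x"
    using x rhs_absolutely_integrable[OF u] by (intro integral_imp_caratheodory_solution[of _ _ x0]) (auto simp: integral_solution_def)
  moreover have "x 0 = x0" using x by (auto simp: integral_solution_def)
  ultimately show "trajectory_on f g x0 u {0..} x" by (simp add: trajectory_on_def)
qed

lemma traj_integral_solution:
  assumes u: "locally_integrable u"
  shows "integral_solution u x0 (traj f g x0 u)"
proof -
  obtain x where "integral_solution u x0 x" using integral_solution_exists[OF u] .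
  then have "trajectory_on f g x0 u {0..} x" by (simp add: trajectory_iff_integral_solution[OF u])
  then have "trajectory_on f g x0 u {0..} (traj f g x0 u)" using someI[of "trajectory_on f g x0 u {0..}"] by (simp add: traj_def)
  then show ?thesis by (simp add: trajectory_iff_integral_solution[OF u])
qed

lemma escape_time_infinite:
  assumes u: "locally_integrable u"
  shows "escape_time f g x0 u = \<infinity>"
proof -
  have "ereal T \<le> escape_time f g x0 u" if T: "0 \<le> T" for T
    unfolding escape_time_def
  proof (rule Sup_upper, safe intro!: exI[of _ T] exI[of _ "traj f g x0 u"])
    have "trajectory_on f g x0 u {0..} (traj f g x0 u)"
      using traj_integral_solution[OF u] by (simp add: trajectory_iff_integral_solution[OF u])
    then show "trajectory_on f g x0 u {0..T} (traj f g x0 u)"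
      unfolding trajectory_on_def caratheodory_solution_def
      by (auto elim!: eventually_mono intro: has_vector_derivative_within_subset)
  qed (use T in auto)
  then have "ereal (real n) \<le> escape_time f g x0 u" for n by simp
  then show ?thesis by (metis ereal_top real_arch_simple ereal_less_eq(3) order_trans)
qed

end

section \<open>Decay of trajectories\<close>

text \<open>The Cauchy-Schwarz inequality with a free parameter \<open>\<eta>\<close> in place of the optimal one; choosing \<open>\<eta>\<close>
  later avoids square roots.\<close>

lemma integral_norm_le_energy:
  fixes u :: "real \<Rightarrow> 'b::euclidean_space"
  assumes u: "u absolutely_integrable_on {a..b}" and q: "(\<lambda>s. (norm (u s))\<^sup>2) integrable_on {a..b}"
    and \<eta>: "\<eta> > 0" and ab: "a \<le> b"
  shows "integral {a..b} (\<lambda>s. norm (u s)) \<le> \<eta> * (b - a) / 2 + integral {a..b} (\<lambda>s. (norm (u s))\<^sup>2) / (2 * \<eta>)"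
proof -
  let ?q = "\<lambda>s. (norm (u s))\<^sup>2"
  have "integral {a..b} (\<lambda>s. norm (u s)) \<le> integral {a..b} (\<lambda>s. \<eta> / 2 + ?q s / (2 * \<eta>))"
  proof (rule integral_le)
    show "(\<lambda>s. norm (u s)) integrable_on {a..b}" using u by (simp add: absolutely_integrable_on_def)
    show "(\<lambda>s. \<eta> / 2 + ?q s / (2 * \<eta>)) integrable_on {a..b}"
      by (intro integrable_add integrable_on_divide q integrable_const_ivl)
    fix s
    have "0 \<le> (norm (u s) - \<eta>)\<^sup>2 / (2 * \<eta>)" using \<eta> by simp
    also have "\<dots> = \<eta> / 2 + ?q s / (2 * \<eta>) - norm (u s)"
      using \<eta> by (simp add: power2_eq_square field_simps)
    finally show "norm (u s) \<le> \<eta> / 2 + ?q s / (2 * \<eta>)" by simp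
  qed
  also have "\<dots> = \<eta> * (b - a) / 2 + integral {a..b} ?q / (2 * \<eta>)"
    using ab by (subst Henstock_Kurzweil_Integration.integral_add)
      (auto intro!: integrable_on_divide q)
  finally show ?thesis .
qed

lemma half_recursion_tendsto_0:
  fixes b c :: "nat \<Rightarrow> real"
  assumes b0: "\<And>n. 0 \<le> b n" and b: "\<And>n. b (Suc n) \<le> b n / 2 + c n" and c: "c \<longlonglongrightarrow> 0"
  shows "b \<longlonglongrightarrow> 0"
proof (rule LIMSEQ_I)
  fix e :: real assume e: "e > 0"
  obtain N where N: "\<And>n. N \<le> n \<Longrightarrow> \<bar>c n\<bar> < e / 4"
    using LIMSEQ_D[OF c, of "e/4"] e by auto
  have rec: "b (N + k) \<le> b N * (1/2) ^ k + e / 2" for k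
  proof (induction k)
    case (Suc k)
    have "b (N + Suc k) \<le> b (N + k) / 2 + e / 4"
      using b[of "N + k"] N[of "N + k"] by simp
    then show ?case using Suc by simp
  qed (use e in simp)
  have "(\<lambda>k. b N * (1/2) ^ k) \<longlonglongrightarrow> b N * 0"
    by (intro tendsto_intros LIMSEQ_power_zero) auto
  then obtain M where M: "\<And>k. M \<le> k \<Longrightarrow> \<bar>b N * (1/2) ^ k\<bar> < e / 2"
    using LIMSEQ_D[of "\<lambda>k. b N * (1/2) ^ k" 0 "e/2"] e by auto
  show "\<exists>no. \<forall>n\<ge>no. norm (b n - 0) < e"
  proof (intro exI[of _ "N + M"] allI impI)
    fix n assume n: "N + M \<le> n"
    then have "b n \<le> b N * (1/2) ^ (n - N) + e / 2" using rec[of "n - N"] by simp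
    moreover have "\<bar>b N * (1/2) ^ (n - N)\<bar> < e / 2" using M[of "n - N"] n by simp
    ultimately show "norm (b n - 0) < e" using b0[of n] unfolding real_norm_def by linarith
  qed
qed

lemma window_integral_tendsto_0:
  fixes q :: "real \<Rightarrow> real"
  assumes q: "q integrable_on {0..}" and q0: "\<And>s. 0 \<le> s \<Longrightarrow> 0 \<le> q s" and T: "T \<ge> 0"
  shows "(\<lambda>n. integral {real n * T..real n * T + T} q) \<longlonglongrightarrow> 0"
proof -
  define Q where "Q n = integral {0..real n * T} q" for n
  have qi: "q integrable_on {a..b}" if "0 \<le> a" for a b
    using that by (intro integrable_on_subinterval[OF q]) auto
  have eq: "integral {real n * T..real n * T + T} q = Q (Suc n) - Q n" for n
    using Henstock_Kurzweil_Integration.integral_combine[of 0 "real n * T" "real n * T + T" q] qi T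
    by (simp add: Q_def algebra_simps)
  have "integral {real n * T..real n * T + T} q \<ge> 0" for n
  proof (intro Henstock_Kurzweil_Integration.integral_nonneg qi q0)
    have "0 \<le> real n * T" using T by simp
    then show "0 \<le> real n * T" "s \<in> {real n * T..real n * T + T} \<Longrightarrow> 0 \<le> s" for s
      unfolding atLeastAtMost_iff by linarith+
  qed
  then have "incseq Q" unfolding eq by (intro incseq_SucI) simp
  moreover have "Q n \<le> integral {0..} q" for n
    unfolding Q_def using q0 by (intro integral_subset_le q qi) auto
  ultimately obtain l where "Q \<longlonglongrightarrow> l" using incseq_convergent by blast
  from tendsto_diff[OF LIMSEQ_Suc[OF this] this] show ?thesis unfolding eq by simp
qed

context control_system begin

lemma integral_solution_shift:
  assumes u: "locally_integrable u" and x: "integral_solution u x0 x" and c: "0 \<le> c"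
  shows "locally_integrable (\<lambda>s. u (c + s))" and "integral_solution (\<lambda>s. u (c + s)) (x c) (\<lambda>s. x (c + s))"
proof -
  show cu: "locally_integrable (\<lambda>s. u (c + s))"
    unfolding locally_integrable_def
  proof
    fix T
    have "u absolutely_integrable_on {c..T + c}"
      using u c by (auto simp: locally_integrable_def intro: absolutely_integrable_on_subinterval)
    then show "(\<lambda>s. u (c + s)) absolutely_integrable_on {0..T}"
      using integrable_on_shift_Icc_real[of u c 0 T] integrable_on_shift_Icc_real[of "\<lambda>s. norm (u s)" c 0 T]
      by (simp add: absolutely_integrable_on_def o_def)
  qed
  have xc: "continuous_on {0..} x" using x by (simp add: integral_solution_def)
  let ?h = "\<lambda>s. f (x s) + g (x s) *v u s"
  have hi: "?h integrable_on {0..t}" for t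
    using rhs_absolutely_integrable[OF u xc] by (simp add: absolutely_integrable_on_def)
  show "integral_solution (\<lambda>s. u (c + s)) (x c) (\<lambda>s. x (c + s))"
    unfolding integral_solution_def
  proof (intro conjI allI impI)
    show "continuous_on {0..} (\<lambda>s. x (c + s))"
      by (rule continuous_on_compose2[OF xc]) (use c in \<open>auto intro!: continuous_intros\<close>)
    fix t :: real assume t: "0 \<le> t"
    have "x (c + t) = x0 + integral {0..c + t} ?h" "x c = x0 + integral {0..c} ?h"
      using x c t by (auto simp: integral_solution_def)
    moreover have "integral {0..c} ?h + integral {c..c + t} ?h = integral {0..c + t} ?h"
      using Henstock_Kurzweil_Integration.integral_combine[of 0 c "c + t" ?h] hi c t by simp
    moreover have "integral {0..t} (\<lambda>s. ?h (c + s)) = integral {c..c + t} ?h"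
      using integral_shift_Icc_real[of 0 t ?h c] by (simp add: o_def add_ac)
    ultimately show "x (c + t) = x c + integral {0..t} (\<lambda>s. ?h (c + s))" by (simp add: algebra_simps)
  qed
qed

lemma integral_solution_bounded:
  assumes u: "locally_integrable u" and x: "integral_solution u x0 x" and s: "s \<in> {0..T}"
  shows "norm (x s) \<le> real (nat \<lceil>radius u x0 T\<rceil>)"
  using integral_solution_norm_le_radius[OF u x, of s] radius_mono[OF u, of s T x0] s
    real_nat_ceiling_ge[of "radius u x0 T"] by auto

text \<open>The free trajectory takes the role of the first solution in the comparison estimate, so that its
  zero control appears in the exponent and the constant depends neither on \<open>u\<close> nor on the
  Lipschitz constants of \<open>g\<close>.\<close>

lemma integral_solution_dist_free_le:
  assumes u: "locally_integrable u" and x: "integral_solution u x0 x" and y: "integral_solution (\<lambda>_. 0) x0 y" and t: "0 \<le> t" "t \<le> T"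
  shows "norm (x t) \<le> norm (y t) + 2 * (G * integral {0..T} (\<lambda>s. norm (u s))) * exp (2 * (L * T))"
proof -
  let ?k = "G * integral {0..T} (\<lambda>s. norm (u s))"
  define N where "N = nat \<lceil>radius u x0 T\<rceil> + nat \<lceil>radius (\<lambda>_. 0) x0 T\<rceil>"
  have z: "locally_integrable (\<lambda>_. 0 :: real ^ 'm)" by (simp add: locally_integrable_def)
  have ui: "(\<lambda>s. norm (u s)) integrable_on {0..t}" for t using locally_integrable_norm[OF u] .
  have k0: "0 \<le> ?k"
    using G0 ui by (intro mult_nonneg_nonneg Henstock_Kurzweil_Integration.integral_nonneg) auto
  have "norm (y t - x t) \<le> 2 * ?k * exp (2 * integral {0..t} (\<lambda>s. L + l N * norm (0 :: real ^ 'm)))"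
  proof (rule integral_solution_dist_le[OF z u y x, of T])
    fix s assume s: "s \<in> {0..T}"
    show "norm (y s) \<le> real N \<and> norm (x s) \<le> real N"
      using integral_solution_bounded[OF u x s] integral_solution_bounded[OF z y s] by (simp add: N_def)
  next
    fix t assume t: "t \<in> {0..T}"
    have xc: "continuous_on {0..t} x" using x by (auto simp: integral_solution_def intro: continuous_on_subset)
    have "continuous_on {0..t} (\<lambda>s. g (x s))" using continuous_on_compose2[OF g_cont xc] by auto
    moreover have "(\<lambda>s. 0 - u s) absolutely_integrable_on {0..t}"
      using u by (intro set_integral_diff) (auto simp: locally_integrable_def)
    ultimately have "(\<lambda>s. g (x s) *v (0 - u s)) absolutely_integrable_on {0..t}"
      by (rule absolutely_integrable_matrix_vector_mult)
    then have "norm (integral {0..t} (\<lambda>s. g (x s) *v (0 - u s))) \<le> integral {0..t} (\<lambda>s. G * norm (u s))"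
      using norm_g_mult_le[of _ "0 - u _"]
      by (intro integral_norm_bound_integral integrable_on_mult_right ui) (auto simp: absolutely_integrable_on_def)
    also have "\<dots> = G * integral {0..t} (\<lambda>s. norm (u s))" by simp
    also have "\<dots> \<le> ?k"
      using t G0 by (intro mult_left_mono indefinite_integral_mono[OF ui]) auto
    finally show "norm (integral {0..t} (\<lambda>s. g (x s) *v (0 - u s))) \<le> ?k" .
  qed (use t in auto)
  also have "\<dots> \<le> 2 * ?k * exp (2 * (L * T))"
    using k0 L0 t by (intro mult_left_mono) (auto intro: mult_left_mono simp: mult.commute)
  finally show ?thesis using norm_triangle_sub[of "x t" "y t"] by (simp add: norm_minus_commute)
qed

text \<open>Over a window of length \<open>T\<close> the free flow contracts by \<open>1 / 2\<close>, while the control perturbs it by \<open>c n\<close>,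
  with \<open>c n \<rightarrow> 0\<close> since the energy of \<open>u\<close> in the \<open>n\<close>-th window is the increment of a convergent
  sequence. A recursion \<open>b (n + 1) \<le> b n / 2 + c n\<close> forces \<open>b n \<rightarrow> 0\<close>, and the same estimate bounds the
  trajectory inside the windows.\<close>

theorem integral_solution_tendsto_0:
  assumes ges: "globally_exponentially_stable f"
    and u: "locally_integrable u" and q: "(\<lambda>s. (norm (u s))\<^sup>2) integrable_on {0..}"
    and x: "integral_solution u x0 x"
  shows "(x \<longlongrightarrow> 0) at_top"
proof -
  obtain \<mu> K where \<mu>: "\<mu> > 0" and K: "K > 0" and
    free: "\<And>x0. (\<exists>y. caratheodory_solution (\<lambda>_. f) {0..} y \<and> y 0 = x0) \<and>
     (\<forall>y. caratheodory_solution (\<lambda>_. f) {0..} y \<and> y 0 = x0 \<longrightarrow>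
        (\<forall>t\<ge>0. norm (y t) \<le> K * norm x0 * exp (- \<mu> * t)))"
    using ges unfolding globally_exponentially_stable_def by auto
  \<comment> \<open>the window length for which \<open>K * exp (- \<mu> * T) = K / (2 * K + 1)\<close> is below \<open>1 / 2\<close>\<close>
  define T where "T = ln (2 * K + 1) / \<mu>"
  have T: "T > 0" using \<mu> K by (simp add: T_def)
  have "exp (\<mu> * T) = 2 * K + 1" using \<mu> K by (simp add: T_def)
  then have "K * exp (- \<mu> * T) = K / (2 * K + 1)"
    by (simp add: exp_minus divide_inverse)
  also have "\<dots> \<le> 1 / 2" using K by (simp add: field_simps)
  finally have KT: "K * exp (- \<mu> * T) \<le> 1 / 2" .
  define c where "c n = 2 * (G * integral {real n * T..real n * T + T} (\<lambda>s. norm (u s))) * exp (2 * (L * T))" for n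
  have ui: "u absolutely_integrable_on {a..b}" if "0 \<le> a" for a b
    using u that by (auto simp: locally_integrable_def intro: absolutely_integrable_on_subinterval)
  have "(\<lambda>n. integral {real n * T..real n * T + T} (\<lambda>s. norm (u s))) \<longlonglongrightarrow> 0"
  proof (rule LIMSEQ_I)
    fix e :: real assume e: "e > 0"
    \<comment> \<open>balances the two terms of the Cauchy-Schwarz estimate on a window\<close>
    define \<eta> where "\<eta> = e / T"
    have \<eta>: "\<eta> > 0" using e T by (simp add: \<eta>_def)
    obtain N where N: "\<And>n. N \<le> n \<Longrightarrow> \<bar>integral {real n * T..real n * T + T} (\<lambda>s. (norm (u s))\<^sup>2)\<bar> < \<eta> * e"
      using LIMSEQ_D[OF window_integral_tendsto_0[OF q, of T], of "\<eta> * e"] \<eta> e T by auto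
    show "\<exists>no. \<forall>n\<ge>no. norm (integral {real n * T..real n * T + T} (\<lambda>s. norm (u s)) - 0) < e"
    proof (intro exI[of _ N] allI impI)
      fix n assume n: "N \<le> n"
      let ?a = "real n * T"
      have a: "0 \<le> ?a" using T by simp
      have "(\<lambda>s. (norm (u s))\<^sup>2) integrable_on {?a..?a + T}"
        using a by (intro integrable_on_subinterval[OF q]) auto
      then have "integral {?a..?a + T} (\<lambda>s. norm (u s)) \<le> \<eta> * (?a + T - ?a) / 2 +
          integral {?a..?a + T} (\<lambda>s. (norm (u s))\<^sup>2) / (2 * \<eta>)"
        using T by (intro integral_norm_le_energy ui a \<eta>) auto
      also have "\<dots> < e / 2 + e / 2"
      proof (intro add_le_less_mono)
        show "\<eta> * (?a + T - ?a) / 2 \<le> e / 2" using T by (simp add: \<eta>_def)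
        show "integral {?a..?a + T} (\<lambda>s. (norm (u s))\<^sup>2) / (2 * \<eta>) < e / 2"
          using N[OF n] \<eta> by (simp add: field_simps)
      qed
      finally have "integral {?a..?a + T} (\<lambda>s. norm (u s)) < e" by simp
      moreover have "0 \<le> integral {?a..?a + T} (\<lambda>s. norm (u s))"
        using ui[OF a, of "?a + T"]
        by (intro Henstock_Kurzweil_Integration.integral_nonneg) (auto simp: absolutely_integrable_on_def)
      ultimately show "norm (integral {?a..?a + T} (\<lambda>s. norm (u s)) - 0) < e" by simp
    qed
  qed
  then have "c \<longlonglongrightarrow> 2 * (G * 0) * exp (2 * (L * T))"
    unfolding c_def by (intro tendsto_intros)
  then have c: "c \<longlonglongrightarrow> 0" by simp
  have window: "norm (x (real n * T + s)) \<le> K * norm (x (real n * T)) * exp (- \<mu> * s) + c n" if s: "0 \<le> s" "s \<le> T" for n s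
  proof -
    let ?a = "real n * T"
    have a: "0 \<le> ?a" using T by simp
    obtain y where y: "caratheodory_solution (\<lambda>_. f) {0..} y" "y 0 = x ?a" using free[of "x ?a"] by blast
    have yb: "norm (y s) \<le> K * norm (x ?a) * exp (- \<mu> * s)" using free[of "x ?a"] y s by blast
    have "trajectory_on f g (x ?a) (\<lambda>_. 0) {0..} y" using y by (simp add: trajectory_on_def)
    then have "integral_solution (\<lambda>_. 0) (x ?a) y" using trajectory_iff_integral_solution[of "\<lambda>_. 0"] by (simp add: locally_integrable_def)
    from integral_solution_dist_free_le[OF integral_solution_shift(1)[OF u x a] integral_solution_shift(2)[OF u x a] this s]
    have "norm (x (?a + s)) \<le> norm (y s) + 2 * (G * integral {0..T} (\<lambda>s. norm (u (?a + s)))) * exp (2 * (L * T))" .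
    also have "integral {0..T} (\<lambda>s. norm (u (?a + s))) = integral {?a..?a + T} (\<lambda>s. norm (u s))"
      using integral_shift_Icc_real[of 0 T "\<lambda>s. norm (u s)" ?a] by (simp add: o_def add_ac)
    finally show ?thesis using yb by (simp add: c_def)
  qed
  define b where "b n = norm (x (real n * T))" for n
  have b: "b \<longlonglongrightarrow> 0"
  proof (rule half_recursion_tendsto_0[OF _ _ c])
    show "0 \<le> b n" for n by (simp add: b_def)
    show "b (Suc n) \<le> b n / 2 + c n" for n
    proof -
      have "b (Suc n) \<le> K * norm (x (real n * T)) * exp (- \<mu> * T) + c n"
        using window[of T n] T by (simp add: b_def algebra_simps)
      also have "K * norm (x (real n * T)) * exp (- \<mu> * T) \<le> b n * (1 / 2)"
        using mult_left_mono[OF KT, of "b n"] by (simp add: b_def mult_ac)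
      finally show ?thesis by simp
    qed
  qed
  have d: "(\<lambda>n. K * b n + c n) \<longlonglongrightarrow> 0"
    using tendsto_add[OF tendsto_mult_left[OF b, of K] c] by simp
  show ?thesis
  proof (rule tendstoI)
    fix e :: real assume e: "e > 0"
    obtain N where N: "\<And>n. N \<le> n \<Longrightarrow> \<bar>K * b n + c n\<bar> < e" using LIMSEQ_D[OF d e] by auto
    show "\<forall>\<^sub>F t in at_top. dist (x t) 0 < e"
      using eventually_ge_at_top[of "real N * T"]
    proof eventually_elim
      case (elim t)
      define n where "n = nat \<lfloor>t / T\<rfloor>"
      have t0: "0 \<le> t" using elim T by (meson mult_nonneg_nonneg of_nat_0_le_iff order_less_imp_le order_trans)
      have rn: "real n = of_int \<lfloor>t / T\<rfloor>" using t0 T by (simp add: n_def)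
      have n: "real n \<le> t / T" "t / T < real n + 1" unfolding rn by linarith+
      have "real N \<le> t / T" using elim T by (simp add: pos_le_divide_eq)
      then have "real N < real n + 1" using n(2) by linarith
      then have Nn: "N \<le> n" by linarith
      define s where "s = t - real n * T"
      have s: "0 \<le> s" "s \<le> T" using n T by (auto simp: s_def field_simps)
      have "norm (x t) \<le> K * b n * exp (- \<mu> * s) + c n" using window[OF s, of n] by (simp add: s_def b_def)
      also have "K * b n * exp (- \<mu> * s) \<le> K * b n * 1"
        using K \<mu> s by (intro mult_left_mono) (auto simp: b_def)
      finally show ?case using N[OF Nn] by simp
    qed
  qed
qed

end

section \<open>Weak limits of square-integrable functions\<close>

definition square_integrable :: "'a measure \<Rightarrow> ('a \<Rightarrow> 'b::euclidean_space) \<Rightarrow> bool" where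
  "square_integrable M u \<longleftrightarrow> u \<in> borel_measurable M \<and> integrable M (\<lambda>t. (norm (u t))\<^sup>2)"

definition energy :: "'a measure \<Rightarrow> ('a \<Rightarrow> 'b::euclidean_space) \<Rightarrow> real" where
  "energy M u = (\<integral>t. (norm (u t))\<^sup>2 \<partial>M)"

lemma energy_nonneg: "0 \<le> energy M u"
  by (simp add: energy_def)

lemma norm_add_squared_le:
  fixes a b :: "'b::real_normed_vector"
  assumes \<eta>: "\<eta> > 0"
  shows "(norm (a + b))\<^sup>2 \<le> (1 + \<eta>) * (norm a)\<^sup>2 + (1 + 1 / \<eta>) * (norm b)\<^sup>2"
proof -
  let ?p = "norm a" and ?q = "norm b"
  have "(norm (a + b))\<^sup>2 \<le> (?p + ?q)\<^sup>2"
    by (intro power_mono norm_triangle_ineq) auto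
  moreover have "0 \<le> (\<eta> * ?p - ?q)\<^sup>2 / \<eta>" using \<eta> by simp
  moreover have "(\<eta> * ?p - ?q)\<^sup>2 / \<eta> = (1 + \<eta>) * ?p\<^sup>2 + (1 + 1 / \<eta>) * ?q\<^sup>2 - (?p + ?q)\<^sup>2"
    using \<eta> by (simp add: power2_eq_square field_simps)
  ultimately show ?thesis by linarith
qed

lemma square_integrable_scaleR:
  "square_integrable M u \<Longrightarrow> square_integrable M (\<lambda>t. c *\<^sub>R u t)"
  by (auto simp: square_integrable_def power_mult_distrib)

lemma square_integrable_add:
  assumes u: "square_integrable M u" and v: "square_integrable M v"
  shows "square_integrable M (\<lambda>t. u t + v t)"
  unfolding square_integrable_def
proof
  show m: "(\<lambda>t. u t + v t) \<in> borel_measurable M" using u v by (auto simp: square_integrable_def)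
  show "integrable M (\<lambda>t. (norm (u t + v t))\<^sup>2)"
  proof (rule Bochner_Integration.integrable_bound)
    show "integrable M (\<lambda>t. 2 * (norm (u t))\<^sup>2 + 2 * (norm (v t))\<^sup>2)"
      using u v by (auto simp: square_integrable_def)
    show "AE t in M. norm ((norm (u t + v t))\<^sup>2) \<le> norm (2 * (norm (u t))\<^sup>2 + 2 * (norm (v t))\<^sup>2)"
      using norm_add_squared_le[of 1 "u _" "v _"] by (intro AE_I2) simp
  qed (use m in measurable)
qed

lemma square_integrable_diff:
  "square_integrable M u \<Longrightarrow> square_integrable M v \<Longrightarrow> square_integrable M (\<lambda>t. u t - v t)"
  using square_integrable_add[of M u "\<lambda>t. (-1) *\<^sub>R v t"] square_integrable_scaleR[of M v "-1"] by simp

text \<open>The parallelogram law, in the form used to show that nearly minimal elements are close.\<close>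

lemma energy_midpoint:
  assumes u: "square_integrable M u" and v: "square_integrable M v"
  shows "energy M (\<lambda>t. (1/2) *\<^sub>R (u t + v t)) =
    energy M u / 2 + energy M v / 2 - energy M (\<lambda>t. u t - v t) / 4"
proof -
  have i: "integrable M (\<lambda>t. (norm (u t))\<^sup>2)" "integrable M (\<lambda>t. (norm (v t))\<^sup>2)"
    "integrable M (\<lambda>t. (norm (u t - v t))\<^sup>2)"
    using u v square_integrable_diff[OF u v] by (auto simp: square_integrable_def)
  have "energy M (\<lambda>t. (1/2) *\<^sub>R (u t + v t)) =
      (\<integral>t. (norm (u t))\<^sup>2 / 2 + (norm (v t))\<^sup>2 / 2 - (norm (u t - v t))\<^sup>2 / 4 \<partial>M)"
    unfolding energy_def
  proof (rule Bochner_Integration.integral_cong[OF refl])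
    fix t
    show "(norm ((1/2) *\<^sub>R (u t + v t)))\<^sup>2 = (norm (u t))\<^sup>2 / 2 + (norm (v t))\<^sup>2 / 2 - (norm (u t - v t))\<^sup>2 / 4"
      by (simp add: power2_norm_eq_inner inner_add inner_diff inner_commute field_simps)
  qed
  also have "\<dots> = energy M u / 2 + energy M v / 2 - energy M (\<lambda>t. u t - v t) / 4"
    using i by (simp add: energy_def)
  finally show ?thesis .
qed

lemma energy_add_le:
  assumes u: "square_integrable M u" and v: "square_integrable M v" and \<eta>: "\<eta> > 0"
  shows "energy M (\<lambda>t. u t + v t) \<le> (1 + \<eta>) * energy M u + (1 + 1 / \<eta>) * energy M v"
proof -
  have i: "integrable M (\<lambda>t. (norm (u t))\<^sup>2)" "integrable M (\<lambda>t. (norm (v t))\<^sup>2)"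
    "integrable M (\<lambda>t. (norm (u t + v t))\<^sup>2)"
    using u v square_integrable_add[OF u v] by (auto simp: square_integrable_def)
  have "energy M (\<lambda>t. u t + v t) \<le> (\<integral>t. (1 + \<eta>) * (norm (u t))\<^sup>2 + (1 + 1 / \<eta>) * (norm (v t))\<^sup>2 \<partial>M)"
    unfolding energy_def using i by (intro integral_mono norm_add_squared_le \<eta>) auto
  also have "\<dots> = (1 + \<eta>) * energy M u + (1 + 1 / \<eta>) * energy M v"
    using i by (simp add: energy_def)
  finally show ?thesis .
qed

lemma square_integrable_set_integral:
  assumes u: "square_integrable M u" and B: "B \<in> sets M" "emeasure M B < \<infinity>" and \<eta>: "\<eta> > 0"
  shows "set_integrable M B u"
    and "norm (LINT t:B|M. u t) \<le> \<eta> * measure M B / 2 + energy M u / (2 * \<eta>)"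
proof -
  let ?b = "\<lambda>t. \<eta> / 2 * indicator B t + (norm (u t))\<^sup>2 / (2 * \<eta>)"
  have um: "u \<in> borel_measurable M" and ui: "integrable M (\<lambda>t. (norm (u t))\<^sup>2)"
    using u by (auto simp: square_integrable_def)
  have le: "norm (indicator B t *\<^sub>R u t) \<le> ?b t" for t
  proof (cases "t \<in> B")
    case True
    have "0 \<le> (norm (u t) - \<eta>)\<^sup>2 / (2 * \<eta>)" using \<eta> by simp
    also have "\<dots> = \<eta> / 2 + (norm (u t))\<^sup>2 / (2 * \<eta>) - norm (u t)"
      using \<eta> by (simp add: power2_eq_square field_simps)
    finally show ?thesis using True by simp
  qed (use \<eta> in simp)
  have bi: "integrable M ?b"
    using B ui by (intro Bochner_Integration.integrable_add integrable_mult_right integrable_real_indicator) auto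
  show si: "set_integrable M B u"
    unfolding set_integrable_def
  proof (rule Bochner_Integration.integrable_bound[OF bi])
    show "(\<lambda>t. indicator B t *\<^sub>R u t) \<in> borel_measurable M" using um B by measurable
    show "AE t in M. norm (indicator B t *\<^sub>R u t) \<le> norm (?b t)"
      using le by (intro AE_I2 order_trans[OF le]) simp
  qed
  have "norm (LINT t:B|M. u t) \<le> (\<integral>t. ?b t \<partial>M)"
    unfolding set_lebesgue_integral_def using si bi le
    by (intro order_trans[OF integral_norm_bound] integral_mono integrable_norm) (auto simp: set_integrable_def)
  also have "\<dots> = \<eta> * measure M B / 2 + energy M u / (2 * \<eta>)"
    using B ui by (subst Bochner_Integration.integral_add)
      (auto simp: energy_def intro!: integrable_mult_right integrable_real_indicator)
  finally show "norm (LINT t:B|M. u t) \<le> \<eta> * measure M B / 2 + energy M u / (2 * \<eta>)" .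
qed

text \<open>The increments are even summable: by the inequality of arithmetic and geometric means the
  norm of an increment \<open>d\<close> is at most \<open>(2\<^sup>-\<^sup>i + 2\<^sup>i \<bar>d\<bar>\<^sup>2) / 2\<close>, and the sum over \<open>i\<close> of
  \<open>2\<^sup>i \<bar>d\<bar>\<^sup>2\<close> has finite integral.\<close>

lemma AE_convergent_of_energy_increments:
  fixes y :: "nat \<Rightarrow> 'a \<Rightarrow> 'b::euclidean_space"
  assumes y: "\<And>i. square_integrable M (y i)"
    and inc: "\<And>i. energy M (\<lambda>t. y (Suc i) t - y i t) \<le> (1/4) ^ i"
  shows "AE t in M. convergent (\<lambda>i. y i t)"
proof -
  define q where "q i t = 2 ^ i * (norm (y (Suc i) t - y i t))\<^sup>2" for i t
  have dy: "square_integrable M (\<lambda>t. y (Suc i) t - y i t)" for i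
    by (intro square_integrable_diff y)
  have qi: "integrable M (q i)" for i 
    unfolding q_def using dy[of i] by (intro integrable_mult_right) (simp add: square_integrable_def)
  have qm: "q i \<in> borel_measurable M" for i using qi by (rule borel_measurable_integrable)
  have "(\<integral>\<^sup>+t. (\<Sum>i. ennreal (q i t)) \<partial>M) = (\<Sum>i. \<integral>\<^sup>+t. ennreal (q i t) \<partial>M)"
    using qm by (intro nn_integral_suminf) auto
  also have "\<dots> \<le> (\<Sum>i. ennreal ((1/2) ^ i))"
  proof (rule suminf_le)
    fix i
    have "(\<integral>\<^sup>+t. ennreal (q i t) \<partial>M) = ennreal (\<integral>t. q i t \<partial>M)"
      by (intro nn_integral_eq_integral qi) (auto simp: q_def)
    also have "(\<integral>t. q i t \<partial>M) = 2 ^ i * energy M (\<lambda>t. y (Suc i) t - y i t)"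
      by (simp add: q_def energy_def)
    also have "ennreal \<dots> \<le> ennreal (2 ^ i * (1/4) ^ i)"
      by (intro ennreal_leI mult_left_mono inc) auto
    also have "(2::real) ^ i * (1/4) ^ i = (1/2) ^ i" by (simp flip: power_mult_distrib)
    finally show "(\<integral>\<^sup>+t. ennreal (q i t) \<partial>M) \<le> ennreal ((1/2) ^ i)" .
  qed auto
  also have "\<dots> = ennreal (\<Sum>i. (1/2) ^ i)"
    by (intro suminf_ennreal2 summable_geometric) auto
  also have "\<dots> < \<infinity>" by simp
  finally have "(\<integral>\<^sup>+t. (\<Sum>i. ennreal (q i t)) \<partial>M) \<noteq> \<infinity>" by simp
  then have "AE t in M. (\<Sum>i. ennreal (q i t)) \<noteq> \<infinity>"
    using qm by (intro nn_integral_noteq_infinite) auto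
  then show ?thesis
  proof eventually_elim
    case (elim t)
    have "summable (\<lambda>i. q i t)"
      by (rule summable_suminf_not_top) (use elim in \<open>auto simp: q_def\<close>)
    then have s: "summable (\<lambda>i. ((1/2) ^ i + q i t) / 2)"
      by (intro summable_divide summable_add summable_geometric) auto
    have "summable (\<lambda>i. y (Suc i) t - y i t)"
    proof (rule summable_comparison_test'[OF s])
      fix i
      let ?d = "norm (y (Suc i) t - y i t)"
      have "0 \<le> (2 ^ i * ?d - 1)\<^sup>2 / (2 * 2 ^ i)" by simp
      also have "\<dots> = ((1/2) ^ i + q i t) / 2 - ?d"
        by (simp add: q_def power2_eq_square field_simps power_divide)
      finally show "?d \<le> ((1/2) ^ i + q i t) / 2" by simp
    qed
    then have "convergent (\<lambda>n. \<Sum>i<n. y (Suc i) t - y i t)"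
      by (simp add: summable_iff_convergent)
    then have "convergent (\<lambda>n. y n t - y 0 t)" 
      using sum_lessThan_telescope[of "\<lambda>i. y i t"] by simp
    then have "convergent (\<lambda>n. (y n t - y 0 t) + y 0 t)" by (intro convergent_add convergent_const)
    then show "convergent (\<lambda>i. y i t)" by simp
  qed
qed

text \<open>A subsequence with fast decreasing increments converges almost everywhere, and Fatou's lemma shows
  that its pointwise limit is also the limit in energy of the whole sequence.\<close>

theorem square_integrable_complete:
  fixes z :: "nat \<Rightarrow> 'a \<Rightarrow> 'b::euclidean_space"
  assumes z: "\<And>k. square_integrable M (z k)"
    and cauchy: "\<And>e. e > 0 \<Longrightarrow> \<exists>K. \<forall>k\<ge>K. \<forall>l\<ge>K. energy M (\<lambda>t. z k t - z l t) \<le> e"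
  obtains v where "square_integrable M v" "(\<lambda>k. energy M (\<lambda>t. v t - z k t)) \<longlonglongrightarrow> 0"
proof -
  have "\<forall>i. \<exists>K. \<forall>k\<ge>K. \<forall>l\<ge>K. energy M (\<lambda>t. z k t - z l t) \<le> (1/4) ^ i"
    using cauchy by simp
  then obtain N where N: "\<And>i k l. N i \<le> k \<Longrightarrow> N i \<le> l \<Longrightarrow> energy M (\<lambda>t. z k t - z l t) \<le> (1/4) ^ i"
    by metis
  \<comment> \<open>an increasing index sequence that dominates \<open>N\<close>\<close>
  define s where "s i = i + (\<Sum>j\<le>i. N j)" for i
  have s: "N i \<le> s i" "s i \<le> s (Suc i)" "i \<le> s i" for i
    using member_le_sum[of i "{..i}" N] by (auto simp: s_def)
  define y where "y i = z (s i)" for i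
  have zm: "z k \<in> borel_measurable M" for k using z by (auto simp: square_integrable_def)
  have ym: "y i \<in> borel_measurable M" for i using z by (auto simp: y_def square_integrable_def)
  have "AE t in M. convergent (\<lambda>i. y i t)"
    
    unfolding y_def by (rule AE_convergent_of_energy_increments[OF z]) (intro N order_trans[OF s(1) s(2)] s(1))
  define v where "v t = lim (\<lambda>i. y i t)" for t
  have vm: "v \<in> borel_measurable M" unfolding v_def[abs_def] by (rule borel_measurable_lim_metric[OF ym])
  have lim: "AE t in M. (\<lambda>i. y i t) \<longlonglongrightarrow> v t"
    using \<open>AE t in M. convergent _\<close> by eventually_elim (simp add: v_def convergent_LIMSEQ_iff)
  have fatou: "(\<integral>\<^sup>+t. ennreal ((norm (v t - z k t))\<^sup>2) \<partial>M) \<le> ennreal e"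
    if e: "\<forall>k\<ge>K. \<forall>l\<ge>K. energy M (\<lambda>t. z k t - z l t) \<le> e" and k: "K \<le> k" for e K k
  proof -
    have "AE t in M. ennreal ((norm (v t - z k t))\<^sup>2) \<le> liminf (\<lambda>i. ennreal ((norm (y i t - z k t))\<^sup>2))"
      using lim
    proof eventually_elim
      case (elim t)
      have "(\<lambda>i. ennreal ((norm (y i t - z k t))\<^sup>2)) \<longlonglongrightarrow> ennreal ((norm (v t - z k t))\<^sup>2)"
        by (intro tendsto_intros elim)
      then show ?case using lim_imp_Liminf[OF sequentially_bot] by (metis order_refl)
    qed
    then have "(\<integral>\<^sup>+t. ennreal ((norm (v t - z k t))\<^sup>2) \<partial>M) \<le>
        (\<integral>\<^sup>+t. liminf (\<lambda>i. ennreal ((norm (y i t - z k t))\<^sup>2)) \<partial>M)"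
      by (rule nn_integral_mono_AE)
    also have "\<dots> \<le> liminf (\<lambda>i. \<integral>\<^sup>+t. ennreal ((norm (y i t - z k t))\<^sup>2) \<partial>M)"
      using ym zm by (intro nn_integral_liminf) measurable
    also have "\<dots> \<le> ennreal e"
    proof (rule Liminf_le)
      show "\<forall>\<^sub>F i in sequentially. (\<integral>\<^sup>+t. ennreal ((norm (y i t - z k t))\<^sup>2) \<partial>M) \<le> ennreal e"
        using eventually_ge_at_top[of K]
      proof eventually_elim
        case (elim i)
        have "square_integrable M (\<lambda>t. y i t - z k t)" unfolding y_def by (intro square_integrable_diff z)
        then have "(\<integral>\<^sup>+t. ennreal ((norm (y i t - z k t))\<^sup>2) \<partial>M) = ennreal (energy M (\<lambda>t. y i t - z k t))"
          unfolding energy_def by (intro nn_integral_eq_integral) (auto simp: square_integrable_def)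
        also have "energy M (\<lambda>t. y i t - z k t) \<le> e"
          unfolding y_def using e k elim s(3)[of i] by simp
        finally show ?case by (simp add: ennreal_leI)
      qed
    qed simp
    finally show ?thesis .
  qed
  have e0: "0 \<le> e" if "\<forall>k\<ge>K. \<forall>l\<ge>K. energy M (\<lambda>t. z k t - z l t) \<le> e" for e K
    using that energy_nonneg order_trans by blast
  have diff: "square_integrable M (\<lambda>t. v t - z k t)" "energy M (\<lambda>t. v t - z k t) \<le> e"
    if e: "\<forall>k\<ge>K. \<forall>l\<ge>K. energy M (\<lambda>t. z k t - z l t) \<le> e" and k: "K \<le> k" for e K k
  proof -
    have m: "(\<lambda>t. v t - z k t) \<in> borel_measurable M" by (intro borel_measurable_diff vm zm)
    have i: "integrable M (\<lambda>t. (norm (v t - z k t))\<^sup>2)"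
    proof (rule integrableI_bounded)
      have "(\<integral>\<^sup>+t. ennreal (norm ((norm (v t - z k t))\<^sup>2)) \<partial>M) \<le> ennreal e"
        using fatou[OF e k] by simp
      then show "(\<integral>\<^sup>+t. ennreal (norm ((norm (v t - z k t))\<^sup>2)) \<partial>M) < \<infinity>"
        using le_less_trans by fastforce
    qed (use m in measurable)
    then show "square_integrable M (\<lambda>t. v t - z k t)" using m by (simp add: square_integrable_def)
    have "ennreal (energy M (\<lambda>t. v t - z k t)) \<le> ennreal e"
      using fatou[OF e k] nn_integral_eq_integral[OF i] by (simp add: energy_def)
    then show "energy M (\<lambda>t. v t - z k t) \<le> e" using e0[OF e] by (simp add: ennreal_le_iff)
  qed
  obtain K where K: "\<forall>k\<ge>K. \<forall>l\<ge>K. energy M (\<lambda>t. z k t - z l t) \<le> 1" using cauchy[of 1] by auto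
  show thesis
  proof
    show "square_integrable M v"
      using square_integrable_add[OF diff(1)[OF K order_refl] z[of K]] by simp
    show "(\<lambda>k. energy M (\<lambda>t. v t - z k t)) \<longlonglongrightarrow> 0"
    proof (rule LIMSEQ_I)
      fix e :: real assume "e > 0"
      then obtain K where K: "\<forall>k\<ge>K. \<forall>l\<ge>K. energy M (\<lambda>t. z k t - z l t) \<le> e / 2" using cauchy[of "e/2"] by auto
      have "norm (energy M (\<lambda>t. v t - z k t) - 0) < e" if "K \<le> k" for k
        using diff(2)[OF K that] energy_nonneg[of M "\<lambda>t. v t - z k t"] \<open>e > 0\<close> by simp
      then show "\<exists>K. \<forall>k\<ge>K. norm (energy M (\<lambda>t. v t - z k t) - 0) < e" by blast
    qed
  qed
qed

text \<open>Closing under midpoints is enough for the parallelogram argument, and it allows induction in place of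
  manipulating the coefficients of convex combinations.\<close>

inductive_set midpoint_hull :: "('a \<Rightarrow> 'b::real_vector) set \<Rightarrow> ('a \<Rightarrow> 'b) set" for S where
  base: "w \<in> S \<Longrightarrow> w \<in> midpoint_hull S"
| mid: "w \<in> midpoint_hull S \<Longrightarrow> z \<in> midpoint_hull S \<Longrightarrow> (\<lambda>t. (1/2) *\<^sub>R (w t + z t)) \<in> midpoint_hull S"

lemma midpoint_hull_mono: "S \<subseteq> T \<Longrightarrow> midpoint_hull S \<subseteq> midpoint_hull T"
proof
  fix w assume "S \<subseteq> T" "w \<in> midpoint_hull S"
  from this(2,1) show "w \<in> midpoint_hull T"
    by induction (auto intro: midpoint_hull.intros)
qed

lemma square_integrable_midpoint_hull:
  assumes "w \<in> midpoint_hull S" "\<And>u. u \<in> S \<Longrightarrow> square_integrable M u"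
  shows "square_integrable M w"
  using assms by induction (auto intro: square_integrable_scaleR square_integrable_add)

lemma set_integral_midpoint_hull:
  assumes "w \<in> midpoint_hull S" and S: "\<And>u. u \<in> S \<Longrightarrow> square_integrable M u"
    and B: "B \<in> sets M" "emeasure M B < \<infinity>"
    and e: "\<And>u. u \<in> S \<Longrightarrow> norm ((LINT t:B|M. u t) - c) \<le> e"
  shows "norm ((LINT t:B|M. w t) - c) \<le> e"
  using assms(1)
proof induction
  case (mid w z)
  have "square_integrable M w" "square_integrable M z"
    using mid.hyps S by (auto intro: square_integrable_midpoint_hull)
  then have i: "set_integrable M B w" "set_integrable M B z"
    using square_integrable_set_integral(1)[OF _ B zero_less_one] by auto
  have "(LINT t:B|M. (1/2) *\<^sub>R (w t + z t)) = (1/2) *\<^sub>R ((LINT t:B|M. w t) + (LINT t:B|M. z t))"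
    using i by (simp add: scaleR_add_right)
  then have "(LINT t:B|M. (1/2) *\<^sub>R (w t + z t)) - c = (1/2) *\<^sub>R (((LINT t:B|M. w t) - c) + ((LINT t:B|M. z t) - c))"
    by (simp add: algebra_simps flip: scaleR_add_left)
  also have "norm \<dots> \<le> (1/2) * (e + e)"
    unfolding norm_scaleR by (intro mult_mono norm_triangle_mono mid.IH) auto
  finally show ?case by simp
qed (rule e)

lemma diagonal_convergent_subsequence:
  fixes U :: "nat \<Rightarrow> nat \<Rightarrow> 'b::heine_borel"
  assumes U: "\<And>n. bounded (range (U n))"
  obtains r where "strict_mono r" "\<And>n. convergent (\<lambda>k. U n (r k))"
proof -
  interpret subseqs "\<lambda>n s. convergent (\<lambda>k. U n (s k))"
  proof
    fix n and s :: "nat \<Rightarrow> nat"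
    have "bounded (range (\<lambda>k. U n (s k)))" using U[of n] by (rule bounded_subset) auto
    then show "\<exists>r. strict_mono r \<and> convergent (\<lambda>k. U n ((s \<circ> r) k))"
      using bounded_imp_convergent_subsequence[of "\<lambda>k. U n (s k)"] by (auto simp: o_def convergent_def)
  qed
  have "convergent (\<lambda>k. U n (diagseq k))" for n
  proof -
    have "convergent (\<lambda>k. U n ((diagseq \<circ> (+) (Suc n)) k))"
      by (rule diagseq_holds) (use convergent_subseq_convergent in \<open>fastforce simp: o_def\<close>)
    then show ?thesis
      using convergent_ignore_initial_segment[of "\<lambda>k. U n (diagseq k)" "Suc n"] by (simp add: add.commute)
  qed
  with subseq_diagseq show thesis by (rule that)
qed

text \<open>A substitute for weak sequential compactness of bounded sets in \<open>L\<^sup>2\<close>, with integrals over countably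
  many prescribed sets \<open>B n\<close> as test functionals. The limit is
  found as a strong limit of elements \<open>z k\<close> of the midpoint hulls \<open>Q k\<close> of the tails, chosen
  with nearly minimal energy. The minimal energies \<open>d k\<close> increase with \<open>k\<close> and are bounded by
  \<open>N\<close>, which yields both the Cauchy property and the bound on the energy of the limit.\<close>

theorem bounded_energy_weak_limit:
  fixes u :: "nat \<Rightarrow> 'a \<Rightarrow> 'b::euclidean_space"
  assumes u: "\<And>k. square_integrable M (u k)" and N: "(\<lambda>k. energy M (u k)) \<longlonglongrightarrow> N"
    and B: "\<And>n::nat. B n \<in> sets M" "\<And>n. emeasure M (B n) < \<infinity>"
  obtains r v where "strict_mono r" "square_integrable M v" "energy M v \<le> N"
    "\<And>n. (\<lambda>k. LINT t:B n|M. u (r k) t) \<longlonglongrightarrow> (LINT t:B n|M. v t)"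
proof -
  obtain C where "\<forall>k. norm (energy M (u k)) \<le> C"
    using convergent_imp_Bseq[OF convergentI[OF N]] by (auto simp: Bseq_def)
  then have C: "energy M (u k) \<le> C" for k by (metis abs_ge_self order_trans real_norm_def)
  have "bounded (range (\<lambda>k. LINT t:B n|M. u k t))" for n
    unfolding bounded_iff
  proof (intro exI ballI)
    fix I assume "I \<in> range (\<lambda>k. LINT t:B n|M. u k t)"
    then obtain k where "I = (LINT t:B n|M. u k t)" by auto
    then show "norm I \<le> measure M (B n) / 2 + C / 2"
      using square_integrable_set_integral(2)[OF u[of k] B[of n] zero_less_one] C[of k] by simp
  qed
  then obtain r where r: "strict_mono r" and "\<And>n. convergent (\<lambda>k. LINT t:B n|M. u (r k) t)"
    using diagonal_convergent_subsequence[of "\<lambda>n k. LINT t:B n|M. u k t"] by blast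
  then obtain U where U: "\<And>n. (\<lambda>k. LINT t:B n|M. u (r k) t) \<longlonglongrightarrow> U n"
    unfolding convergent_def by metis
  define Q where "Q k = midpoint_hull ((\<lambda>j. u (r j)) ` {k..})" for k
  have Qsq: "square_integrable M w" if "w \<in> Q k" for w k
    using that u unfolding Q_def by (auto intro: square_integrable_midpoint_hull)
  have Qu: "u (r j) \<in> Q k" if "k \<le> j" for j k
    using that by (auto simp: Q_def intro: midpoint_hull.base)
  have Qmono: "Q l \<subseteq> Q k" if "k \<le> l" for k l
    unfolding Q_def using that by (intro midpoint_hull_mono) auto
  define d where "d k = Inf (energy M ` Q k)" for k
  have bdd: "bdd_below (energy M ` Q k)" for k
    by (rule bdd_belowI[of _ 0]) (auto simp: energy_nonneg)
  have ne: "Q k \<noteq> {}" for k using Qu[of k k] by auto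
  have d_le: "d k \<le> energy M w" if "w \<in> Q k" for w k
    unfolding d_def using that bdd by (intro cInf_lower) auto
  have d_mono: "d k \<le> d l" if "k \<le> l" for k l
    unfolding d_def using Qmono[OF that] bdd ne by (intro cInf_superset_mono) auto
  have Nr: "(\<lambda>k. energy M (u (r k))) \<longlonglongrightarrow> N"
    using LIMSEQ_subseq_LIMSEQ[OF N r] by (simp add: o_def)
  have dN: "d k \<le> N" for k
    by (rule LIMSEQ_le_const[OF Nr]) (use d_le Qu in blast)
  have "incseq d" using d_mono by (auto simp: incseq_def)
  then obtain D where D: "d \<longlonglongrightarrow> D"
    using incseq_convergent[of d N] dN by blast
  have "\<exists>z\<in>Q k. energy M z < d k + 1 / Suc k" for k
    using cInf_lessD[of "energy M ` Q k" "d k + 1 / Suc k"] ne[of k] by (auto simp: d_def)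
  then obtain z where zQ: "\<And>k. z k \<in> Q k" and z: "\<And>k. energy M (z k) < d k + 1 / Suc k" by metis
  have zsq: "square_integrable M (z k)" for k using zQ Qsq by blast
  have close: "energy M (\<lambda>t. z k t - z l t) \<le> 2 * (d l - d K) + 4 / Suc K" if "K \<le> k" "k \<le> l" for K k l
  proof -
    have "(\<lambda>t. (1/2) *\<^sub>R (z k t + z l t)) \<in> Q k"
      using zQ[of k] zQ[of l] Qmono[OF that(2)] unfolding Q_def by (intro midpoint_hull.mid) auto
    then have "d k \<le> energy M (z k) / 2 + energy M (z l) / 2 - energy M (\<lambda>t. z k t - z l t) / 4"
      using d_le energy_midpoint[OF zsq zsq, of k l] by fastforce
    moreover have "1 / Suc k \<le> 1 / Suc K" "1 / Suc l \<le> 1 / Suc K" using that by (auto simp: field_simps)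
    moreover have "4 / Suc K = 4 * (1 / Suc K)" by simp
    ultimately show ?thesis using z[of k] z[of l] d_mono[OF that(1)] by argo
  qed
  obtain v where v: "square_integrable M v" "(\<lambda>k. energy M (\<lambda>t. v t - z k t)) \<longlonglongrightarrow> 0"
  proof (rule square_integrable_complete[OF zsq])
    fix e :: real assume e: "e > 0"
    have "(\<lambda>K. 2 * (D - d K) + 4 * (1 / Suc K)) \<longlonglongrightarrow> 2 * (D - D) + 4 * 0"
      by (intro tendsto_intros D LIMSEQ_Suc[OF lim_1_over_n])
    then obtain K where K: "2 * (D - d K) + 4 * (1 / Suc K) < e"
      using order_tendstoD(2)[of _ 0 sequentially e] e by (auto simp: eventually_sequentially)
    have dD: "d l \<le> D" for l using incseq_le[OF _ D] d_mono by (auto simp: incseq_def)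
    have ord: "energy M (\<lambda>t. z k t - z l t) \<le> e" if "K \<le> k" "k \<le> l" for k l
      using close[OF that] K dD[of l] by simp
    have "energy M (\<lambda>t. z k t - z l t) = energy M (\<lambda>t. z l t - z k t)" for k l
      by (simp add: energy_def norm_minus_commute)
    then show "\<exists>K. \<forall>k\<ge>K. \<forall>l\<ge>K. energy M (\<lambda>t. z k t - z l t) \<le> e"
      using ord by (metis nle_le)
  qed
  have vz: "square_integrable M (\<lambda>t. v t - z k t)" for k by (intro square_integrable_diff v zsq)
  \<comment> \<open>lower semicontinuity of the energy, from \<open>v = z k + (v - z k)\<close>\<close>
  have vN: "energy M v \<le> (1 + \<eta>) * N" if \<eta>: "\<eta> > 0" for \<eta>
  proof (rule LIMSEQ_le_const)
    have "(\<lambda>k. (1 + \<eta>) * (N + 1 / Suc k) + (1 + 1 / \<eta>) * energy M (\<lambda>t. v t - z k t))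
        \<longlonglongrightarrow> (1 + \<eta>) * (N + 0) + (1 + 1 / \<eta>) * 0"
      by (intro tendsto_intros v LIMSEQ_Suc[OF lim_1_over_n])
    then show "(\<lambda>k. (1 + \<eta>) * (N + 1 / Suc k) + (1 + 1 / \<eta>) * energy M (\<lambda>t. v t - z k t))
        \<longlonglongrightarrow> (1 + \<eta>) * N" by simp
    have "energy M v \<le> (1 + \<eta>) * (N + 1 / Suc k) + (1 + 1 / \<eta>) * energy M (\<lambda>t. v t - z k t)" for k
    proof -
      have "energy M v \<le> (1 + \<eta>) * energy M (z k) + (1 + 1 / \<eta>) * energy M (\<lambda>t. v t - z k t)"
        using energy_add_le[OF zsq[of k] vz[of k] \<eta>] by simp
      also have "(1 + \<eta>) * energy M (z k) \<le> (1 + \<eta>) * (N + 1 / Suc k)"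
        using z[of k] dN[of k] \<eta> by (intro mult_left_mono) auto
      finally show ?thesis by simp
    qed
    then show "\<exists>K. \<forall>k\<ge>K. energy M v \<le> (1 + \<eta>) * (N + 1 / Suc k) + (1 + 1 / \<eta>) * energy M (\<lambda>t. v t - z k t)"
      by blast
  qed
  have "energy M v \<le> N"
  proof (rule tendsto_lowerbound[of "\<lambda>k. (1 + 1 / Suc k) * N" _ sequentially])
    have "(\<lambda>k. (1 + 1 / Suc k) * N) \<longlonglongrightarrow> (1 + 0) * N"
      by (intro tendsto_intros LIMSEQ_Suc[OF lim_1_over_n])
    then show "(\<lambda>k. (1 + 1 / Suc k) * N) \<longlonglongrightarrow> N" by simp
    show "\<forall>\<^sub>F k in sequentially. energy M v \<le> (1 + 1 / Suc k) * N"
      by (intro always_eventually allI vN) simp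
  qed simp
  moreover have "U n = (LINT t:B n|M. v t)" for n
  proof (rule ccontr)
    assume "U n \<noteq> (LINT t:B n|M. v t)"
    define e where "e = norm (U n - (LINT t:B n|M. v t))"
    have e: "e > 0" using \<open>U n \<noteq> _\<close> by (simp add: e_def)
    \<comment> \<open>makes \<open>\<eta> * measure M (B n)\<close> at most \<open>e / 4\<close>, also if \<open>B n\<close> is a null set\<close>
    define \<eta> where "\<eta> = e / 4 / (measure M (B n) + 1)"
    have \<eta>: "\<eta> > 0" using e by (simp add: \<eta>_def add_nonneg_pos)
    obtain K1 where K1: "\<And>k. K1 \<le> k \<Longrightarrow> norm ((LINT t:B n|M. u (r k) t) - U n) < e / 4"
      using LIMSEQ_D[OF U[of n], of "e/4"] e by auto
    obtain K2 where K2: "\<And>k. K2 \<le> k \<Longrightarrow> energy M (\<lambda>t. v t - z k t) < \<eta> * e / 4"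
      using order_tendstoD(2)[OF v(2), of "\<eta> * e / 4"] e \<eta> by (auto simp: eventually_sequentially)
    define k where "k = max K1 K2"
    have "norm ((LINT t:B n|M. z k t) - U n) \<le> e / 4"
      using zQ[of k] unfolding Q_def
      by (rule set_integral_midpoint_hull[OF _ _ B]) (use u K1 in \<open>force simp: k_def\<close>)+
    moreover have "norm (LINT t:B n|M. v t - z k t) \<le> e / 4"
    proof -
      have "norm (LINT t:B n|M. v t - z k t) \<le> \<eta> * measure M (B n) / 2 + energy M (\<lambda>t. v t - z k t) / (2 * \<eta>)"
        by (rule square_integrable_set_integral(2)[OF vz B \<eta>])
      moreover have "\<eta> * measure M (B n) \<le> \<eta> * (measure M (B n) + 1)"
        using \<eta> by simp
      moreover have "\<eta> * (measure M (B n) + 1) = e / 4"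
      proof -
        have "measure M (B n) + 1 \<noteq> 0" using measure_nonneg[of M "B n"] by linarith
        then show ?thesis unfolding \<eta>_def by (rule nonzero_eq_divide_eq[THEN iffD1, OF _ refl])
      qed
      moreover have "energy M (\<lambda>t. v t - z k t) / (2 * \<eta>) \<le> e / 8"
        using K2[of k] \<eta> by (simp add: k_def field_simps)
      ultimately show ?thesis by simp
    qed
    moreover have "(LINT t:B n|M. v t - z k t) = (LINT t:B n|M. v t) - (LINT t:B n|M. z k t)"
      using square_integrable_set_integral(1)[OF v(1) B zero_less_one]
        square_integrable_set_integral(1)[OF zsq B zero_less_one] by (intro set_integral_diff)
    ultimately have "norm ((LINT t:B n|M. v t) - (LINT t:B n|M. z k t) + ((LINT t:B n|M. z k t) - U n)) \<le> e / 4 + e / 4"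
      by (intro norm_triangle_mono) auto
    then show False using e by (simp add: e_def norm_minus_commute)
  qed
  ultimately show thesis using that[OF r v(1)] U by auto
qed

section \<open>Square-integrable controls on the half-line\<close>

abbreviation "halfline \<equiv> lebesgue_on {0::real<..}"

lemma L2_controls_eq: "u \<in> L2_controls \<longleftrightarrow> square_integrable halfline u"
  by (simp add: L2_controls_def square_integrable_def)

text \<open>Controls live on \<open>{0<..}\<close> and trajectories on \<open>{0..}\<close>; the point \<open>0\<close> is negligible.\<close>

lemma set_integrable_halfline_imp:
  fixes u :: "real \<Rightarrow> 'b::euclidean_space"
  assumes u: "set_integrable halfline {0<..T} u"
  shows "u absolutely_integrable_on {0..T}" and "(LINT t:{0<..T}|halfline. u t) = integral {0..T} u"
proof -
  have eq: "indicator {0<..} t *\<^sub>R (indicator {0<..T} t *\<^sub>R u t) = indicator {0<..T} t *\<^sub>R u t" for t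
    by (simp add: indicator_def)
  have ab: "u absolutely_integrable_on {0<..T}"
    using u unfolding set_integrable_def by (subst (asm) integrable_restrict_space) (simp_all only: eq sets_completionI_sets, auto)
  have "negligible {x \<in> {0<..T} - {0..T}. u x \<noteq> 0}" "negligible {x \<in> {0..T} - {0<..T}. u x \<noteq> 0}"
    by (auto intro: negligible_subset[OF negligible_sing[of 0]])
  note neg = this
  show "u absolutely_integrable_on {0..T}"
    using ab absolutely_integrable_spike_set_eq[OF neg] by simp
  have "(LINT t:{0<..T}|halfline. u t) = (LINT t:{0<..T}|lebesgue. u t)"
    unfolding set_lebesgue_integral_def by (subst integral_restrict_space) (simp_all only: eq, auto)
  also have "\<dots> = integral {0<..T} u" by (rule set_lebesgue_integral_eq_integral(2)[OF ab])
  also have "\<dots> = integral {0..T} u" by (rule integral_spike_set[OF neg])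
  finally show "(LINT t:{0<..T}|halfline. u t) = integral {0..T} u" .
qed

lemma emeasure_halfline_finite: "{0<..T} \<in> sets halfline" "emeasure halfline {0<..T} < \<infinity>"
proof -
  show s: "{0<..T} \<in> sets halfline" by (auto simp: sets_restrict_space_iff)
  have "emeasure halfline {0<..T} = emeasure lebesgue {0<..T}"
    by (rule emeasure_restrict_space) auto
  then show "emeasure halfline {0<..T} < \<infinity>" by (cases "0 \<le> T") auto
qed

lemma square_integrable_halfline:
  fixes u :: "real \<Rightarrow> 'b::euclidean_space"
  assumes u: "square_integrable halfline u"
  shows "locally_integrable u" and "(\<lambda>s. (norm (u s))\<^sup>2) integrable_on {0..}"
    and "(LINT t:{0<..T}|halfline. u t) = integral {0..T} u"
    and "integral {0..} (\<lambda>s. (norm (u s))\<^sup>2) = energy halfline u"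
proof -
  have si: "set_integrable halfline {0<..T} u" for T
    by (rule square_integrable_set_integral(1)[OF u emeasure_halfline_finite zero_less_one])
  show "locally_integrable u" using set_integrable_halfline_imp(1)[OF si] by (simp add: locally_integrable_def)
  show "(LINT t:{0<..T}|halfline. u t) = integral {0..T} u" by (rule set_integrable_halfline_imp(2)[OF si])
  let ?q = "\<lambda>s. (norm (u s))\<^sup>2"
  have "integrable halfline ?q" using u by (simp add: square_integrable_def)
  then have ab: "?q absolutely_integrable_on {0<..}"
    unfolding set_integrable_def by (subst (asm) integrable_restrict_space) auto
  have neg: "negligible {x \<in> {0<..} - {0..}. ?q x \<noteq> 0}" "negligible {x \<in> {0..} - {0<..}. ?q x \<noteq> 0}"
    by (auto intro: negligible_subset[OF negligible_sing[of 0]])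
  show "?q integrable_on {0..}"
    using ab by (intro integrable_spike_set[OF _ neg]) (simp add: absolutely_integrable_on_def)
  have "integral {0..} ?q = integral {0<..} ?q" by (rule integral_spike_set[OF neg, symmetric])
  also have "\<dots> = (LINT t:{0<..}|lebesgue. ?q t)"
    by (rule set_lebesgue_integral_eq_integral(2)[OF ab, symmetric])
  also have "\<dots> = energy halfline u"
    unfolding set_lebesgue_integral_def energy_def by (subst integral_restrict_space) auto
  finally show "integral {0..} ?q = energy halfline u" .
qed

lemma locally_integrable_subinterval:
  "locally_integrable u \<Longrightarrow> 0 \<le> c \<Longrightarrow> u absolutely_integrable_on {c..d}"
  by (auto simp: locally_integrable_def intro: absolutely_integrable_on_subinterval)

definition bounded_energy :: "real \<Rightarrow> (nat \<Rightarrow> real \<Rightarrow> 'b::euclidean_space) \<Rightarrow> bool" where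
  "bounded_energy C w \<longleftrightarrow> (\<forall>k. square_integrable halfline (w k) \<and> energy halfline (w k) \<le> C)"

lemma bounded_energyD:
  assumes w: "bounded_energy C w"
  shows "0 \<le> C" and "locally_integrable (w k)"
    and "0 < \<eta> \<Longrightarrow> 0 \<le> c \<Longrightarrow> c \<le> d \<Longrightarrow>
      integral {c..d} (\<lambda>s. norm (w k s)) \<le> \<eta> * (d - c) / 2 + C / (2 * \<eta>)"
proof -
  have sq: "square_integrable halfline (w k)" and C: "energy halfline (w k) \<le> C" for k
    using w by (auto simp: bounded_energy_def)
  show "0 \<le> C" using order_trans[OF energy_nonneg C] .
  show wc: "locally_integrable (w k)" for k by (rule square_integrable_halfline(1)[OF sq])
  assume \<eta>: "0 < \<eta>" and cd: "0 \<le> c" "c \<le> d"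
  let ?q = "\<lambda>s. (norm (w k s))\<^sup>2"
  have qi: "?q integrable_on {0..}" by (rule square_integrable_halfline(2)[OF sq])
  have qcd: "?q integrable_on {c..d}" using cd by (intro integrable_on_subinterval[OF qi]) auto
  have "integral {c..d} (\<lambda>s. norm (w k s)) \<le> \<eta> * (d - c) / 2 + integral {c..d} ?q / (2 * \<eta>)"
    using cd by (intro integral_norm_le_energy qcd \<eta> locally_integrable_subinterval wc)
  also have "integral {c..d} ?q \<le> integral {0..} ?q"
    using cd by (intro integral_subset_le qcd qi) auto
  also have "\<dots> \<le> C" using C[of k] square_integrable_halfline(4)[OF sq] by simp
  finally show "integral {c..d} (\<lambda>s. norm (w k s)) \<le> \<eta> * (d - c) / 2 + C / (2 * \<eta>)"
    using \<eta> by (simp add: divide_right_mono)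
qed

section \<open>Dependence of trajectories on weakly converging controls\<close>

text \<open>Convergence on the grids \<open>i / (N + 1)\<close> suffices. These countably many points are the
  times at which a diagonal subsequence of the controls has convergent primitives.\<close>

lemma equicontinuous_tendsto_uniformly:
  fixes Z :: "nat \<Rightarrow> real \<Rightarrow> 'a::real_normed_vector"
  assumes eq: "\<And>e. e > 0 \<Longrightarrow> \<exists>\<delta>>0. \<forall>k s t. 0 \<le> s \<and> s \<le> t \<and> t \<le> T \<and> t - s < \<delta> \<longrightarrow> norm (Z k t - Z k s) < e"
    and pt: "\<And>i N. real i / real (Suc N) \<le> T \<Longrightarrow> (\<lambda>k. Z k (real i / real (Suc N))) \<longlonglongrightarrow> 0"
    and e: "e > 0"
  shows "\<forall>\<^sub>F k in sequentially. \<forall>t\<in>{0..T}. norm (Z k t) < e"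
proof -
  obtain \<delta> where \<delta>: "\<delta> > 0"
    and close: "\<And>k s t. 0 \<le> s \<Longrightarrow> s \<le> t \<Longrightarrow> t \<le> T \<Longrightarrow> t - s < \<delta> \<Longrightarrow> norm (Z k t - Z k s) < e / 2"
    using eq[of "e/2"] e by fastforce
  obtain N where N: "1 / real (Suc N) < \<delta>" using nat_approx_posE[OF \<delta>] .
  define I where "I = {i. real i / real (Suc N) \<le> T}"
  have "I \<subseteq> {.. nat \<lceil>T * real (Suc N)\<rceil>}"
  proof
    fix i assume "i \<in> I"
    then have "real i \<le> T * real (Suc N)" by (simp add: I_def pos_divide_le_eq)
    then show "i \<in> {.. nat \<lceil>T * real (Suc N)\<rceil>}" by (simp add: le_nat_iff) linarith
  qed
  then have "finite I" by (rule finite_subset) simp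
  then have "\<forall>\<^sub>F k in sequentially. \<forall>i\<in>I. norm (Z k (real i / real (Suc N))) < e / 2"
  proof (rule eventually_ball_finite, intro ballI)
    fix i assume "i \<in> I"
    then have "(\<lambda>k. Z k (real i / real (Suc N))) \<longlonglongrightarrow> 0" by (intro pt) (simp add: I_def)
    then have "(\<lambda>k. norm (Z k (real i / real (Suc N)))) \<longlonglongrightarrow> 0" by (rule tendsto_norm_zero)
    then show "\<forall>\<^sub>F k in sequentially. norm (Z k (real i / real (Suc N))) < e / 2"
      using e by (intro order_tendstoD(2)) auto
  qed
  then show ?thesis
  proof eventually_elim
    case (elim k)
    show ?case
    proof
      fix t assume t: "t \<in> {0..T}"
      define i where "i = nat \<lfloor>t * real (Suc N)\<rfloor>"
      have i: "real i \<le> t * real (Suc N)" "t * real (Suc N) < real i + 1"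
        using t by (auto simp: i_def)
      then have it: "real i / real (Suc N) \<le> t" "t - real i / real (Suc N) < 1 / real (Suc N)"
        using pos_less_divide_eq[of "real (Suc N)" t "real i + 1"]
        by (simp_all add: pos_divide_le_eq add_divide_distrib del: of_nat_Suc)
      then have "i \<in> I" using t by (auto simp: I_def)
      then have "norm (Z k (real i / real (Suc N))) < e / 2" using elim by blast
      moreover have "norm (Z k t - Z k (real i / real (Suc N))) < e / 2"
        using it N t by (intro close) auto
      ultimately have "norm (Z k t - Z k (real i / real (Suc N)) + Z k (real i / real (Suc N))) < e / 2 + e / 2"
        by (intro norm_triangle_lt add_strict_mono)
      then show "norm (Z k t) < e" by simp
    qed
  qed
qed

lemma bounded_energy_equicontinuous:
  assumes w: "bounded_energy C w" and e: "e > 0"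
  shows "\<exists>\<delta>>0. \<forall>k s t. 0 \<le> s \<and> s \<le> t \<and> t - s < \<delta> \<longrightarrow> integral {s..t} (\<lambda>s. norm (w k s)) < e"
proof -
  have C: "0 \<le> C" by (rule bounded_energyD(1)[OF w])
  \<comment> \<open>makes \<open>C / (2 * \<eta>)\<close> at most \<open>e / 2\<close>, uniformly in \<open>k\<close>\<close>
  define \<eta> where "\<eta> = (C + 1) / e"
  have \<eta>: "\<eta> > 0" using C e by (simp add: \<eta>_def)
  have "integral {s..t} (\<lambda>s. norm (w k s)) < e" if "0 \<le> s" "s \<le> t" "t - s < e / \<eta>" for k s t
  proof -
    have "integral {s..t} (\<lambda>s. norm (w k s)) \<le> \<eta> * (t - s) / 2 + C / (2 * \<eta>)"
      by (intro bounded_energyD(3)[OF w] that \<eta>)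
    moreover have "\<eta> * (t - s) < e" using that(3) \<eta> by (simp add: field_simps)
    moreover have "C / (2 * \<eta>) \<le> e / 2" using C e by (simp add: \<eta>_def field_simps)
    ultimately show ?thesis by argo
  qed
  then show ?thesis using e \<eta> by (intro exI[of _ "e / \<eta>"]) auto
qed

lemma norm_integral_matrix_vector_mult_le:
  fixes A :: "real \<Rightarrow> real ^ 'm ^ 'n"
  assumes A: "continuous_on {c..d} A" and w: "w absolutely_integrable_on {c..d}"
    and b: "\<And>s. s \<in> {c..d} \<Longrightarrow> norm (A s) \<le> b"
  shows "norm (integral {c..d} (\<lambda>s. A s *v w s)) \<le> b * integral {c..d} (\<lambda>s. norm (w s))"
proof -
  have "norm (integral {c..d} (\<lambda>s. A s *v w s)) \<le> integral {c..d} (\<lambda>s. b * norm (w s))"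
  proof (rule integral_norm_bound_integral)
    show "(\<lambda>s. A s *v w s) integrable_on {c..d}"
      using absolutely_integrable_matrix_vector_mult[OF A w] by (simp add: absolutely_integrable_on_def)
    show "(\<lambda>s. b * norm (w s)) integrable_on {c..d}"
      using w by (intro integrable_on_mult_right) (simp add: absolutely_integrable_on_def)
    show "norm (A s *v w s) \<le> b * norm (w s)" if "s \<in> {c..d}" for s
      by (rule order_trans[OF norm_matrix_vector_mult_le]) (intro mult_right_mono b that norm_ge_zero)
  qed
  then show ?thesis by simp
qed

text \<open>On a short interval \<open>A\<close> is nearly constant and comes out of the integral, where convergence of the
  primitives of \<open>w k\<close> applies; the error is at most \<open>\<epsilon>\<close> times the integral of \<open>\<bar>w k\<bar>\<close>. The bound
  \<open>\<epsilon> (d - c) + \<epsilon> \<integral> \<bar>w k\<bar>\<close> is additive over adjacent intervals, so the local estimate extends to \<open>{0..T}\<close>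
  by the bisection principle \<open>Bolzano\<close>, without explicit partitions.\<close>

lemma integral_matrix_vector_mult_tendsto_0:
  fixes A :: "real \<Rightarrow> real ^ 'm ^ 'n"
  assumes w: "bounded_energy C w" and A: "continuous_on {0..T} A" and T: "0 \<le> T"
    and W: "\<And>t. 0 \<le> t \<Longrightarrow> (\<lambda>k. integral {0..t} (w k)) \<longlonglongrightarrow> 0"
  shows "(\<lambda>k. integral {0..T} (\<lambda>s. A s *v w k s)) \<longlonglongrightarrow> 0"
proof -
  have wc: "locally_integrable (w k)" for k by (rule bounded_energyD(2)[OF w])
  have wi: "w k absolutely_integrable_on {c..d}" if "0 \<le> c" for k c d
    using locally_integrable_subinterval[OF wc that] .
  have ni: "(\<lambda>s. norm (w k s)) integrable_on {c..d}" if "0 \<le> c" for k c d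
    using wi[OF that] by (simp add: absolutely_integrable_on_def)
  have Awi: "(\<lambda>s. A s *v w k s) integrable_on {c..d}" if "0 \<le> c" "d \<le> T" for k c d
  proof -
    have "continuous_on {c..d} A" using that by (intro continuous_on_subset[OF A]) auto
    from absolutely_integrable_matrix_vector_mult[OF this wi[OF that(1)]] show ?thesis
      by (simp add: absolutely_integrable_on_def)
  qed
  have Wcd: "(\<lambda>k. integral {c..d} (w k)) \<longlonglongrightarrow> 0" if "0 \<le> c" "c \<le> d" for c d
  proof -
    have "integral {c..d} (w k) = integral {0..d} (w k) - integral {0..c} (w k)" for k
      using Henstock_Kurzweil_Integration.integral_combine[of 0 c d "w k"] that wi[where c = 0 and k = k and d = d]
      by (simp add: absolutely_integrable_on_def algebra_simps)
    then show ?thesis using tendsto_diff[OF W[of d] W[of c]] that by simp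
  qed
  have claim: "\<forall>\<^sub>F k in sequentially. norm (integral {0..T} (\<lambda>s. A s *v w k s))
      \<le> \<epsilon> * (T - 0) + \<epsilon> * integral {0..T} (\<lambda>s. norm (w k s))" if \<epsilon>: "\<epsilon> > 0" for \<epsilon>
  proof -
    define P where "P c d \<longleftrightarrow> (0 \<le> c \<and> c \<le> d \<and> d \<le> T \<longrightarrow> (\<forall>\<^sub>F k in sequentially. norm (integral {c..d} (\<lambda>s. A s *v w k s))
      \<le> \<epsilon> * (d - c) + \<epsilon> * integral {c..d} (\<lambda>s. norm (w k s))))" for c d
    have "P 0 T"
      using T
    proof (rule Bolzano)
      fix a b c assume P: "P a b" "P b c" and abc: "a \<le> b" "b \<le> c"
      show "P a c"
        unfolding P_def
      proof
        assume ac: "0 \<le> a \<and> a \<le> c \<and> c \<le> T"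
        have "\<forall>\<^sub>F k in sequentially. norm (integral {a..b} (\<lambda>s. A s *v w k s)) \<le> \<epsilon> * (b - a) + \<epsilon> * integral {a..b} (\<lambda>s. norm (w k s))"
          "\<forall>\<^sub>F k in sequentially. norm (integral {b..c} (\<lambda>s. A s *v w k s)) \<le> \<epsilon> * (c - b) + \<epsilon> * integral {b..c} (\<lambda>s. norm (w k s))"
          using P abc ac by (auto simp: P_def)
        then show "\<forall>\<^sub>F k in sequentially. norm (integral {a..c} (\<lambda>s. A s *v w k s)) \<le> \<epsilon> * (c - a) + \<epsilon> * integral {a..c} (\<lambda>s. norm (w k s))"
        proof eventually_elim
          case (elim k)
          have "integral {a..c} (\<lambda>s. A s *v w k s) = integral {a..b} (\<lambda>s. A s *v w k s) + integral {b..c} (\<lambda>s. A s *v w k s)"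
            "integral {a..c} (\<lambda>s. norm (w k s)) = integral {a..b} (\<lambda>s. norm (w k s)) + integral {b..c} (\<lambda>s. norm (w k s))"
            using Henstock_Kurzweil_Integration.integral_combine[of a b c "\<lambda>s. A s *v w k s"]
              Henstock_Kurzweil_Integration.integral_combine[of a b c "\<lambda>s. norm (w k s)"] abc ac Awi ni by auto
          then show ?case
            using norm_triangle_mono[OF elim] by (simp add: algebra_simps)
        qed
      qed
    next
      fix x assume x: "0 \<le> x" "x \<le> T"
      then obtain \<delta> where \<delta>: "\<delta> > 0" "\<And>s. s \<in> {0..T} \<Longrightarrow> dist s x < \<delta> \<Longrightarrow> dist (A s) (A x) < \<epsilon>"
        using A \<epsilon> unfolding continuous_on_iff by (metis atLeastAtMost_iff)
      have "P a b" if ab: "a \<le> x" "x \<le> b" "b - a < \<delta>" for a b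
        unfolding P_def
      proof
        assume ab0: "0 \<le> a \<and> a \<le> b \<and> b \<le> T"
        show "\<forall>\<^sub>F k in sequentially. norm (integral {a..b} (\<lambda>s. A s *v w k s)) \<le> \<epsilon> * (b - a) + \<epsilon> * integral {a..b} (\<lambda>s. norm (w k s))"
        proof (cases "a = b")
          case False
          have "(\<lambda>k. norm (A x) * norm (integral {a..b} (w k))) \<longlonglongrightarrow> norm (A x) * 0"
            using ab0 by (intro tendsto_intros tendsto_norm_zero Wcd) auto
          then have "\<forall>\<^sub>F k in sequentially. norm (A x) * norm (integral {a..b} (w k)) < \<epsilon> * (b - a)"
            by (rule order_tendstoD(2)) (use False ab0 \<epsilon> in auto)
          then show ?thesis
          proof eventually_elim
            case (elim k)
            have wk: "w k absolutely_integrable_on {a..b}" using wi ab0 by blast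
            have "continuous_on {a..b} (\<lambda>s. A s - A x)"
              using ab0 by (intro continuous_intros continuous_on_subset[OF A]) auto
            then have 1: "norm (integral {a..b} (\<lambda>s. (A s - A x) *v w k s)) \<le> \<epsilon> * integral {a..b} (\<lambda>s. norm (w k s))"
            proof (rule norm_integral_matrix_vector_mult_le[OF _ wk])
              fix s assume "s \<in> {a..b}"
              then have "dist (A s) (A x) < \<epsilon>" using ab ab0 by (intro \<delta>) (auto simp: dist_real_def)
              then show "norm (A s - A x) \<le> \<epsilon>" by (simp add: dist_norm)
            qed
            have i: "(\<lambda>s. (A s - A x) *v w k s) integrable_on {a..b}" "(\<lambda>s. A x *v w k s) integrable_on {a..b}"
              using absolutely_integrable_matrix_vector_mult[OF \<open>continuous_on {a..b} (\<lambda>s. A s - A x)\<close> wk]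
                absolutely_integrable_matrix_vector_mult[OF continuous_on_const wk]
              by (auto simp: absolutely_integrable_on_def)
            have "integral {a..b} (\<lambda>s. A x *v w k s) = A x *v integral {a..b} (w k)"
              using integral_linear[of "w k" "{a..b}" "(*v) (A x)"] wk
                bounded_bilinear.bounded_linear_right[OF bounded_bilinear_matrix_vector_mult]
              by (simp add: o_def absolutely_integrable_on_def)
            then have 2: "norm (integral {a..b} (\<lambda>s. A x *v w k s)) \<le> \<epsilon> * (b - a)"
              using norm_matrix_vector_mult_le[of "A x" "integral {a..b} (w k)"] elim by simp
            have "integral {a..b} (\<lambda>s. A s *v w k s) = integral {a..b} (\<lambda>s. A x *v w k s) + integral {a..b} (\<lambda>s. (A s - A x) *v w k s)"
              by (subst Henstock_Kurzweil_Integration.integral_add[OF i(2,1), symmetric])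
                (simp add: matrix_vector_mult_diff_rdistrib)
            then show ?case using norm_triangle_mono[OF 2 1] by simp
          qed
        qed simp
      qed
      then show "\<exists>d>0. \<forall>a b. a \<le> x \<and> x \<le> b \<and> b - a < d \<longrightarrow> P a b"
        using \<delta>(1) by blast
    qed
    then show ?thesis using T by (simp add: P_def)
  qed
  define D where "D = T + (T / 2 + C / 2) + 1"
  have C: "0 \<le> C" by (rule bounded_energyD(1)[OF w])
  have D: "D > 0" using T C by (simp add: D_def)
  have wT: "T + integral {0..T} (\<lambda>s. norm (w k s)) < D" for k
  proof -
    have "integral {0..T} (\<lambda>s. norm (w k s)) \<le> 1 * (T - 0) / 2 + C / (2 * 1)"
      using T by (intro bounded_energyD(3)[OF w]) auto
    then show ?thesis by (simp add: D_def)
  qed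
  show ?thesis
  proof (rule tendstoI)
    fix e :: real assume e: "e > 0"
    have "e / D > 0" using e D by simp
    from claim[OF this] show "\<forall>\<^sub>F k in sequentially. dist (integral {0..T} (\<lambda>s. A s *v w k s)) 0 < e"
    proof eventually_elim
      case (elim k)
      have "e / D * (T + integral {0..T} (\<lambda>s. norm (w k s))) < e / D * D"
        using \<open>e / D > 0\<close> by (intro mult_strict_left_mono wT)
      then show ?case using elim D by (simp add: algebra_simps)
    qed
  qed
qed

context control_system begin

text \<open>Weak convergence of the controls implies pointwise convergence of the trajectories. The
  a priori bound depends on a control only through the integral of its norm, so all trajectories stay in one
  ball on \<open>{0..t}\<close> and a single Lipschitz constant of \<open>g\<close> serves for all \<open>k\<close>. What remains is that
  \<open>\<integral> g (y) (u k - v)\<close> tends to \<open>0\<close> uniformly in the upper limit: pointwise convergence is the previous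
  lemma, and bounded energy provides equicontinuity.\<close>

theorem integral_solution_tendsto:
  fixes u :: "nat \<Rightarrow> real \<Rightarrow> real ^ 'm"
  assumes u: "bounded_energy C u" and v: "locally_integrable v"
    and diff: "bounded_energy C' (\<lambda>k s. u k s - v s)"
    and conv: "\<And>i N. (\<lambda>k. integral {0..real i / real (Suc N)} (\<lambda>s. u k s - v s)) \<longlonglongrightarrow> 0"
    and x: "\<And>k. integral_solution (u k) x0 (x k)" and y: "integral_solution v x0 y" and t: "0 \<le> t"
  shows "(\<lambda>k. x k t) \<longlonglongrightarrow> y t"
proof -
  have uc: "locally_integrable (u k)" for k by (rule bounded_energyD(2)[OF u])
  let ?w = "\<lambda>k s. u k s - v s"
  have wc: "locally_integrable (?w k)" for k by (rule bounded_energyD(2)[OF diff])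
  have yc: "continuous_on {0..} y" using y by (simp add: integral_solution_def)
  have gy: "continuous_on {0..t} (\<lambda>s. g (y s))" for t
    using continuous_on_compose2[OF g_cont continuous_on_subset[OF yc]] by auto
  have W: "(\<lambda>k. integral {0..t} (?w k)) \<longlonglongrightarrow> 0" if t: "0 \<le> t" for t
  proof (rule tendstoI)
    fix e :: real assume e: "e > 0"
    have "\<forall>\<^sub>F k in sequentially. \<forall>r\<in>{0..t}. norm (integral {0..r} (?w k)) < e"
    proof (rule equicontinuous_tendsto_uniformly[where Z = "\<lambda>k r. integral {0..r} (?w k)", OF _ conv e])
      fix e :: real assume "e > 0"
      from bounded_energy_equicontinuous[OF diff this] obtain \<delta> where \<delta>: "\<delta> > 0"
        and small: "\<forall>k s t. 0 \<le> s \<and> s \<le> t \<and> t - s < \<delta> \<longrightarrow> integral {s..t} (\<lambda>s. norm (?w k s)) < e"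
        by blast
      have "norm (integral {0..r} (?w k) - integral {0..s} (?w k)) < e" if "0 \<le> s" "s \<le> r" "r - s < \<delta>" for k s r
      proof -
        have "integral {0..r} (?w k) - integral {0..s} (?w k) = integral {s..r} (?w k)"
          using Henstock_Kurzweil_Integration.integral_combine[of 0 s r "?w k"] that locally_integrable_subinterval[OF wc[of k], of 0 r]
          by (simp add: absolutely_integrable_on_def algebra_simps)
        also have "norm \<dots> \<le> integral {s..r} (\<lambda>s. norm (?w k s))"
          using locally_integrable_subinterval[OF wc[of k] that(1), of r] by (intro integral_norm_bound_integral) (auto simp: absolutely_integrable_on_def)
        also have "\<dots> < e" using that small by blast
        finally show ?thesis .
      qed
      then show "\<exists>\<delta>>0. \<forall>k s r. 0 \<le> s \<and> s \<le> r \<and> r \<le> t \<and> r - s < \<delta> \<longrightarrow>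
          norm (integral {0..r} (?w k) - integral {0..s} (?w k)) < e"
        using \<delta> by (intro exI[of _ \<delta>]) auto
    qed
    then show "\<forall>\<^sub>F k in sequentially. dist (integral {0..t} (?w k)) 0 < e"
      by eventually_elim (use t in auto)
  qed
  let ?Z = "\<lambda>k r. integral {0..r} (\<lambda>s. g (y s) *v ?w k s)"
  have Zsmall: "\<forall>\<^sub>F k in sequentially. \<forall>r\<in>{0..t}. norm (?Z k r) < e" if e: "e > 0" for e
  proof (rule equicontinuous_tendsto_uniformly[where Z = ?Z, OF _ _ e])
    fix e :: real assume e: "e > 0"
    then have "e / (G + 1) > 0" using G0 by simp
    from bounded_energy_equicontinuous[OF diff this] obtain \<delta> where \<delta>: "\<delta> > 0"
      and small: "\<forall>k s t. 0 \<le> s \<and> s \<le> t \<and> t - s < \<delta> \<longrightarrow> integral {s..t} (\<lambda>s. norm (?w k s)) < e / (G + 1)"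
      by blast
    have "norm (?Z k r - ?Z k s) < e" if "0 \<le> s" "s \<le> r" "r - s < \<delta>" for k s r
    proof -
      have "(\<lambda>s. g (y s) *v ?w k s) absolutely_integrable_on {0..r}"
        by (intro absolutely_integrable_matrix_vector_mult gy locally_integrable_subinterval wc order_refl)
      then have "?Z k r - ?Z k s = integral {s..r} (\<lambda>s. g (y s) *v ?w k s)"
        using Henstock_Kurzweil_Integration.integral_combine[of 0 s r "\<lambda>s. g (y s) *v ?w k s"] that
        by (simp add: absolutely_integrable_on_def algebra_simps)
      also have "norm \<dots> \<le> G * integral {s..r} (\<lambda>s. norm (?w k s))"
        using that by (intro norm_integral_matrix_vector_mult_le g_bound locally_integrable_subinterval wc continuous_on_subset[OF gy[of r]]) auto
      also have "\<dots> \<le> G * (e / (G + 1))"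
        using that small[rule_format, of s r k] G0 by (intro mult_left_mono less_imp_le[of _ "e / (G + 1)"]) auto
      also have "\<dots> < e" using e G0 by (simp add: field_simps)
      finally show ?thesis .
    qed
    then show "\<exists>\<delta>>0. \<forall>k s r. 0 \<le> s \<and> s \<le> r \<and> r \<le> t \<and> r - s < \<delta> \<longrightarrow> norm (?Z k r - ?Z k s) < e"
      using \<delta> by (intro exI[of _ \<delta>]) auto
  next
    fix i N assume "real i / real (Suc N) \<le> t"
    show "(\<lambda>k. ?Z k (real i / real (Suc N))) \<longlonglongrightarrow> 0"
      by (rule integral_matrix_vector_mult_tendsto_0[OF diff gy]) (auto intro: W)
  qed
  define U where "U = t / 2 + C / 2"
  have uU: "integral {0..t} (\<lambda>s. norm (u k s)) \<le> U" for k
  proof -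
    have "integral {0..t} (\<lambda>s. norm (u k s)) \<le> 1 * (t - 0) / 2 + C / (2 * 1)"
      using t by (intro bounded_energyD(3)[OF u]) auto
    then show ?thesis by (simp add: U_def)
  qed
  define \<rho> where "\<rho> = 2 * (norm x0 + 1 + G * U) * exp (2 * (L * t))"
  define N where "N = nat \<lceil>\<rho>\<rceil> + nat \<lceil>radius v x0 t\<rceil>"
  have rad: "radius (u k) x0 t \<le> \<rho>" for k
    unfolding radius_def \<rho>_def using uU[of k] G0 by (intro mult_right_mono mult_left_mono add_left_mono) auto
  have bound: "norm (x k s) \<le> real N \<and> norm (y s) \<le> real N" if s: "s \<in> {0..t}" for k s
  proof
    have "norm (x k s) \<le> radius (u k) x0 s" using s by (intro integral_solution_norm_le_radius uc x) auto
    also have "\<dots> \<le> radius (u k) x0 t" using s by (intro radius_mono uc) auto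
    also have "\<dots> \<le> \<rho>" by (rule rad)
    also have "\<dots> \<le> real (nat \<lceil>\<rho>\<rceil>)" by (rule real_nat_ceiling_ge)
    finally show "norm (x k s) \<le> real N" by (simp add: N_def)
    show "norm (y s) \<le> real N" using integral_solution_bounded[OF v y s] by (simp add: N_def)
  qed
  define E where "E = 2 * exp (2 * (L * t + l N * U))"
  have E: "E > 0" by (simp add: E_def)
  show ?thesis
  proof (rule tendstoI)
    fix e :: real assume e: "e > 0"
    have "e / (2 * E) > 0" using e E by simp
    from Zsmall[OF this] show "\<forall>\<^sub>F k in sequentially. dist (x k t) (y t) < e"
    proof eventually_elim
      case (elim k)
      have "norm (x k t - y t) \<le> 2 * (e / (2 * E)) * exp (2 * integral {0..t} (\<lambda>s. L + l N * norm (u k s)))"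
        using elim t by (intro integral_solution_dist_le[OF uc v x y bound, of t]) (auto intro: less_imp_le)
      also have "integral {0..t} (\<lambda>s. L + l N * norm (u k s)) = L * t + l N * integral {0..t} (\<lambda>s. norm (u k s))"
        using t by (subst Henstock_Kurzweil_Integration.integral_add)
          (auto intro!: integrable_on_mult_right locally_integrable_norm uc)
      also have "2 * (e / (2 * E)) * exp (2 * (L * t + l N * integral {0..t} (\<lambda>s. norm (u k s))))
          \<le> 2 * (e / (2 * E)) * exp (2 * (L * t + l N * U))"
        using e E uU[of k] l0 by (intro mult_left_mono) (auto intro: mult_left_mono)
      also have "\<dots> = e / 2" using E by (simp add: E_def field_simps)
      finally show ?case using e by (simp add: dist_norm)
    qed
  qed
qed

end

section \<open>Existence of optimal controls\<close>

lemma convergent_subsequence_of_bounded: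
  fixes a :: "nat \<Rightarrow> real"
  assumes "\<And>k. 0 \<le> a k" "\<And>k. a k \<le> C"
  obtains r l where "strict_mono r" "(\<lambda>k. a (r k)) \<longlonglongrightarrow> l"
proof -
  have "bounded (range a)" unfolding bounded_iff using assms by (intro exI[of _ C]) auto
  then show thesis using bounded_imp_convergent_subsequence[of a] that by (auto simp: o_def)
qed

context control_system begin

text \<open>Splitting the cost lets the two parts be treated by different arguments in the limit.\<close>

lemma cost_eq:
  fixes h :: "real ^ 'n \<Rightarrow> real"
  assumes u: "square_integrable halfline u" and hc: "continuous_on UNIV h" and h0: "\<And>x. 0 \<le> h x"
  shows "cost f g h x0 u = ennreal (energy halfline u / 2) + (\<integral>\<^sup>+ t. ennreal (h (traj f g x0 u t)) \<partial>halfline)"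
    and "(\<lambda>t. h (traj f g x0 u t)) \<in> borel_measurable halfline"
proof -
  have c: "locally_integrable u" by (rule square_integrable_halfline(1)[OF u])
  have "continuous_on {0..} (traj f g x0 u)" using traj_integral_solution[OF c] by (simp add: integral_solution_def)
  then have "continuous_on {0<..} (traj f g x0 u)" by (rule continuous_on_subset) auto
  then have "continuous_on {0<..} (\<lambda>t. h (traj f g x0 u t))" using continuous_on_compose2[OF hc] by auto
  then show hm: "(\<lambda>t. h (traj f g x0 u t)) \<in> borel_measurable halfline"
    by (intro continuous_imp_measurable_on_sets_lebesgue) auto
  have um: "u \<in> borel_measurable halfline" and ui: "integrable halfline (\<lambda>t. (norm (u t))\<^sup>2)"
    using u by (auto simp: square_integrable_def)
  have "cost f g h x0 u = (\<integral>\<^sup>+ t. ennreal (1/2 * (norm (u t))\<^sup>2 + h (traj f g x0 u t)) \<partial>halfline)"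
    by (simp add: cost_def escape_time_infinite[OF c])
  also have "\<dots> = (\<integral>\<^sup>+ t. ennreal (1/2 * (norm (u t))\<^sup>2) + ennreal (h (traj f g x0 u t)) \<partial>halfline)"
    using h0 by (intro nn_integral_cong ennreal_plus) auto
  also have "\<dots> = (\<integral>\<^sup>+ t. ennreal (1/2 * (norm (u t))\<^sup>2) \<partial>halfline) + (\<integral>\<^sup>+ t. ennreal (h (traj f g x0 u t)) \<partial>halfline)"
    using um hm by (intro nn_integral_add) auto
  also have "(\<integral>\<^sup>+ t. ennreal (1/2 * (norm (u t))\<^sup>2) \<partial>halfline) = ennreal (\<integral>t. 1/2 * (norm (u t))\<^sup>2 \<partial>halfline)"
    using ui by (intro nn_integral_eq_integral) auto
  also have "(\<integral>t. 1/2 * (norm (u t))\<^sup>2 \<partial>halfline) = energy halfline u / 2"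
    by (simp add: energy_def)
  finally show "cost f g h x0 u = ennreal (energy halfline u / 2) + (\<integral>\<^sup>+ t. ennreal (h (traj f g x0 u t)) \<partial>halfline)" .
qed

text \<open>If every cost is infinite, any control is optimal. Otherwise pass to a subsequence along which the
  energies converge to some \<open>N\<close>. The costs converge to the infimum \<open>I\<close>, hence the running costs
  converge to \<open>I - N / 2\<close>. In the limit the energy is at most \<open>N\<close> and, by Fatou's lemma,
  the running cost is at most \<open>I - N / 2\<close>.\<close>

theorem optimal_control_exists:
  fixes h :: "real ^ 'n \<Rightarrow> real"
  assumes hc: "continuous_on UNIV h" and h0: "\<And>x. 0 \<le> h x"
  obtains v where "optimal_control f g h x0 v"
proof -
  let ?L2 = "L2_controls :: (real \<Rightarrow> real ^ 'm) set" and ?J = "cost f g h x0"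
  let ?H = "\<lambda>u. \<integral>\<^sup>+ t. ennreal (h (traj f g x0 u t)) \<partial>halfline"
  define m where "m = (INF u\<in>?L2. ?J u)"
  show thesis
  proof (cases "m = \<infinity>")
    case True
    have "(\<lambda>_. 0) \<in> ?L2" by (simp add: L2_controls_def)
    moreover from this have "m \<le> ?J (\<lambda>_. 0)" unfolding m_def by (rule INF_lower)
    ultimately show thesis using True that[of "\<lambda>_. 0"] by (simp add: optimal_control_def m_def top_unique)
  next
    case False
    define I where "I = enn2real m"
    have m: "m = ennreal I" and I0: "0 \<le> I" using False by (auto simp: I_def less_top)
    have "\<exists>u\<in>?L2. ?J u < m + ennreal (1 / Suc k)" for k
      by (rule INF_approx_ennreal) (use False m_def in auto)
    then obtain u where uL2: "\<And>k. u k \<in> ?L2" and uJ: "\<And>k. ?J (u k) < m + ennreal (1 / Suc k)" by metis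
    have usq: "square_integrable halfline (u k)" for k using uL2 by (simp add: L2_controls_eq)
    define E where "E k = energy halfline (u k)" for k
    define c where "c k = enn2real (?J (u k))" for k
    have Jfin: "?J (u k) < \<infinity>" for k
      using uJ[of k] unfolding m by (rule less_le_trans) simp
    then have Jc: "?J (u k) = ennreal (c k)" and c0: "0 \<le> c k" for k by (auto simp: c_def less_top)
    have cu: "c k \<le> I + 1 / Suc k" for k
    proof -
      have "ennreal (c k) < ennreal (I + 1 / Suc k)"
        using uJ[of k] I0 by (simp add: Jc m flip: ennreal_plus)
      then show ?thesis using c0 by (simp add: ennreal_less_iff)
    qed
    have cl: "I \<le> c k" for k
    proof -
      have "m \<le> ?J (u k)" unfolding m_def by (rule INF_lower[OF uL2])
      then show ?thesis using c0 by (simp add: Jc m)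
    qed
    have cI: "c \<longlonglongrightarrow> I"
    proof (rule tendsto_sandwich[of "\<lambda>_. I" _ _ "\<lambda>k. I + 1 / Suc k"])
      have "(\<lambda>k. I + 1 / Suc k) \<longlonglongrightarrow> I + 0" by (intro tendsto_intros LIMSEQ_Suc[OF lim_1_over_n])
      then show "(\<lambda>k. I + 1 / Suc k) \<longlonglongrightarrow> I" by simp
    qed (use cl cu in auto)
    have split: "ennreal (E k / 2) + ?H (u k) = ennreal (c k)" for k
      using cost_eq(1)[OF usq[of k] hc h0, of x0] Jc[of k] by (simp add: E_def)
    have E0: "0 \<le> E k" for k by (simp add: E_def energy_nonneg)
    have Ec: "E k / 2 \<le> c k" for k
    proof -
      have "ennreal (E k / 2) \<le> ennreal (c k)" unfolding split[symmetric] by simp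
      then show ?thesis using c0 by (simp add: ennreal_le_iff)
    qed
    have H: "?H (u k) = ennreal (c k - E k / 2)" for k
    proof -
      have "?H (u k) = ennreal (E k / 2) + ?H (u k) - ennreal (E k / 2)" by simp
      also have "\<dots> = ennreal (c k - E k / 2)" unfolding split using E0 by (simp add: ennreal_minus)
      finally show ?thesis .
    qed
    have Eb: "E k \<le> 2 * (I + 1)" for k
    proof -
      have "1 / real (Suc k) \<le> 1" by simp
      then show ?thesis using Ec[of k] cu[of k] by argo
    qed
    obtain p N where p: "strict_mono p" and N: "(\<lambda>k. E (p k)) \<longlonglongrightarrow> N"
      using convergent_subsequence_of_bounded[OF E0 Eb] .
    \<comment> \<open>the intervals from \<open>0\<close> to the grid points \<open>i / (N + 1)\<close>, enumerated by a pairing function\<close>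
    define B where "B n = {0<..real (fst (prod_decode n)) / real (Suc (snd (prod_decode n)))}" for n
    obtain r v where r: "strict_mono r" and v: "square_integrable halfline v" and vN: "energy halfline v \<le> N"
      and lim: "\<And>n. (\<lambda>k. LINT t:B n|halfline. u (p (r k)) t) \<longlonglongrightarrow> (LINT t:B n|halfline. v t)"
    proof (rule bounded_energy_weak_limit[of halfline "\<lambda>k. u (p k)" N B])
      show "(\<lambda>k. energy halfline (u (p k))) \<longlonglongrightarrow> N" using N by (simp add: E_def)
    qed (use usq emeasure_halfline_finite in \<open>auto simp: B_def\<close>)
    define w where "w k = u (p (r k))" for k
    have wsq: "square_integrable halfline (w k)" for k by (simp add: w_def usq)
    have wv: "square_integrable halfline (\<lambda>s. w k s - v s)" for k by (intro square_integrable_diff wsq v)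
    have vc: "locally_integrable v" by (rule square_integrable_halfline(1)[OF v])
    have wc: "locally_integrable (w k)" for k by (rule square_integrable_halfline(1)[OF wsq])
    have conv: "(\<lambda>k. traj f g x0 (w k) t) \<longlonglongrightarrow> traj f g x0 v t" if t: "0 \<le> t" for t
    proof (rule integral_solution_tendsto[OF _ vc _ _ traj_integral_solution[OF wc] traj_integral_solution[OF vc] t])
      show "bounded_energy (2 * (I + 1)) w"
        using wsq Eb by (simp add: bounded_energy_def w_def E_def)
      show "bounded_energy (2 * (2 * (I + 1)) + 2 * energy halfline v) (\<lambda>k s. w k s - v s)"
        unfolding bounded_energy_def
      proof (intro allI conjI wv)
        fix k
        have "energy halfline (\<lambda>s. w k s + (-1) *\<^sub>R v s) \<le> (1 + 1) * energy halfline (w k) + (1 + 1 / 1) * energy halfline (\<lambda>s. (-1) *\<^sub>R v s)"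
          by (intro energy_add_le wsq square_integrable_scaleR v) simp
        moreover have "energy halfline (\<lambda>s. (-1) *\<^sub>R v s) = energy halfline v" by (simp add: energy_def)
        moreover have "energy halfline (w k) \<le> 2 * (I + 1)" using Eb by (simp add: w_def E_def)
        ultimately show "energy halfline (\<lambda>s. w k s - v s) \<le> 2 * (2 * (I + 1)) + 2 * energy halfline v" by simp
      qed
      fix i n :: nat
      let ?q = "real i / real (Suc n)"
      have "(\<lambda>k. LINT t:{0<..?q}|halfline. w k t) \<longlonglongrightarrow> (LINT t:{0<..?q}|halfline. v t)"
        using lim[of "prod_encode (i, n)"] by (simp add: B_def w_def)
      then have "(\<lambda>k. integral {0..?q} (w k) - integral {0..?q} v) \<longlonglongrightarrow> 0"
        unfolding square_integrable_halfline(3)[OF wsq] square_integrable_halfline(3)[OF v] by (simp add: LIM_zero_iff)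
      moreover have "integral {0..?q} (\<lambda>s. w k s - v s) = integral {0..?q} (w k) - integral {0..?q} v" for k
        using wc[of k] vc by (intro Henstock_Kurzweil_Integration.integral_diff)
          (auto simp: locally_integrable_def absolutely_integrable_on_def)
      ultimately show "(\<lambda>k. integral {0..?q} (\<lambda>s. w k s - v s)) \<longlonglongrightarrow> 0" by simp
    qed
    have "?H v \<le> (\<integral>\<^sup>+ t. liminf (\<lambda>k. ennreal (h (traj f g x0 (w k) t))) \<partial>halfline)"
    proof (rule nn_integral_mono)
      fix t assume "t \<in> space halfline"
      then have "(\<lambda>k. traj f g x0 (w k) t) \<longlonglongrightarrow> traj f g x0 v t" by (intro conv) simp
      then have "(\<lambda>k. h (traj f g x0 (w k) t)) \<longlonglongrightarrow> h (traj f g x0 v t)"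
        by (rule continuous_on_tendsto_compose[OF hc]) auto
      then have "(\<lambda>k. ennreal (h (traj f g x0 (w k) t))) \<longlonglongrightarrow> ennreal (h (traj f g x0 v t))"
        by (rule tendsto_ennrealI)
      from lim_imp_Liminf[OF sequentially_bot this]
      show "ennreal (h (traj f g x0 v t)) \<le> liminf (\<lambda>k. ennreal (h (traj f g x0 (w k) t)))" by simp
    qed
    also have "\<dots> \<le> liminf (\<lambda>k. ?H (w k))"
      using cost_eq(2)[OF wsq hc h0] by (intro nn_integral_liminf) auto
    also have "\<dots> = ennreal (I - N / 2)"
    proof (rule lim_imp_Liminf[OF sequentially_bot])
      have "(\<lambda>k. c (p (r k))) \<longlonglongrightarrow> I"
        using LIMSEQ_subseq_LIMSEQ[OF LIMSEQ_subseq_LIMSEQ[OF cI p] r] by (simp add: o_def)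
      moreover have "(\<lambda>k. E (p (r k))) \<longlonglongrightarrow> N"
        using LIMSEQ_subseq_LIMSEQ[OF N r] by (simp add: o_def)
      ultimately have "(\<lambda>k. c (p (r k)) - E (p (r k)) / 2) \<longlonglongrightarrow> I - N / 2"
        by (intro tendsto_intros) auto
      then show "(\<lambda>k. ?H (w k)) \<longlonglongrightarrow> ennreal (I - N / 2)"
        unfolding w_def H by (rule tendsto_ennrealI)
    qed
    finally have Hv: "?H v \<le> ennreal (I - N / 2)" .
    have IN: "N / 2 \<le> I" "0 \<le> N"
    proof -
      have "(\<lambda>k. E (p k) / 2) \<longlonglongrightarrow> N / 2" "(\<lambda>k. c (p k)) \<longlonglongrightarrow> I"
        using N LIMSEQ_subseq_LIMSEQ[OF cI p] by (auto simp: o_def intro: tendsto_intros)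
      then show "N / 2 \<le> I" by (rule LIMSEQ_le) (use Ec in auto)
      show "0 \<le> N" by (rule LIMSEQ_le_const[OF N]) (use E0 in auto)
    qed
    have "?J v \<le> ennreal (N / 2) + ennreal (I - N / 2)"
      unfolding cost_eq(1)[OF v hc h0] using vN by (intro add_mono Hv ennreal_leI) auto
    also have "\<dots> = m" unfolding m using IN by (simp flip: ennreal_plus)
    finally have "?J v \<le> m" .
    moreover have "v \<in> ?L2" using v by (simp add: L2_controls_eq)
    moreover from this have "m \<le> ?J v" unfolding m_def by (rule INF_lower)
    ultimately show thesis using that[of v] by (simp add: optimal_control_def m_def)
  qed
qed

end

lemma C2_has_derivative:
  fixes F :: "'a::real_normed_vector \<Rightarrow> 'b::real_normed_vector"
  assumes F: "C2 F"
  obtains D where "\<And>x. (F has_derivative blinfun_apply (D x)) (at x)" "continuous_on UNIV D"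
proof -
  obtain D D2 where D: "\<forall>x. (F has_derivative blinfun_apply (D x)) (at x)"
    "\<forall>x. (D has_derivative blinfun_apply (D2 x)) (at x)"
    using F unfolding C2_def by blast
  have "continuous_on UNIV D"
    using D(2) has_derivative_continuous by (blast intro: continuous_at_imp_continuous_on)
  with D(1) show thesis by (intro that) auto
qed

lemma locally_lipschitz_imp_continuous:
  assumes "locally_lipschitz h"
  shows "continuous_on UNIV h"
proof (rule continuous_at_imp_continuous_on, rule ballI)
  fix x
  obtain e L where e: "e > 0" and "L-lipschitz_on (cball x e) h"
    using assms unfolding locally_lipschitz_def by blast
  then have "continuous_on (ball x e) h"
    using lipschitz_on_continuous_on continuous_on_subset ball_subset_cball by blast
  then show "isCont h x" using e by (simp add: continuous_on_eq_continuous_at)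
qed

text \<open>The derivative is continuous, hence bounded on compact balls. Summing the absolute values of the
  bounds makes the constants monotone in the radius.\<close>

lemma C2_lipschitz_on_balls:
  fixes F :: "'a::euclidean_space \<Rightarrow> 'b::real_normed_vector"
  assumes F: "C2 F"
  obtains l :: "nat \<Rightarrow> real" where "mono l" "\<And>n. 0 \<le> l n"
    "\<And>n y z. norm y \<le> real n \<Longrightarrow> norm z \<le> real n \<Longrightarrow> norm (F y - F z) \<le> l n * norm (y - z)"
proof -
  obtain D where D: "\<And>x. (F has_derivative blinfun_apply (D x)) (at x)" "continuous_on UNIV D"
    using C2_has_derivative[OF F] by blast
  have "\<exists>b. \<forall>x\<in>cball 0 (real n). norm (D x) \<le> b" for n
  proof -
    have "compact (D ` cball 0 (real n))"
      by (intro compact_continuous_image continuous_on_subset[OF D(2)]) auto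
    from compact_imp_bounded[OF this] show ?thesis unfolding bounded_iff by auto
  qed
  then obtain b where b: "\<And>n x. x \<in> cball 0 (real n) \<Longrightarrow> norm (D x) \<le> b n" by metis
  define l where "l n = (\<Sum>i\<le>n. \<bar>b i\<bar>)" for n
  show thesis
  proof
    show "mono l" by (auto simp: mono_iff_le_Suc l_def)
    show "0 \<le> l n" for n by (auto simp: l_def intro: sum_nonneg)
    fix n and y z :: 'a assume yz: "norm y \<le> real n" "norm z \<le> real n"
    have "b n \<le> l n"
      using member_le_sum[of n "{..n}" "\<lambda>i. \<bar>b i\<bar>"] by (simp add: l_def)
    show "norm (F y - F z) \<le> l n * norm (y - z)"
    proof (rule differentiable_bound[OF convex_cball[of 0 "real n"]])
      show "(F has_derivative blinfun_apply (D x)) (at x within cball 0 (real n))" for x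
        by (rule has_derivative_at_withinI[OF D(1)])
      show "onorm (blinfun_apply (D x)) \<le> l n" if "x \<in> cball 0 (real n)" for x
        using b[OF that] \<open>b n \<le> l n\<close> by (simp add: norm_blinfun.rep_eq)
    qed (use yz in auto)
  qed
qed

lemma bounded_derivative_imp_lipschitz:
  fixes F :: "'a::real_normed_vector \<Rightarrow> 'b::real_normed_vector"
  assumes F: "C2 F" and M: "\<And>x. onorm (frechet_derivative F (at x)) \<le> M"
  shows "norm (F y - F z) \<le> M * norm (y - z)"
proof -
  obtain D where D: "\<And>x. (F has_derivative blinfun_apply (D x)) (at x)"
    using C2_has_derivative[OF F] by blast
  then have "(F has_derivative frechet_derivative F (at x)) (at x)" for x
    using frechet_derivative_works by (auto simp: differentiable_def)
  then show ?thesis using M by (intro differentiable_bound[OF convex_UNIV]) auto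
qed

theorem theorem2p3:
  fixes f :: "real ^ 'n \<Rightarrow> real ^ 'n"
    and g :: "real ^ 'n \<Rightarrow> real ^ 'm ^ 'n"
    and h :: "real ^ 'n \<Rightarrow> real"
  assumes "C2 f" and "C2 g" and "f 0 = 0"
    and "locally_lipschitz h" and "\<forall>x. h x \<ge> 0" and "h 0 = 0"
    and "bounded (range g)"
    and "\<exists>M. \<forall>x. onorm (frechet_derivative f (at x)) \<le> M"
    and "globally_exponentially_stable f"
  shows "\<forall>x0. \<exists>u. optimal_control f g h x0 u \<and>
           trajectory_on f g x0 u {0..} (traj f g x0 u) \<and>
           (traj f g x0 u \<longlongrightarrow> 0) at_top"
proof
  fix x0
  obtain M where M: "\<And>x. onorm (frechet_derivative f (at x)) \<le> M" using assms(8) by blast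
  have f_lip: "norm (f y - f z) \<le> max M 0 * norm (y - z)" for y z
    using bounded_derivative_imp_lipschitz[OF assms(1) M, of y z]
    by (rule order_trans) (intro mult_right_mono, auto)
  obtain G where G: "G > 0" "\<And>y. norm (g y) \<le> G" using assms(7) unfolding bounded_pos by blast
  obtain l where l: "mono l" "\<And>n. 0 \<le> l n"
    "\<And>n y z. norm y \<le> real n \<Longrightarrow> norm z \<le> real n \<Longrightarrow> norm (g y - g z) \<le> l n * norm (y - z)"
    using C2_lipschitz_on_balls[OF assms(2)] by blast
  obtain D where "\<And>x. (g has_derivative blinfun_apply (D x)) (at x)"
    using C2_has_derivative[OF assms(2)] by blast
  then have gc: "continuous_on UNIV g"
    by (intro continuous_at_imp_continuous_on) (auto intro: has_derivative_continuous)
  interpret control_system f g "max M 0" G l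
    by unfold_locales (use f_lip G l gc assms(3) in auto)
  obtain u where u: "optimal_control f g h x0 u"
    using optimal_control_exists[OF locally_lipschitz_imp_continuous[OF assms(4)]] assms(5) by blast
  then have sq: "square_integrable halfline u" by (simp add: optimal_control_def L2_controls_eq)
  have c: "locally_integrable u" by (rule square_integrable_halfline(1)[OF sq])
  have "trajectory_on f g x0 u {0..} (traj f g x0 u)"
    using traj_integral_solution[OF c] by (simp add: trajectory_iff_integral_solution[OF c])
  moreover have "(traj f g x0 u \<longlongrightarrow> 0) at_top"
    by (rule integral_solution_tendsto_0[OF assms(9) c square_integrable_halfline(2)[OF sq] traj_integral_solution[OF c]])
  ultimately show "\<exists>u. optimal_control f g h x0 u \<and>
           trajectory_on f g x0 u {0..} (traj f g x0 u) \<and> (traj f g x0 u \<longlongrightarrow> 0) at_top"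
    using u by blast
qed

end
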